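(* Let $\mathbb L(\lambda)=\mathbb M_{(\tau_1,\sigma_1)}(Y_1,X_1)\,(\lambda\mathbb M^{\mathcal S}_\tau-\mathbb M^{\mathcal S}_\sigma)\,\mathbb M_{(\sigma_2,\tau_2)}(X_2,Y_2)$ be a GFPR of $\mathcal S(\lambda)$ with nonsingular matrix assignments $X_1,X_2,Y_1,Y_2$. Suppose that $\mathcal S(\lambda)$ is regular and $\mu\in\mathbb C$ is an eigenvalue of $\mathcal S(\lambda)$. Let $Z=\begin{bmatrix}Z_{mn}\\ Z_r\end{bmatrix}$ be an $(mn+r)\times p$ matrix such that $\mathrm{rank}(Z)=p$, where $Z_{mn}$ has $mn$ rows and $Z_r$ has $r$ rows. If $Z$ is a basis of $\mathcal N_r(\mathbb L(\mu))$ (resp., $\mathcal N_l(\mathbb L(\mu))$) then $\begin{bmatrix}(e^T_{m-c_0(\sigma,\sigma_2)}\otimes I_n)Z_{mn}\\ Z_r\end{bmatrix}$ (resp., $\begin{bmatrix}(e^T_{m-i_0(\sigma_1,\sigma)}\otimes I_n)Z_{mn}\\ Z_r\end{bmatrix}$) is a basis of $\mathcal N_r(\mathcal S(\mu))$ (resp., $\mathcal N_l(\mathcal S(\mu))$).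
   Context: Setting: $P(\lambda)=\sum_{i=0}^m\lambda^iA_i$ with $A_i\in\mathbb C^{n\times n}$, $A_m\neq0$, $m\ge1$; $G(\lambda)=P(\lambda)+C(\lambda E-A)^{-1}B$ is a minimal realization ($r$ smallest possible) with $A,E\in\mathbb C^{r\times r}$, $E$ nonsingular, $C\in\mathbb C^{n\times r}$, $B\in\mathbb C^{r\times n}$; system matrix $\mathcal S(\lambda)=\left[\begin{array}{c|c}P(\lambda)&C\\ \hline B&A-\lambda E\end{array}\right]$. $e_j$ is the $j$-th column of $I_m$. Elementary matrices: for $X\in\mathbb C^{n\times n}$, $M_0(X)=\mathrm{diag}(I_{(m-1)n},X)$, $M_{-m}(X)=\mathrm{diag}(X,I_{(m-1)n})$, and for $1\le i\le m-1$, $M_i(X)=\mathrm{diag}\big(I_{(m-i-1)n},\begin{bmatrix}X&I_n\\ I_n&0\end{bmatrix},I_{(i-1)n}\big)$, $M_{-i}(X)=\mathrm{diag}\big(I_{(m-i-1)n},\begin{bmatrix}0&I_n\\ I_n&X\end{bmatrix},I_{(i-1)n}\big)$. For $i\in\{-m,\dots,m-1\}$: $\mathbb M_i(X)=\mathrm{diag}(M_i(X),I_r)$; $M_i^P=M_i(-A_i)$ if $i\ge0$, $M_i^P=M_i(A_{-i})$ if $i<0$. Fiedler matrices: $\mathbb M_0^{\mathcal S}=\left[\begin{array}{c|c}M_0^P&-e_m\otimes C\\ \hline -e_m^T\otimes B&-A\end{array}\right]$, $\mathbb M_{-m}^{\mathcal S}=\mathrm{diag}(M_{-m}^P,-E)$,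 $\mathbb M_i^{\mathcal S}=\mathrm{diag}(M_i^P,I_r)$ and $\mathbb M_{-i}^{\mathcal S}=(\mathbb M_i^{\mathcal S})^{-1}$ for $1\le i\le m-1$. Index tuples: $\mathbf t=(t_1,\dots,t_k)$ is an ordered tuple of integers (possibly empty); permutations are regarded as tuples; $(\alpha,\beta)$ is concatenation. A matrix assignment for $\mathbf t$ is a tuple $X=(X_1,\dots,X_k)$ of $n\times n$ matrices; it is nonsingular if the matrices at positions occupied by the indices $0$ and $-m$ are nonsingular. $\mathbb M_{\mathbf t}(X)=\mathbb M_{t_1}(X_1)\cdots\mathbb M_{t_k}(X_k)$, $\mathbb M^{\mathcal S}_{\mathbf t}=\mathbb M^{\mathcal S}_{t_1}\cdots\mathbb M^{\mathcal S}_{t_k}$ (empty product $=$ identity); $\mathbb M_{(\tau_1,\sigma_1)}(Y_1,X_1)=\mathbb M_{\tau_1}(Y_1)\mathbb M_{\sigma_1}(X_1)$, etc. $\mathbf t$ satisfies the SIP if whenever $t_a=t_b$, $a<b$, there is $a<c<b$ with $t_c=t_a+1$. For a tuple $\beta$ of nonnegative indices containing $0$, $c_0(\beta)$ (resp. $i_0(\beta)$) is the largest $p\ge0$ such that $(0,1,\dots,p)$ (resp. $(p,\dots,1,0)$) is a subtuple of $\beta$ (obtained by deleting entries). GFPR of $\mathcal S(\lambda)$: a pencil of the form displayed in the claim, where $0\le h\le m-1$; $\sigma,\tau$ are permutations of $\{0,\dots,h\}$ and $\{-m,\dots,-h-1\}$; $\sigma_1,\sigma_2$ are index tuples from $\{0,\dots,h-1\}$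 with $(\sigma_1,\sigma,\sigma_2)$ satisfying the SIP; $\tau_1,\tau_2$ are index tuples from $\{-m,\dots,-h-2\}$ with $(\tau_1,\tau,\tau_2)$ satisfying the SIP; $X_j,Y_j$ are matrix assignments for $\sigma_j,\tau_j$. $\mathcal S(\lambda)$ is regular if $\det\mathcal S(\lambda)\not\equiv0$; $\mu$ is an eigenvalue if $\det\mathcal S(\mu)=0$. For a constant matrix $F$, $\mathcal N_r(F)=\{x:Fx=0\}$ and $\mathcal N_l(F)=\{x:x^TF=0\}$; a matrix is said to be a basis of a subspace if its columns form a basis of it. *)

theory Defs
  imports
    "HOL-Library.Sublist"
    "HOL-Combinatorics.Multiset_Permutations"
    "Jordan_Normal_Form.Matrix_Kernel"
    "Jordan_Normal_Form.DL_Rank"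
begin

section \<open>Matrices\<close>

text \<open>The Kronecker product: the block at position \<open>(k, l)\<close> of \<open>kron A B\<close> is \<open>A\<^sub>k\<^sub>l B\<close>.\<close>

definition kron :: "'a :: semiring_1 mat \<Rightarrow> 'a mat \<Rightarrow> 'a mat" where
  "kron A B = mat (dim_row A * dim_row B) (dim_col A * dim_col B)
     (\<lambda>(i, j). A $$ (i div dim_row B, j div dim_col B) * B $$ (i mod dim_row B, j mod dim_col B))"

text \<open>The column \<open>e\<^sub>j\<close> of the identity matrix of order \<open>m\<close>, as an \<open>m \<times> 1\<close> matrix.
  The index \<open>j\<close> is one-based, whereas the entries of a \<open>mat\<close> are counted from zero.\<close>

definition unit_col :: "nat \<Rightarrow> nat \<Rightarrow> 'a :: semiring_1 mat" where
  "unit_col m j = mat m 1 (\<lambda>(i, _). if Suc i = j then 1 else 0)"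

text \<open>To be used only for nonsingular square matrices.\<close>

abbreviation mat_inv :: "complex mat \<Rightarrow> complex mat" where
  "mat_inv M \<equiv> the (mat_inverse M)"

definition mat_prod :: "nat \<Rightarrow> complex mat list \<Rightarrow> complex mat" where
  "mat_prod N Ms = foldr (*) Ms (1\<^sub>m N)"

abbreviation right_null_space :: "complex mat \<Rightarrow> complex vec set" where
  "right_null_space \<equiv> mat_kernel"

text \<open>The condition is \<open>x\<^sup>T F = 0\<close>, with transpose and not conjugate transpose.\<close>

definition left_null_space :: "complex mat \<Rightarrow> complex vec set" where
  "left_null_space F = {x \<in> carrier_vec (dim_row F). mat_of_row x * F = 0\<^sub>m 1 (dim_col F)}"

text \<open>Since \<open>vectorspace.basis\<close> takes a set of vectors, it cannot detect repeated columns;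
  these are excluded separately.\<close>

definition columns_form_basis :: "complex mat \<Rightarrow> complex vec set \<Rightarrow> bool" where
  "columns_form_basis Z W \<longleftrightarrow> distinct (cols Z) \<and>
     vectorspace.basis class_ring ((module_vec TYPE(complex) (dim_row Z))\<lparr>carrier := W\<rparr>) (set (cols Z))"

section \<open>The system matrix\<close>

definition mat_poly :: "nat \<Rightarrow> nat \<Rightarrow> (nat \<Rightarrow> complex mat) \<Rightarrow> complex \<Rightarrow> complex mat" where
  "mat_poly n m Ac lam = mat n n (\<lambda>(i, j). \<Sum>k\<le>m. lam ^ k * Ac k $$ (i, j))"

definition rat_mat ::
  "nat \<Rightarrow> nat \<Rightarrow> (nat \<Rightarrow> complex mat) \<Rightarrow> complex mat \<Rightarrow> complex mat \<Rightarrow> complex mat \<Rightarrow> complex mat \<Rightarrow>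
   complex \<Rightarrow> complex mat" where
  "rat_mat n m Ac A E B C lam = mat_poly n m Ac lam + C * mat_inv (lam \<cdot>\<^sub>m E - A) * B"

definition realization_data ::
  "nat \<Rightarrow> nat \<Rightarrow> complex mat \<Rightarrow> complex mat \<Rightarrow> complex mat \<Rightarrow> complex mat \<Rightarrow> bool" where
  "realization_data n r A E B C \<longleftrightarrow>
     A \<in> carrier_mat r r \<and> E \<in> carrier_mat r r \<and> invertible_mat E \<and>
     B \<in> carrier_mat r n \<and> C \<in> carrier_mat n r"

text \<open>A realization of order \<open>r\<close> is minimal if every realization of the same rational matrix has
  order at least \<open>r\<close>. Equality of two rational matrices is equality at all points where both
  resolvents exist, that is, off a finite set, as \<open>E\<close> and \<open>E'\<close> are nonsingular. For the same
  reason the second summand vanishes at infinity, so the polynomial part is determined by the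
  rational matrix and can be kept fixed.\<close>

definition minimal_realization ::
  "nat \<Rightarrow> nat \<Rightarrow> nat \<Rightarrow> (nat \<Rightarrow> complex mat) \<Rightarrow>
   complex mat \<Rightarrow> complex mat \<Rightarrow> complex mat \<Rightarrow> complex mat \<Rightarrow> bool" where
  "minimal_realization n m r Ac A E B C \<longleftrightarrow>
     realization_data n r A E B C \<and>
     (\<forall>r' A' E' B' C'.
        realization_data n r' A' E' B' C' \<and>
        (\<forall>lam. det (lam \<cdot>\<^sub>m E - A) \<noteq> 0 \<and> det (lam \<cdot>\<^sub>m E' - A') \<noteq> 0 \<longrightarrow>
           rat_mat n m Ac A' E' B' C' lam = rat_mat n m Ac A E B C lam)
        \<longrightarrow> r \<le> r')"

definition sys_mat ::
  "nat \<Rightarrow> nat \<Rightarrow> (nat \<Rightarrow> complex mat) \<Rightarrow> complex mat \<Rightarrow> complex mat \<Rightarrow> complex mat \<Rightarrow> complex mat \<Rightarrow>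
   complex \<Rightarrow> complex mat" where
  "sys_mat n m Ac A E B C lam = four_block_mat (mat_poly n m Ac lam) C B (A - lam \<cdot>\<^sub>m E)"

section \<open>Elementary matrices and Fiedler matrices\<close>

text \<open>The order \<open>r\<close> of the state space is a parameter of those matrices that act on all \<open>m n + r\<close>
  coordinates. The index \<open>i\<close> ranges over \<open>{- int m .. int m - 1}\<close>.\<close>

definition elem_mat0 :: "nat \<Rightarrow> nat \<Rightarrow> int \<Rightarrow> complex mat \<Rightarrow> complex mat" where
  "elem_mat0 n m i X =
     (if i = 0 then diag_block_mat [1\<^sub>m ((m - 1) * n), X]
      else if i = - int m then diag_block_mat [X, 1\<^sub>m ((m - 1) * n)]
      else if i > 0 then
        diag_block_mat [1\<^sub>m ((m - nat i - 1) * n),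
          four_block_mat X (1\<^sub>m n) (1\<^sub>m n) (0\<^sub>m n n),
          1\<^sub>m ((nat i - 1) * n)]
      else
        diag_block_mat [1\<^sub>m ((m - nat (- i) - 1) * n),
          four_block_mat (0\<^sub>m n n) (1\<^sub>m n) (1\<^sub>m n) X,
          1\<^sub>m ((nat (- i) - 1) * n)])"

definition elem_mat :: "nat \<Rightarrow> nat \<Rightarrow> nat \<Rightarrow> int \<Rightarrow> complex mat \<Rightarrow> complex mat" where
  "elem_mat n m r i X = diag_block_mat [elem_mat0 n m i X, 1\<^sub>m r]"

definition fiedler_poly :: "nat \<Rightarrow> nat \<Rightarrow> (nat \<Rightarrow> complex mat) \<Rightarrow> int \<Rightarrow> complex mat" where
  "fiedler_poly n m Ac i = elem_mat0 n m i (if i \<ge> 0 then - Ac (nat i) else Ac (nat (- i)))"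

definition fiedler_sys ::
  "nat \<Rightarrow> nat \<Rightarrow> nat \<Rightarrow> (nat \<Rightarrow> complex mat) \<Rightarrow>
   complex mat \<Rightarrow> complex mat \<Rightarrow> complex mat \<Rightarrow> complex mat \<Rightarrow> int \<Rightarrow> complex mat" where
  "fiedler_sys n m r Ac A E B C i =
     (if i = 0 then
        four_block_mat (fiedler_poly n m Ac 0) (- kron (unit_col m m) C)
          (- kron (transpose_mat (unit_col m m)) B) (- A)
      else if i = - int m then diag_block_mat [fiedler_poly n m Ac i, - E]
      else if i > 0 then diag_block_mat [fiedler_poly n m Ac i, 1\<^sub>m r]
      else mat_inv (diag_block_mat [fiedler_poly n m Ac (- i), 1\<^sub>m r]))"

definition elem_prod :: "nat \<Rightarrow> nat \<Rightarrow> nat \<Rightarrow> int list \<Rightarrow> complex mat list \<Rightarrow> complex mat" where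
  "elem_prod n m r t X = mat_prod (m * n + r) (map2 (elem_mat n m r) t X)"

definition fiedler_prod ::
  "nat \<Rightarrow> nat \<Rightarrow> nat \<Rightarrow> (nat \<Rightarrow> complex mat) \<Rightarrow>
   complex mat \<Rightarrow> complex mat \<Rightarrow> complex mat \<Rightarrow> complex mat \<Rightarrow> int list \<Rightarrow> complex mat" where
  "fiedler_prod n m r Ac A E B C t = mat_prod (m * n + r) (map (fiedler_sys n m r Ac A E B C) t)"

section \<open>Index tuples\<close>

definition SIP :: "int list \<Rightarrow> bool" where
  "SIP t \<longleftrightarrow> (\<forall>a b. a < b \<and> b < length t \<and> t ! a = t ! b \<longrightarrow>
     (\<exists>c. a < c \<and> c < b \<and> t ! c = t ! a + 1))"

definition c0 :: "int list \<Rightarrow> nat" where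
  "c0 beta = Max {p. subseq [0..int p] beta}"

definition i0 :: "int list \<Rightarrow> nat" where
  "i0 beta = Max {p. subseq (rev [0..int p]) beta}"

definition matrix_assignment :: "nat \<Rightarrow> int list \<Rightarrow> complex mat list \<Rightarrow> bool" where
  "matrix_assignment n t X \<longleftrightarrow> length X = length t \<and> set X \<subseteq> carrier_mat n n"

definition nonsingular_assignment :: "nat \<Rightarrow> int list \<Rightarrow> complex mat list \<Rightarrow> bool" where
  "nonsingular_assignment m t X \<longleftrightarrow>
     (\<forall>j < length t. t ! j \<in> {0, - int m} \<longrightarrow> invertible_mat (X ! j))"

definition gfpr_data ::
  "nat \<Rightarrow> nat \<Rightarrow> nat \<Rightarrow> int list \<Rightarrow> int list \<Rightarrow> int list \<Rightarrow> int list \<Rightarrow> int list \<Rightarrow> int list \<Rightarrow>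
   complex mat list \<Rightarrow> complex mat list \<Rightarrow> complex mat list \<Rightarrow> complex mat list \<Rightarrow> bool" where
  "gfpr_data n m h \<sigma> \<tau> \<sigma>1 \<sigma>2 \<tau>1 \<tau>2 X1 X2 Y1 Y2 \<longleftrightarrow>
     h \<le> m - 1 \<and>
     \<sigma> \<in> permutations_of_set {0..int h} \<and>
     \<tau> \<in> permutations_of_set {- int m..- int h - 1} \<and>
     set \<sigma>1 \<subseteq> {0..int h - 1} \<and> set \<sigma>2 \<subseteq> {0..int h - 1} \<and> SIP (\<sigma>1 @ \<sigma> @ \<sigma>2) \<and>
     set \<tau>1 \<subseteq> {- int m..- int h - 2} \<and> set \<tau>2 \<subseteq> {- int m..- int h - 2} \<and> SIP (\<tau>1 @ \<tau> @ \<tau>2) \<and>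
     matrix_assignment n \<sigma>1 X1 \<and> matrix_assignment n \<sigma>2 X2 \<and>
     matrix_assignment n \<tau>1 Y1 \<and> matrix_assignment n \<tau>2 Y2"

definition gfpr ::
  "nat \<Rightarrow> nat \<Rightarrow> nat \<Rightarrow> (nat \<Rightarrow> complex mat) \<Rightarrow>
   complex mat \<Rightarrow> complex mat \<Rightarrow> complex mat \<Rightarrow> complex mat \<Rightarrow>
   int list \<Rightarrow> int list \<Rightarrow> int list \<Rightarrow> int list \<Rightarrow> int list \<Rightarrow> int list \<Rightarrow>
   complex mat list \<Rightarrow> complex mat list \<Rightarrow> complex mat list \<Rightarrow> complex mat list \<Rightarrow>
   complex \<Rightarrow> complex mat" where
  "gfpr n m r Ac A E B C \<sigma> \<tau> \<sigma>1 \<sigma>2 \<tau>1 \<tau>2 X1 X2 Y1 Y2 lam =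
     (elem_prod n m r \<tau>1 Y1 * elem_prod n m r \<sigma>1 X1) *
     (lam \<cdot>\<^sub>m fiedler_prod n m r Ac A E B C \<tau> - fiedler_prod n m r Ac A E B C \<sigma>) *
     (elem_prod n m r \<sigma>2 X2 * elem_prod n m r \<tau>2 Y2)"

end

theory Submission
  imports Defs
begin

text \<open>
  Fix the point \<open>\<mu>\<close>. Extracting one block of \<open>n\<close> coordinates together with the last \<open>r\<close> coordinates
  is a linear map, and a linear bijection maps bases to bases; so it is enough that this map is a
  bijection from the null space of \<open>L \<mu>\<close> onto that of \<open>S \<mu>\<close>.

  Left null spaces are right null spaces of the transpose. The transpose of a pencil of the given
  form belongs to the transposed system and has all index tuples reversed, which turns \<open>i0\<close> into
  \<open>c0\<close>. Only right null spaces remain.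

  A vector with \<open>m n + r\<close> entries is written as a pair \<open>(v, u)\<close>, where \<open>v k\<close> is the \<open>k\<close>-th
  block counted from the bottom, starting with \<open>k = 0\<close>, and \<open>u\<close> has \<open>r\<close> entries. In these coordinates
  an elementary or Fiedler matrix of index \<open>k\<close> or \<open>- k\<close> with \<open>0 < k < m\<close> changes the blocks
  \<open>v k\<close> and \<open>v (k - 1)\<close> only: it swaps them and adds a multiple of one of them. The extraction
  in the theorem reads off \<open>(v (c0 (\<sigma> @ \<sigma>2)), u)\<close>.

  The outer factors are invertible, because the assignments are nonsingular. The left ones
  do not affect the null space; the right ones are absorbed one index at a time. The SIP forbids an
  index equal to the current value \<open>q\<close> of \<open>c0\<close>; hence block \<open>q\<close> after the action of an elementary matrix
  is block \<open>q + 1\<close> before it if the index is \<open>q + 1\<close>, and block \<open>q\<close> otherwise, which is how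
  \<open>c0\<close> changes when the index is appended (\<open>elem_act_c0\<close>).

  There remains the equation \<open>M\<^sub>\<sigma> w = \<mu> M\<^sub>\<tau> w\<close> of a Fiedler pencil. Two reductions turn it into the
  equation of the system matrix, and each is a bijection of solution sets that respects the
  extracted pair.

  \<^item> The highest index \<open>h\<close> of \<open>\<sigma>\<close> commutes with every index except \<open>h - 1\<close>, so its factor can
    be pushed to an end of \<open>M\<^sub>\<sigma>\<close> and then divided out, which puts \<open>- h\<close> into \<open>\<tau>\<close>
    (\<open>move_highest_index\<close>). At the right end the division changes the unknown by \<open>M\<^sub>h\<close>, and the
    effect of this on the block \<open>c0 \<sigma>\<close> is the effect of removing \<open>h\<close> on \<open>c0\<close> (\<open>c0_insert_max\<close>).
    After \<open>h\<close> steps \<open>\<sigma>\<close> consists of the index 0.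
  \<^item> If \<open>\<sigma>\<close> consists of the index 0, the top block row determines the top block as \<open>\<mu>\<close>
    times a linear expression in the other blocks.
    Inserting it leaves the same problem for degree \<open>m - 1\<close>, where the new leading coefficient is
    \<open>A\<^bsub>m-1\<^esub> + \<mu> A\<^sub>m\<close> (\<open>drop_degree\<close>). This Horner step does not change \<open>P(\<mu>)\<close>, and for degree 1 the
    pencil is the system matrix.
\<close>

section \<open>Index tuples\<close>

lemma upto_snoc: "[0..int (Suc p)] = [0..int p] @ [int (Suc p)]"
  using upto_rec2[of 0 "int (Suc p)"] by simp

lemma c0_set:
  assumes "0 \<in> set \<beta>"
  shows "finite {p. subseq [0..int p] \<beta>}" "{p. subseq [0..int p] \<beta>} \<noteq> {}"
proof -
  have "p < length \<beta>" if "subseq [0..int p] \<beta>" for p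
    using that list_emb_length[OF that] by simp
  then show "finite {p. subseq [0..int p] \<beta>}"
    by (meson finite_nat_set_iff_bounded mem_Collect_eq)
  have "subseq [0..int 0] \<beta>" using assms by (simp add: subseq_singleton_left)
  then show "{p. subseq [0..int p] \<beta>} \<noteq> {}" by blast
qed

lemma subseq_upto_mono:
  assumes "subseq [0..int q] \<beta>" "p \<le> q"
  shows "subseq [0..int p] \<beta>"
proof -
  have "[0..int q] = [0..int p] @ [int p + 1..int q]"
    using assms(2) upto_split2[of 0 "int p" "int q"] by simp
  then have "prefix [0..int p] [0..int q]" by simp
  then show ?thesis using assms(1) subseq_order.order_trans by blast
qed

lemma subseq_c0: "0 \<in> set \<beta> \<Longrightarrow> subseq [0..int (c0 \<beta>)] \<beta>"
  using Max_in[OF c0_set] unfolding c0_def by simp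

lemma c0_ge: "0 \<in> set \<beta> \<Longrightarrow> subseq [0..int p] \<beta> \<Longrightarrow> p \<le> c0 \<beta>"
  using Max_ge[OF c0_set(1)] unfolding c0_def by simp

lemma c0_in_set: "0 \<in> set \<beta> \<Longrightarrow> int (c0 \<beta>) \<in> set \<beta>"
  using list_emb_set[OF subseq_c0, of \<beta> "int (c0 \<beta>)"] by auto

lemma c0_eqI:
  assumes "subseq [0..int p] \<beta>" "\<not> subseq [0..int (Suc p)] \<beta>"
  shows "c0 \<beta> = p"
proof -
  have 0: "0 \<in> set \<beta>"
    using subseq_upto_mono[OF assms(1), of 0] by (simp add: subseq_singleton_left)
  have "p \<le> c0 \<beta>" by (rule c0_ge[OF 0 assms(1)])
  moreover have "\<not> Suc p \<le> c0 \<beta>" using subseq_upto_mono[OF subseq_c0[OF 0]] assms(2) by blast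
  ultimately show ?thesis by simp
qed

lemma not_subseq_Suc_c0: "0 \<in> set \<beta> \<Longrightarrow> \<not> subseq [0..int (Suc (c0 \<beta>))] \<beta>"
  using c0_ge by fastforce

lemma subseq_snoc_append:
  assumes "subseq (xs @ [x]) (\<alpha> @ \<beta>)" "x \<notin> set \<beta>"
  shows "subseq (xs @ [x]) \<alpha>"
proof -
  obtain as bs where *: "xs @ [x] = as @ bs" "subseq as \<alpha>" "subseq bs \<beta>"
    using assms(1) by (auto elim: subseq_appendE)
  have "bs = []"
  proof (rule ccontr)
    assume "bs \<noteq> []"
    then have "x \<in> set bs" using *(1) by (metis last_appendR last_in_set last_snoc)
    then show False using list_emb_set[OF *(3)] assms(2) by blast
  qed
  then show ?thesis using * by simp
qed

lemma c0_snoc: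
  assumes "0 \<in> set \<beta>"
  shows "c0 (\<beta> @ [s]) = (if s = int (Suc (c0 \<beta>)) then Suc (c0 \<beta>) else c0 \<beta>)"
proof (cases "s = int (Suc (c0 \<beta>))")
  case True
  have "subseq [0..int (Suc (c0 \<beta>))] (\<beta> @ [s])"
    unfolding upto_snoc using True subseq_c0[OF assms] by simp
  moreover have "\<not> subseq [0..int (Suc (Suc (c0 \<beta>)))] (\<beta> @ [s])"
  proof
    assume "subseq [0..int (Suc (Suc (c0 \<beta>)))] (\<beta> @ [s])"
    then have "subseq [0..int (Suc (Suc (c0 \<beta>)))] \<beta>"
      unfolding upto_snoc[of "Suc (c0 \<beta>)"] by (rule subseq_snoc_append) (use True in simp)
    then show False using c0_ge[OF assms] by fastforce
  qed
  ultimately show ?thesis using True c0_eqI by simp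
next
  case False
  have "subseq [0..int (c0 \<beta>)] (\<beta> @ [s])" by (rule subseq_rev_drop_many[OF subseq_c0[OF assms]])
  moreover have "\<not> subseq [0..int (Suc (c0 \<beta>))] (\<beta> @ [s])"
  proof
    assume "subseq [0..int (Suc (c0 \<beta>))] (\<beta> @ [s])"
    then have "subseq [0..int (Suc (c0 \<beta>))] \<beta>"
      unfolding upto_snoc by (rule subseq_snoc_append) (use False in simp)
    then show False using not_subseq_Suc_c0[OF assms] by simp
  qed
  ultimately show ?thesis using False c0_eqI by simp
qed

text \<open>The chain that defines \<open>c0\<close> can pass through the maximal index only as its last element, and then
  the index just below it must come earlier.\<close>

lemma c0_insert_max:
  assumes d: "distinct (\<alpha> @ int (Suc h) # \<beta>)" and s: "set (\<alpha> @ int (Suc h) # \<beta>) = {0..int (Suc h)}"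
  shows "int h \<in> set \<alpha> \<Longrightarrow>
      c0 (\<alpha> @ int (Suc h) # \<beta>) = (if c0 (\<alpha> @ \<beta>) = h then Suc h else c0 (\<alpha> @ \<beta>))"
    and "int h \<in> set \<beta> \<Longrightarrow> c0 (\<alpha> @ int (Suc h) # \<beta>) = c0 (\<alpha> @ \<beta>)"
proof -
  let ?\<sigma> = "\<alpha> @ int (Suc h) # \<beta>"
  have "set (\<alpha> @ \<beta>) = {0..int (Suc h)} - {int (Suc h)}" using d unfolding s[symmetric] by auto
  also have "\<dots> = {0..int h}" by auto
  finally have s': "set (\<alpha> @ \<beta>) = {0..int h}" .
  have 0: "0 \<in> set (\<alpha> @ \<beta>)" unfolding s' by simp
  have le: "c0 (\<alpha> @ \<beta>) \<le> h" using c0_in_set[OF 0] unfolding s' by simp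
  have sub: "subseq [0..int (c0 (\<alpha> @ \<beta>))] ?\<sigma>"
    by (rule subseq_order.order_trans[OF subseq_c0[OF 0]]) (simp add: subseq_append' list_emb_Cons)
  have low: "subseq [0..int p] (\<alpha> @ \<beta>)" if "subseq [0..int p] ?\<sigma>" "p \<le> h" for p
  proof -
    have "subseq (filter (\<lambda>i. i \<noteq> int (Suc h)) [0..int p]) (filter (\<lambda>i. i \<noteq> int (Suc h)) ?\<sigma>)"
      using that(1) by (rule subseq_filter)
    moreover have "filter (\<lambda>i. i \<noteq> int (Suc h)) [0..int p] = [0..int p]"
      using that(2) by (intro filter_True) auto
    moreover have "filter (\<lambda>i. i \<noteq> int (Suc h)) \<alpha> = \<alpha>" "filter (\<lambda>i. i \<noteq> int (Suc h)) \<beta> = \<beta>"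
      using d by (intro filter_True; auto)+
    ultimately show ?thesis by simp
  qed
  have small: "c0 ?\<sigma> = c0 (\<alpha> @ \<beta>)" if "c0 (\<alpha> @ \<beta>) < h"
    using sub low[of "Suc (c0 (\<alpha> @ \<beta>))"] that not_subseq_Suc_c0[OF 0] by (intro c0_eqI) auto
  have nolarge: "\<not> subseq [0..int (Suc (Suc h))] ?\<sigma>"
  proof
    assume "subseq [0..int (Suc (Suc h))] ?\<sigma>"
    from list_emb_set[OF this, of "int (Suc (Suc h))"] obtain z where "z \<in> set ?\<sigma>" "z = int (Suc (Suc h))"
      by auto
    then have "int (Suc (Suc h)) \<in> {0..int (Suc h)}" unfolding s[symmetric] by simp
    then show False by simp
  qed
  have top: "subseq [0..int (Suc h)] ?\<sigma> \<longleftrightarrow> subseq [0..int h] \<alpha>"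
  proof
    assume "subseq [0..int (Suc h)] ?\<sigma>"
    then have "subseq ([0..int h] @ [int (Suc h)]) ((\<alpha> @ [int (Suc h)]) @ \<beta>)"
      unfolding upto_snoc by simp
    then have "subseq ([0..int h] @ [int (Suc h)]) (\<alpha> @ [int (Suc h)])"
      by (rule subseq_snoc_append) (use d in auto)
    then show "subseq [0..int h] \<alpha>" by simp
  next
    assume "subseq [0..int h] \<alpha>"
    then have "subseq ([0..int h] @ [int (Suc h)]) (\<alpha> @ [int (Suc h)])" by simp
    then have "subseq ([0..int h] @ [int (Suc h)]) ((\<alpha> @ [int (Suc h)]) @ \<beta>)"
      by (rule subseq_rev_drop_many)
    then show "subseq [0..int (Suc h)] ?\<sigma>" unfolding upto_snoc by simp
  qed
  have ends: "subseq xs ys \<Longrightarrow> x \<in> set xs \<Longrightarrow> x \<in> set ys" for xs ys :: "int list" and x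
    using list_emb_set[of "(=)" xs ys x] by blast
  show "c0 ?\<sigma> = (if c0 (\<alpha> @ \<beta>) = h then Suc h else c0 (\<alpha> @ \<beta>))" if h: "int h \<in> set \<alpha>"
  proof (cases "c0 (\<alpha> @ \<beta>) = h")
    case True
    have "subseq [0..int h] \<alpha>"
    proof (cases h)
      case 0
      then show ?thesis using h by (simp add: subseq_singleton_left)
    next
      case (Suc g)
      have "subseq [0..int h] (\<alpha> @ \<beta>)" using subseq_c0[OF 0] True by simp
      then show ?thesis unfolding Suc upto_snoc
        by (rule subseq_snoc_append) (use d h Suc in auto)
    qed
    then show ?thesis using top True nolarge by (auto intro: c0_eqI)
  qed (use small le in simp)
  show "c0 ?\<sigma> = c0 (\<alpha> @ \<beta>)" if h: "int h \<in> set \<beta>"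
  proof (cases "c0 (\<alpha> @ \<beta>) = h")
    case True
    have "\<not> subseq [0..int h] \<alpha>" using ends[of "[0..int h]" \<alpha> "int h"] d h by auto
    then show ?thesis using top True sub by (auto intro: c0_eqI)
  qed (use small le in simp)
qed

lemma SIP_prefix: "SIP (s @ t) \<Longrightarrow> SIP s"
  unfolding SIP_def
proof (intro allI impI)
  fix a b
  assume h: "\<forall>a b. a < b \<and> b < length (s @ t) \<and> (s @ t) ! a = (s @ t) ! b \<longrightarrow>
      (\<exists>c. a < c \<and> c < b \<and> (s @ t) ! c = (s @ t) ! a + 1)"
    and ab: "a < b \<and> b < length s \<and> s ! a = s ! b"
  then have "(s @ t) ! a = (s @ t) ! b" "b < length (s @ t)" by (simp_all add: nth_append)
  then obtain c where "a < c" "c < b" "(s @ t) ! c = (s @ t) ! a + 1" using h ab by blast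
  then show "\<exists>c. a < c \<and> c < b \<and> s ! c = s ! a + 1"
    using ab by (auto simp: nth_append intro!: exI[of _ c])
qed

text \<open>The condition only concerns what lies between two equal entries, so it is symmetric.\<close>

lemma SIP_rev:
  assumes "SIP t"
  shows "SIP (rev t)"
  unfolding SIP_def
proof (intro allI impI)
  fix a b assume ab: "a < b \<and> b < length (rev t) \<and> rev t ! a = rev t ! b"
  let ?r = "\<lambda>i. length t - Suc i"
  have "?r b < ?r a" "?r a < length t" "t ! ?r b = t ! ?r a" using ab by (auto simp: rev_nth)
  then obtain c where c: "?r b < c" "c < ?r a" "t ! c = t ! ?r b + 1"
    using assms unfolding SIP_def by blast
  have "rev t ! ?r c = t ! c" using c ab by (simp add: rev_nth)
  then have "rev t ! ?r c = rev t ! a + 1" using c ab by (simp add: rev_nth)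
  moreover have "a < ?r c" "?r c < b" using c ab by auto
  ultimately show "\<exists>c. a < c \<and> c < b \<and> rev t ! c = rev t ! a + 1" by blast
qed

lemma SIP_suffix: "SIP (s @ t) \<Longrightarrow> SIP t"
  using SIP_prefix[of "rev t" "rev s"] SIP_rev[of "s @ t"] SIP_rev[of "rev t"] by simp

text \<open>If \<open>s\<close> were \<open>c0 \<beta>\<close>, then the SIP would put \<open>c0 \<beta> + 1\<close> behind the last entry of an ascending chain from
  0 to \<open>c0 \<beta>\<close>, and the chain would not be maximal.\<close>

lemma SIP_snoc_ne_c0:
  assumes "SIP (\<beta> @ [s])" "0 \<in> set \<beta>"
  shows "s \<noteq> int (c0 \<beta>)"
proof
  assume s: "s = int (c0 \<beta>)"
  define p where "p = c0 \<beta>"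
  have "subseq ([0..int p - 1] @ [int p]) \<beta>"
    using subseq_c0[OF assms(2)] upto_rec2[of 0 "int p"] unfolding p_def by simp
  then obtain as bs where ab: "\<beta> = as @ bs" "subseq [0..int p - 1] as" "subseq [int p] bs"
    by (metis list_emb_appendD)
  have "int p \<in> set bs" using ab(3) by (simp add: subseq_singleton_left)
  then obtain a where a: "a < length bs" "bs ! a = int p" by (metis in_set_conv_nth)
  let ?l = "\<beta> @ [s]"
  have 1: "?l ! (length as + a) = int p" using a ab by (simp add: nth_append)
  have 2: "?l ! (length \<beta>) = int p" using s p_def by simp
  have "length as + a < length \<beta>" using a ab by simp
  moreover have "length \<beta> < length ?l" by simp
  ultimately obtain c where c: "length as + a < c" "c < length \<beta>" "?l ! c = ?l ! (length as + a) + 1"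
    using assms(1)[unfolded SIP_def, rule_format, of "length as + a" "length \<beta>"] 1 2 by auto
  note c = c[unfolded 1]
  (* The entry p + 1 in between extends the ascending chain 0, ..., p of \<beta>. *)
  have "\<beta> ! c = int (Suc p)" using c by (simp add: nth_append)
  moreover have bc: "\<beta> = take c \<beta> @ \<beta> ! c # drop (Suc c) \<beta>" using c(2) by (simp add: id_take_nth_drop)
  ultimately have bc: "\<beta> = take c \<beta> @ [int (Suc p)] @ drop (Suc c) \<beta>" by simp
  have tk: "take c \<beta> = as @ take (c - length as) bs" using ab c by simp
  have "int p \<in> set (take (c - length as) bs)"
    using a c by (auto simp: in_set_conv_nth intro!: exI[of _ a])
  then have "subseq [int p] (take (c - length as) bs)" by (simp add: subseq_singleton_left)
  then have "subseq ([0..int p - 1] @ [int p]) (take c \<beta>)"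
    unfolding tk by (rule list_emb_append_mono[OF ab(2)])
  then have "subseq [0..int p] (take c \<beta>)" using upto_rec2[of 0 "int p"] by simp
  then have "subseq ([0..int p] @ [int (Suc p)]) (take c \<beta> @ [int (Suc p)] @ drop (Suc c) \<beta>)"
    by (intro list_emb_append_mono) auto
  then have "subseq [0..int (Suc p)] \<beta>" unfolding upto_snoc by (subst bc)
  then show False using not_subseq_Suc_c0[OF assms(2)] p_def by simp
qed

lemma subseq_rev: "subseq xs ys \<Longrightarrow> subseq (rev xs) (rev ys)"
  by (induction rule: list_emb.induct) (auto intro: list_emb_append_mono)

lemma i0_eq_c0_rev: "i0 \<beta> = c0 (rev \<beta>)"
proof -
  have "subseq (rev xs) \<beta> \<longleftrightarrow> subseq xs (rev \<beta>)" for xs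
    using subseq_rev[of "rev xs" \<beta>] subseq_rev[of xs "rev \<beta>"] by auto
  then show ?thesis by (simp add: i0_def c0_def)
qed

section \<open>Elementary matrices as maps of blocks\<close>

text \<open>The block \<open>v k\<close> of a state \<open>(v, u)\<close> belongs to the block row \<open>m - k\<close> of the matrices, so that the index \<open>k\<close> of an
  elementary matrix is the index of a block.\<close>

type_synonym state = "(nat \<Rightarrow> complex vec) \<times> complex vec"

text \<open>Blocks from \<open>m\<close> on are zero. This keeps the number of blocks out of the type, so that \<open>m\<close> can be lowered in
  an induction, and makes a state determined by its vector.\<close>

definition state_space :: "nat \<Rightarrow> nat \<Rightarrow> nat \<Rightarrow> state set" where
  "state_space n r m = {(v, u). (\<forall>k. v k \<in> carrier_vec n) \<and> (\<forall>k\<ge>m. v k = 0\<^sub>v n) \<and> u \<in> carrier_vec r}"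

definition scale :: "complex \<Rightarrow> state \<Rightarrow> state" where
  "scale c = (\<lambda>(v, u). (\<lambda>k. c \<cdot>\<^sub>v v k, c \<cdot>\<^sub>v u))"

text \<open>The product of \<open>elem_mat n m r i X\<close> and the vector of a state, in terms of blocks; see \<open>elem_mat_action\<close>.\<close>

definition elem_act :: "nat \<Rightarrow> int \<Rightarrow> complex mat \<Rightarrow> state \<Rightarrow> state" where
  "elem_act m i X = (\<lambda>(v, u).
     (if i = 0 then v(0 := X *\<^sub>v v 0)
      else if i = - int m then v(m - 1 := X *\<^sub>v v (m - 1))
      else if i > 0 then
        v(nat i := X *\<^sub>v v (nat i) + v (nat i - 1), nat i - 1 := v (nat i))
      else
        v(nat (- i) := v (nat (- i) - 1), nat (- i) - 1 := v (nat (- i)) + X *\<^sub>v v (nat (- i) - 1)),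
      u))"

lemma foldr_closed: "(\<And>i s. i \<in> set t \<Longrightarrow> s \<in> S \<Longrightarrow> f i s \<in> S) \<Longrightarrow> s \<in> S \<Longrightarrow> foldr f t s \<in> S"
  by (induction t) auto

lemma foldr_commute:
  assumes "\<And>j s. j \<in> set t \<Longrightarrow> f j (g s) = g (f j s)"
  shows "foldr f t (g s) = g (foldr f t s)"
  using assms by (induction t) auto

lemma bij_betw_restrict:
  assumes "bij_betw f S S'" "\<And>s. s \<in> S \<Longrightarrow> P s \<longleftrightarrow> P' (f s)"
  shows "bij_betw f {s \<in> S. P s} {s \<in> S'. P' s}"
  using assms unfolding bij_betw_def inj_on_def by auto

lemma scale_closed: "s \<in> state_space n r m \<Longrightarrow> scale c s \<in> state_space n r m"
  by (auto simp: state_space_def scale_def)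

lemma elem_act_closed:
  assumes "X \<in> carrier_mat n n" "- int m \<le> i" "i < int m" "s \<in> state_space n r m"
  shows "elem_act m i X s \<in> state_space n r m"
  using assms by (auto simp: elem_act_def state_space_def fun_upd_def split: if_splits)

lemma elem_act_scale:
  assumes "X \<in> carrier_mat n n" "s \<in> state_space n r m"
  shows "elem_act m i X (scale c s) = scale c (elem_act m i X s)"
proof -
  obtain v u where s: "s = (v, u)" by force
  have v: "v k \<in> carrier_vec n" for k using assms(2) s by (simp add: state_space_def)
  have 1: "X *\<^sub>v (c \<cdot>\<^sub>v v k) = c \<cdot>\<^sub>v (X *\<^sub>v v k)" for k
    using assms(1) v by (rule mult_mat_vec)
  have 2: "c \<cdot>\<^sub>v (X *\<^sub>v v k + v j) = c \<cdot>\<^sub>v (X *\<^sub>v v k) + c \<cdot>\<^sub>v v j"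
    "c \<cdot>\<^sub>v (v j + X *\<^sub>v v k) = c \<cdot>\<^sub>v v j + c \<cdot>\<^sub>v (X *\<^sub>v v k)" for k j
    using assms(1) v by (intro smult_add_distrib_vec[of _ n]; simp)+
  show ?thesis by (simp add: elem_act_def scale_def s fun_eq_iff 1 2)
qed

lemma vec_cancel:
  fixes a b :: "complex vec"
  assumes "a \<in> carrier_vec n" "b \<in> carrier_vec n"
  shows "- a + (b + a) = b" "- a + b + a = b"
  using assms by (auto intro!: eq_vecI)

lemma elem_act_up:
  "Suc k < m \<Longrightarrow> elem_act m (int (Suc k)) X (v, u) = (v(Suc k := X *\<^sub>v v (Suc k) + v k, k := v (Suc k)), u)"
  by (simp add: elem_act_def del: of_nat_Suc)

lemma elem_act_down:
  "Suc k < m \<Longrightarrow> elem_act m (- int (Suc k)) X (v, u) = (v(Suc k := v k, k := v (Suc k) + X *\<^sub>v v k), u)"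
  by (simp add: elem_act_def del: of_nat_Suc)

lemma elem_act_inverse:
  assumes "X \<in> carrier_mat n n" "Suc k < m" "s \<in> state_space n r m"
  shows "elem_act m (int (Suc k)) (- X) (elem_act m (- int (Suc k)) X s) = s"
    and "elem_act m (- int (Suc k)) X (elem_act m (int (Suc k)) (- X) s) = s"
proof -
  obtain v u where s: "s = (v, u)" by force
  have v: "v k \<in> carrier_vec n" for k using assms(3) s by (simp add: state_space_def)
  have Xv: "X *\<^sub>v v k \<in> carrier_vec n" for k using assms(1) v by simp
  have neg: "(- X) *\<^sub>v v k = - (X *\<^sub>v v k)" for k
    using v[of k] assms(1) by (intro uminus_mult_mat_vec) auto
  have c: "- (X *\<^sub>v v j) + (v i + X *\<^sub>v v j) = v i" "- (X *\<^sub>v v j) + v i + X *\<^sub>v v j = v i" for i j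
    by (rule vec_cancel[OF Xv v])+
  show "elem_act m (int (Suc k)) (- X) (elem_act m (- int (Suc k)) X s) = s"
    unfolding s elem_act_up[OF assms(2)] elem_act_down[OF assms(2)]
    by (simp add: neg c fun_upd_idem fun_upd_twist)
  show "elem_act m (- int (Suc k)) X (elem_act m (int (Suc k)) (- X) s) = s"
    unfolding s elem_act_up[OF assms(2)] elem_act_down[OF assms(2)]
    by (simp add: neg c fun_upd_idem fun_upd_twist)
qed

section \<open>Solutions of a Fiedler pencil at a point\<close>

locale pencil_at =
  fixes n r :: nat and A E B C :: "complex mat" and \<mu> :: complex
  assumes A [simp]: "A \<in> carrier_mat r r" and E [simp]: "E \<in> carrier_mat r r"
    and B [simp]: "B \<in> carrier_mat r n" and C [simp]: "C \<in> carrier_mat n r"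
begin

abbreviation states :: "nat \<Rightarrow> state set" where
  "states \<equiv> state_space n r"

text \<open>The product of \<open>fiedler_sys n m r Ac A E B C i\<close> and the vector of a state; see \<open>fiedler_sys_action\<close>.\<close>

definition sys_act :: "nat \<Rightarrow> (nat \<Rightarrow> complex mat) \<Rightarrow> int \<Rightarrow> state \<Rightarrow> state" where
  "sys_act m Ac i = (\<lambda>(v, u).
     (if i = 0 then (v(0 := - (Ac 0 *\<^sub>v v 0) - C *\<^sub>v u), - (B *\<^sub>v v 0) - A *\<^sub>v u)
      else if i = - int m then (v(m - 1 := Ac m *\<^sub>v v (m - 1)), - (E *\<^sub>v u))
      else elem_act m i (if i > 0 then - Ac (nat i) else Ac (nat (- i))) (v, u)))"

text \<open>The kernel of \<open>\<mu> M\<^sub>\<tau> - M\<^sub>\<sigma>\<close>. Products are folds from the right, because the last factor acts first.\<close>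

definition pencil_solutions :: "nat \<Rightarrow> (nat \<Rightarrow> complex mat) \<Rightarrow> int list \<Rightarrow> int list \<Rightarrow> state set" where
  "pencil_solutions m Ac \<sigma> \<tau> =
     {s \<in> states m. foldr (sys_act m Ac) \<sigma> s = scale \<mu> (foldr (sys_act m Ac) \<tau> s)}"

definition sys_solutions :: "nat \<Rightarrow> (nat \<Rightarrow> complex mat) \<Rightarrow> (complex vec \<times> complex vec) set" where
  "sys_solutions m Ac = {(x, u). x \<in> carrier_vec n \<and> u \<in> carrier_vec r \<and>
     mat_poly n m Ac \<mu> *\<^sub>v x + C *\<^sub>v u = 0\<^sub>v n \<and> B *\<^sub>v x + (A - \<mu> \<cdot>\<^sub>m E) *\<^sub>v u = 0\<^sub>v r}"

lemma sys_act_elem: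
  assumes "i \<noteq> 0" "i \<noteq> - int m"
  shows "sys_act m Ac i = elem_act m i (if i > 0 then - Ac (nat i) else Ac (nat (- i)))"
  using assms by (auto simp: sys_act_def fun_eq_iff)

lemma sys_act_up: "Suc k < m \<Longrightarrow> sys_act m Ac (int (Suc k)) = elem_act m (int (Suc k)) (- Ac (Suc k))"
  by (subst sys_act_elem) (auto simp del: of_nat_Suc)

lemma sys_act_down: "Suc k < m \<Longrightarrow> sys_act m Ac (- int (Suc k)) = elem_act m (- int (Suc k)) (Ac (Suc k))"
  by (subst sys_act_elem) (auto simp del: of_nat_Suc)

lemma sys_act_bottom: "sys_act m Ac 0 (v, u) = (v(0 := - (Ac 0 *\<^sub>v v 0) - C *\<^sub>v u), - (B *\<^sub>v v 0) - A *\<^sub>v u)"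
  by (simp add: sys_act_def)

lemma sys_act_top: "m \<ge> 1 \<Longrightarrow> sys_act m Ac (- int m) (v, u) = (v(m - 1 := Ac m *\<^sub>v v (m - 1)), - (E *\<^sub>v u))"
  by (simp add: sys_act_def)

lemma sys_act_closed:
  assumes "\<And>i. i \<le> m \<Longrightarrow> Ac i \<in> carrier_mat n n" "m \<ge> 1" "- int m \<le> i" "i < int m" "s \<in> states m"
  shows "sys_act m Ac i s \<in> states m"
proof (cases "i = 0 \<or> i = - int m")
  case True
  obtain v u where s: "s = (v, u)" by force
  have v: "v k \<in> carrier_vec n" for k using assms(5) s by (simp add: state_space_def)
  have u: "u \<in> carrier_vec r" using assms(5) s by (simp add: state_space_def)
  have *: "Ac k *\<^sub>v v j \<in> carrier_vec n" if "k \<le> m" for k j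
    using assms(1)[OF that] v by simp
  have **: "C *\<^sub>v u \<in> carrier_vec n" "B *\<^sub>v v k \<in> carrier_vec r"  "A *\<^sub>v u \<in> carrier_vec r" "E *\<^sub>v u \<in> carrier_vec r" for k
    using u v by (auto intro!: mult_mat_vec_carrier)
  show ?thesis using True assms(2,5) u v *[of 0] *[of m] ** unfolding s
    by (auto simp: sys_act_def state_space_def)
next
  case False
  have "(if i > 0 then - Ac (nat i) else Ac (nat (- i))) \<in> carrier_mat n n"
    using assms(1)[of "nat i"] assms(1)[of "nat (-i)"] assms(3,4) by auto
  then show ?thesis using False elem_act_closed assms(3-5) by (simp add: sys_act_elem)
qed

lemma sys_act_inverse:
  assumes "\<And>i. i \<le> m \<Longrightarrow> Ac i \<in> carrier_mat n n" "0 < h" "h < m" "s \<in> states m"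
  shows "sys_act m Ac (int h) (sys_act m Ac (- int h) s) = s"
    and "sys_act m Ac (- int h) (sys_act m Ac (int h) s) = s"
proof -
  obtain k where h: "h = Suc k" using assms(2) by (cases h) auto
  show "sys_act m Ac (int h) (sys_act m Ac (- int h) s) = s"
    "sys_act m Ac (- int h) (sys_act m Ac (int h) s) = s"
    using elem_act_inverse[of "Ac (Suc k)" n k m s r] assms unfolding h
    by (simp_all only: sys_act_up sys_act_down)
qed

lemma sys_act_commute:
  assumes "0 < i" "i < int m" "0 \<le> j" "j \<le> i - 2"
  shows "sys_act m Ac i (sys_act m Ac j s) = sys_act m Ac j (sys_act m Ac i s)"
proof -
  obtain v u where s: "s = (v, u)" by force
  obtain k where i: "i = int (Suc k)" using assms(1) that[of "nat (i - 1)"] by simp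
  have k: "Suc k < m" using assms i by simp
  show ?thesis
  proof (cases "nat j")
    case 0
    then have "j = 0" "k \<noteq> 0" using assms i by auto
    then show ?thesis unfolding i sys_act_up[OF k] s elem_act_up[OF k]
      by (simp add: sys_act_def elem_act_up[OF k] fun_upd_twist del: of_nat_Suc)
  next
    case (Suc l)
    then have j: "j = int (Suc l)" and l: "Suc l < k" "Suc l < m" using assms i k by auto
    show ?thesis unfolding i j sys_act_up[OF k] sys_act_up[OF l(2)] s elem_act_up[OF k] elem_act_up[OF l(2)]
      using l by (auto simp: fun_eq_iff)
  qed
qed

lemma sys_act_scale:
  assumes "\<And>i. i \<le> m \<Longrightarrow> Ac i \<in> carrier_mat n n" "0 < h" "h < m" "s \<in> states m"
  shows "sys_act m Ac (- int h) (scale c s) = scale c (sys_act m Ac (- int h) s)"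
  using assms elem_act_scale[OF assms(1)[of h]] by (simp add: sys_act_elem)

lemma bij_sys_act:
  assumes "\<And>i. i \<le> m \<Longrightarrow> Ac i \<in> carrier_mat n n" "0 < h" "h < m"
  shows "bij_betw (sys_act m Ac (int h)) (states m) (states m)"
proof (rule bij_betw_byWitness[where f' = "sys_act m Ac (- int h)"])
  show "sys_act m Ac (int h) ` states m \<subseteq> states m" "sys_act m Ac (- int h) ` states m \<subseteq> states m"
    using assms by (intro image_subsetI sys_act_closed; simp)+
qed (simp_all add: sys_act_inverse assms)

subsection \<open>Lowering the highest index\<close>

text \<open>All indices on the side of \<open>h\<close> that does not contain \<open>h - 1\<close> commute with \<open>h\<close>. If that is the right side,
  the factor of \<open>h\<close> becomes the last one and is absorbed by a change of the unknown; the other side of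
  the equation is then corrected by the inverse factor, of index \<open>- h\<close>. If it is the left side, the factor becomes the
  first one, and both sides of the equation are multiplied by its inverse.\<close>

lemma move_highest_index:
  assumes Ac: "\<And>i. i \<le> m \<Longrightarrow> Ac i \<in> carrier_mat n n" and h: "0 < h" "h < m"
    and \<sigma>: "set (\<alpha> @ \<beta>) = {0..int h - 1}" and \<tau>: "set \<tau> = {- int m..- int h - 1}"
    and d: "distinct (\<alpha> @ \<beta>)"
  shows "int h - 1 \<in> set \<alpha> \<Longrightarrow> bij_betw (sys_act m Ac (int h))
      (pencil_solutions m Ac (\<alpha> @ int h # \<beta>) \<tau>) (pencil_solutions m Ac (\<alpha> @ \<beta>) (\<tau> @ [- int h]))"
    and "int h - 1 \<in> set \<beta> \<Longrightarrow>
      pencil_solutions m Ac (\<alpha> @ int h # \<beta>) \<tau> = pencil_solutions m Ac (\<alpha> @ \<beta>) (- int h # \<tau>)"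
proof -
  let ?F = "foldr (sys_act m Ac)"
  have com: "?F t (sys_act m Ac (int h) s) = sys_act m Ac (int h) (?F t s)"
    if "set t \<subseteq> {0..int h - 2}" for t s
    using that h by (intro foldr_commute sys_act_commute[symmetric]) auto
  have closed: "?F t s \<in> states m" if "s \<in> states m" "set t \<subseteq> {- int m..int m - 1}" for s t
    using that h by (intro foldr_closed sys_act_closed Ac) auto
  have below: "set t \<subseteq> {0..int h - 2}" if "set t \<subseteq> set (\<alpha> @ \<beta>)" "int h - 1 \<notin> set t" for t
  proof
    fix x assume "x \<in> set t"
    then have "x \<in> {0..int h - 1}" "x \<noteq> int h - 1" using that unfolding \<sigma> by auto
    then show "x \<in> {0..int h - 2}" by auto
  qed
  show "bij_betw (sys_act m Ac (int h))
      (pencil_solutions m Ac (\<alpha> @ int h # \<beta>) \<tau>) (pencil_solutions m Ac (\<alpha> @ \<beta>) (\<tau> @ [- int h]))"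
    if "int h - 1 \<in> set \<alpha>"
    unfolding pencil_solutions_def
  proof (rule bij_betw_restrict[OF bij_sys_act[OF Ac h]])
    fix s assume s: "s \<in> states m"
    have "set \<beta> \<subseteq> {0..int h - 2}" using that d by (intro below) auto
    then show "?F (\<alpha> @ int h # \<beta>) s = scale \<mu> (?F \<tau> s) \<longleftrightarrow>
      ?F (\<alpha> @ \<beta>) (sys_act m Ac (int h) s) = scale \<mu> (?F (\<tau> @ [- int h]) (sys_act m Ac (int h) s))"
      using com sys_act_inverse[OF Ac h s] by simp
  qed
  show "pencil_solutions m Ac (\<alpha> @ int h # \<beta>) \<tau> = pencil_solutions m Ac (\<alpha> @ \<beta>) (- int h # \<tau>)"
    if "int h - 1 \<in> set \<beta>"
  proof -
    have a: "set \<alpha> \<subseteq> {0..int h - 2}" using that d by (intro below) auto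
    have "?F (\<alpha> @ int h # \<beta>) s = scale \<mu> (?F \<tau> s) \<longleftrightarrow> ?F (\<alpha> @ \<beta>) s = scale \<mu> (?F (- int h # \<tau>) s)"
      if s: "s \<in> states m" for s
    proof -
      have X: "?F (\<alpha> @ \<beta>) s \<in> states m" using \<sigma> h by (intro closed s) auto
      have Y: "?F \<tau> s \<in> states m" using \<tau> h by (intro closed s) auto
      have Y': "scale \<mu> (?F \<tau> s) \<in> states m" by (rule scale_closed[OF Y])
      have "?F (\<alpha> @ int h # \<beta>) s = sys_act m Ac (int h) (?F (\<alpha> @ \<beta>) s)"
        using com[OF a] by simp
      moreover have "scale \<mu> (?F (- int h # \<tau>) s) = sys_act m Ac (- int h) (scale \<mu> (?F \<tau> s))"
        using sys_act_scale[OF Ac h Y] by simp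
      moreover have "sys_act m Ac (int h) X = Y \<longleftrightarrow> X = sys_act m Ac (- int h) Y"
        if "X \<in> states m" "Y \<in> states m" for X Y
        using sys_act_inverse[OF Ac h that(1)] sys_act_inverse[OF Ac h that(2)] by auto
      ultimately show ?thesis using X Y' by (simp only:)
    qed
    then show ?thesis unfolding pencil_solutions_def by auto
  qed
qed

end

subsection \<open>Lowering the degree\<close>

lemma distinct_set_singletonD: "distinct xs \<Longrightarrow> set xs = {x} \<Longrightarrow> xs = [x]"
  by (cases xs; cases "tl xs") auto

lemma mat_poly_carrier [simp]: "mat_poly n m Ac \<mu> \<in> carrier_mat n n"
  by (simp add: mat_poly_def)

lemma mat_poly_one:
  assumes "Ac 0 \<in> carrier_mat n n" "Ac 1 \<in> carrier_mat n n"
  shows "mat_poly n 1 Ac \<mu> = Ac 0 + \<mu> \<cdot>\<^sub>m Ac 1"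
  using assms by (intro eq_matI) (auto simp: mat_poly_def)

text \<open>One step of Horner's rule at \<open>\<mu>\<close>.\<close>

lemma mat_poly_Suc:
  assumes "Ac M \<in> carrier_mat n n" "Ac (Suc M) \<in> carrier_mat n n"
  shows "mat_poly n (Suc M) Ac \<mu> = mat_poly n M (Ac(M := Ac M + \<mu> \<cdot>\<^sub>m Ac (Suc M))) \<mu>"
proof (rule eq_matI)
  fix i j assume "i < dim_row (mat_poly n M (Ac(M := Ac M + \<mu> \<cdot>\<^sub>m Ac (Suc M))) \<mu>)"
    "j < dim_col (mat_poly n M (Ac(M := Ac M + \<mu> \<cdot>\<^sub>m Ac (Suc M))) \<mu>)"
  then have ij: "i < n" "j < n" by (auto simp: mat_poly_def)
  have "(\<Sum>k\<in>{..<M}. \<mu> ^ k * (Ac(M := Ac M + \<mu> \<cdot>\<^sub>m Ac (Suc M))) k $$ (i, j)) = (\<Sum>k\<in>{..<M}. \<mu> ^ k * Ac k $$ (i, j))"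
    by (intro sum.cong) auto
  then show "mat_poly n (Suc M) Ac \<mu> $$ (i, j) = mat_poly n M (Ac(M := Ac M + \<mu> \<cdot>\<^sub>m Ac (Suc M))) \<mu> $$ (i, j)"
    using ij assms by (simp add: mat_poly_def lessThan_Suc_atMost[symmetric] algebra_simps)
qed (auto simp: mat_poly_def)

lemma smult_mat_mult_vec:
  fixes X :: "complex mat"
  assumes "X \<in> carrier_mat nr nc" "x \<in> carrier_vec nc"
  shows "(c \<cdot>\<^sub>m X) *\<^sub>v x = c \<cdot>\<^sub>v (X *\<^sub>v x)"
  using assms by (intro eq_vecI) auto

text \<open>The part of the action of a negative index above \<open>- m\<close> that concerns the blocks; the component \<open>u\<close> is
  untouched.\<close>

definition down_act :: "(nat \<Rightarrow> complex mat) \<Rightarrow> int \<Rightarrow> (nat \<Rightarrow> complex vec) \<Rightarrow> nat \<Rightarrow> complex vec" where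
  "down_act Ac i v = v(nat (- i) := v (nat (- i) - 1),
     nat (- i) - 1 := v (nat (- i)) + Ac (nat (- i)) *\<^sub>v v (nat (- i) - 1))"

lemma foldr_down_act_upd:
  assumes "set t \<subseteq> {- int M + 1..-1}"
  shows "foldr (down_act Ac) t (v(M := x)) = (foldr (down_act Ac) t v)(M := x)"
proof (rule foldr_commute)
  fix i v assume "i \<in> set t"
  then have "i \<in> {- int M + 1..-1}" using assms by blast
  then have "nat (- i) < M" "nat (- i) - 1 < M" by auto
  then show "down_act Ac i (v(M := x)) = (down_act Ac i v)(M := x)"
    unfolding down_act_def by (auto simp: fun_eq_iff)
qed

lemma foldr_down_act_same: "set t \<subseteq> {- int M + 1..-1} \<Longrightarrow> foldr (down_act Ac) t v M = v M"
  by (metis foldr_down_act_upd fun_upd_same fun_upd_triv)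

lemma foldr_down_act_cong:
  assumes "set t \<subseteq> {- int M + 1..-1}" "\<And>k. k < M \<Longrightarrow> Ac k = Ac' k"
  shows "foldr (down_act Ac) t v = foldr (down_act Ac') t v"
proof (rule foldr_cong)
  fix i v assume "i \<in> set t"
  then have "i \<in> {- int M + 1..-1}" using assms by blast
  then have "nat (- i) < M" by auto
  then show "down_act Ac i v = down_act Ac' i v" unfolding down_act_def using assms(2) by simp
qed auto

lemma foldr_down_act_closed:
  assumes "set t \<subseteq> {- int M + 1..-1}" "\<And>k. k < M \<Longrightarrow> Ac k \<in> carrier_mat n n" "\<And>k. v k \<in> carrier_vec n"
  shows "foldr (down_act Ac) t v k \<in> carrier_vec n"
proof -
  have "foldr (down_act Ac) t v \<in> {v. \<forall>k. v k \<in> carrier_vec n}"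
  proof (rule foldr_closed)
    fix i and v :: "nat \<Rightarrow> complex vec" assume "i \<in> set t" and v: "v \<in> {v. \<forall>k. v k \<in> carrier_vec n}"
    then have "i \<in> {- int M + 1..-1}" using assms by blast
    then have "nat (- i) < M" by auto
    then have "Ac (nat (- i)) *\<^sub>v v (nat (- i) - 1) \<in> carrier_vec n"
      using assms(2) v by (intro mult_mat_vec_carrier) auto
    then show "down_act Ac i v \<in> {v. \<forall>k. v k \<in> carrier_vec n}" unfolding down_act_def using v by auto
  qed (use assms(3) in simp)
  then show ?thesis by simp
qed

context pencil_at
begin

lemma foldr_sys_act_down:
  assumes "set t \<subseteq> {- int m + 1..-1}"
  shows "foldr (sys_act m Ac) t (v, u) = (foldr (down_act Ac) t v, u)"
  using assms by (induction t) (auto simp: sys_act_def elem_act_def down_act_def)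

text \<open>Let \<open>m = Suc M\<close>. The product over \<open>\<tau>\<close> uses the top block \<open>v M\<close> in two places only: as an input, through \<open>d v\<close>,
  and as an output, which is \<open>g (y v)\<close>. Here \<open>y v\<close> is the content of block \<open>M - 1\<close> when the factor
  of index \<open>- M\<close> acts, and \<open>G z v\<close> is the result if this factor puts \<open>z\<close> into block \<open>M - 1\<close>. Whether \<open>- m\<close> acts
  before or after \<open>- M\<close> decides if \<open>A\<^sub>m\<close> enters through \<open>d\<close> or through \<open>g\<close>. In both cases, if
  the top block equals \<open>\<mu>\<close> times its output, then the input into block \<open>M - 1\<close> is
  \<open>(A\<^sub>M + \<mu> A\<^sub>m) (y v)\<close>, as in the product for degree \<open>M\<close>.\<close>

lemma foldr_sys_act_drop_degree:
  assumes Ac: "\<And>i. i \<le> Suc M \<Longrightarrow> Ac i \<in> carrier_mat n n" and M: "M \<ge> 1"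
    and \<tau>: "distinct \<tau>" "set \<tau> = {- int (Suc M)..-1}"
  defines "Ac' \<equiv> Ac(M := Ac M + \<mu> \<cdot>\<^sub>m Ac (Suc M))"
    and "\<tau>' \<equiv> filter (\<lambda>i. i \<noteq> - int (Suc M)) \<tau>"
  obtains g y G d where
    "\<And>v u. foldr (sys_act (Suc M) Ac) \<tau> (v, u) = ((G (d v + Ac M *\<^sub>v y v) v)(M := g (y v)), - (E *\<^sub>v u))"
    "\<And>v u. foldr (sys_act M Ac') \<tau>' (v, u) = (G (Ac' M *\<^sub>v y v) v, - (E *\<^sub>v u))"
    "\<And>v. (\<And>k. v k \<in> carrier_vec n) \<Longrightarrow> v M = \<mu> \<cdot>\<^sub>v g (y v) \<Longrightarrow> d v = \<mu> \<cdot>\<^sub>v (Ac (Suc M) *\<^sub>v y v)"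
    "\<And>v x. y (v(M := x)) = y v" "\<And>v x z. G z (v(M := x)) = (G z v)(M := x)"
    "\<And>v. (\<And>k. v k \<in> carrier_vec n) \<Longrightarrow> y v \<in> carrier_vec n"
    "\<And>v. (\<And>k. v k \<in> carrier_vec n) \<Longrightarrow> g (y v) \<in> carrier_vec n"
proof -
  have "- int M \<in> set \<tau>'" using \<tau> M by (simp add: \<tau>'_def)
  then obtain \<alpha> \<beta> where ab: "\<tau>' = \<alpha> @ - int M # \<beta>" by (metis split_list)
  have s': "set \<tau>' = {- int M..-1}" using \<tau> by (auto simp: \<tau>'_def)
  have d': "distinct \<tau>'" using \<tau> by (simp add: \<tau>'_def)
  have "set \<alpha> \<union> set \<beta> = set \<tau>' - {- int M}" using d' unfolding ab by auto
  also have "\<dots> = {- int M + 1..-1}" unfolding s' by auto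
  finally have low: "set \<alpha> \<subseteq> {- int M + 1..-1}" "set \<beta> \<subseteq> {- int M + 1..-1}" by auto
  have low': "set \<alpha> \<subseteq> {- int (Suc M) + 1..-1}" "set \<beta> \<subseteq> {- int (Suc M) + 1..-1}" using low by auto
  have ne: "M - Suc 0 \<noteq> M" "M \<noteq> M - Suc 0" "M \<noteq> 0" using M by auto
  let ?D = "foldr (down_act Ac)"
  define y where "y v = ?D \<beta> v (M - 1)" for v
  define G where "G z v = ?D \<alpha> ((?D \<beta> v)(M - 1 := z))" for z v
  have new: "foldr (sys_act M Ac') \<tau>' (v, u) = (G (Ac' M *\<^sub>v y v) v, - (E *\<^sub>v u))" for v u
  proof -
    have "foldr (down_act Ac') \<alpha> v = ?D \<alpha> v" "foldr (down_act Ac') \<beta> v = ?D \<beta> v" for v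
      using low by (auto intro!: foldr_down_act_cong simp: Ac'_def)
    then show ?thesis unfolding ab
      using M by (simp add: foldr_sys_act_down[OF low(1)] foldr_sys_act_down[OF low(2)] sys_act_top G_def y_def)
  qed
  have yupd: "y (v(M := x)) = y v" for v x
    using ne by (simp add: y_def foldr_down_act_upd[OF low(2)])
  have Gupd: "G z (v(M := x)) = (G z v)(M := x)" for v x z
  proof -
    have "G z (v(M := x)) = ?D \<alpha> (((?D \<beta> v)(M - 1 := z))(M := x))"
      using ne unfolding G_def foldr_down_act_upd[OF low(2)] by (simp add: fun_upd_twist)
    then show ?thesis unfolding foldr_down_act_upd[OF low(1)] G_def .
  qed
  have yc: "y v \<in> carrier_vec n" if "\<And>k. v k \<in> carrier_vec n" for v
    unfolding y_def using Ac that by (intro foldr_down_act_closed[OF low(2)]) auto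
  have step: "sys_act (Suc M) Ac (- int M) (v, u) = (v(M := v (M - 1), M - 1 := v M + Ac M *\<^sub>v v (M - 1)), u)" for v u
    using M by (simp add: sys_act_def elem_act_def)
  have top: "sys_act (Suc M) Ac (- int (Suc M)) (v, u) = (v(M := Ac (Suc M) *\<^sub>v v M), - (E *\<^sub>v u))" for v u
    using sys_act_top[of "Suc M"] by simp
  have "- int (Suc M) \<in> set \<tau>" using \<tau> by simp
  then obtain \<gamma> \<delta> where gd: "\<tau> = \<gamma> @ - int (Suc M) # \<delta>" by (metis split_list)
  have fil: "filter (\<lambda>i. i \<noteq> - int (Suc M)) \<gamma> = \<gamma>" "filter (\<lambda>i. i \<noteq> - int (Suc M)) \<delta> = \<delta>"
    using \<tau>(1) unfolding gd by (intro filter_True; auto)+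
  have gd': "\<gamma> @ \<delta> = \<alpha> @ - int M # \<beta>" using ab fil unfolding \<tau>'_def gd by simp
  have lowg: "set \<gamma> \<subseteq> {- int (Suc M) + 1..-1}" "set \<delta> \<subseteq> {- int (Suc M) + 1..-1}"
    using s' unfolding ab gd'[symmetric] by auto
  have commute_top: "foldr (sys_act (Suc M) Ac) t (sys_act (Suc M) Ac (- int (Suc M)) s) =
      sys_act (Suc M) Ac (- int (Suc M)) (foldr (sys_act (Suc M) Ac) t s)"
    if t: "set t \<subseteq> {- int M + 1..-1}" for t s
  proof -
    obtain v u where s: "s = (v, u)" by force
    have t': "set t \<subseteq> {- int (Suc M) + 1..-1}" using t by auto
    show ?thesis unfolding s top foldr_sys_act_down[OF t'] foldr_down_act_upd[OF t] foldr_down_act_same[OF t] ..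
  qed
  (* The index -m stands to the left of -(m-1) in the first case and to its right in the second.
     Every other index commutes with it. *)
  consider \<epsilon> where "\<alpha> = \<gamma> @ \<epsilon>" "\<delta> = \<epsilon> @ - int M # \<beta>" | \<epsilon> where "\<gamma> = \<alpha> @ - int M # \<epsilon>" "\<beta> = \<epsilon> @ \<delta>"
    using gd' that(1)[of "[]"] by (auto simp: append_eq_append_conv2 append_eq_Cons_conv)
  then show ?thesis
  proof cases
    case (1 \<epsilon>)
    have lowe: "set \<epsilon> \<subseteq> {- int M + 1..-1}" "set \<gamma> \<subseteq> {- int M + 1..-1}" using low 1 by auto
    have full: "foldr (sys_act (Suc M) Ac) \<tau> (v, u) =
        ((G (v M + Ac M *\<^sub>v y v) v)(M := Ac (Suc M) *\<^sub>v y v), - (E *\<^sub>v u))" for v u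
    proof -
      have "foldr (sys_act (Suc M) Ac) \<tau> (v, u) = sys_act (Suc M) Ac (- int (Suc M))
          (foldr (sys_act (Suc M) Ac) \<alpha> (sys_act (Suc M) Ac (- int M) (foldr (sys_act (Suc M) Ac) \<beta> (v, u))))"
        unfolding gd 1 using commute_top[OF lowe(2)] by simp
      also have "foldr (sys_act (Suc M) Ac) \<beta> (v, u) = (?D \<beta> v, u)" by (rule foldr_sys_act_down[OF low'(2)])
      also have "sys_act (Suc M) Ac (- int M) (?D \<beta> v, u) =
          (((?D \<beta> v)(M - 1 := v M + Ac M *\<^sub>v y v))(M := y v), u)"
        unfolding step y_def foldr_down_act_same[OF low(2)] using ne by (simp add: fun_upd_twist)
      also have "foldr (sys_act (Suc M) Ac) \<alpha> \<dots> = ((G (v M + Ac M *\<^sub>v y v) v)(M := y v), u)"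
        unfolding foldr_sys_act_down[OF low'(1)] foldr_down_act_upd[OF low(1)] G_def ..
      finally show ?thesis unfolding top by simp
    qed
    show ?thesis
      by (rule that[of G "\<lambda>v. v M" y "\<lambda>y. Ac (Suc M) *\<^sub>v y"])
        (use full new yupd Gupd yc mult_mat_vec_carrier[OF Ac[of "Suc M"] yc] in auto)
  next
    case (2 \<epsilon>)
    have lowe: "set \<epsilon> \<subseteq> {- int M + 1..-1}" "set \<delta> \<subseteq> {- int M + 1..-1}" using low 2 by auto
    have full: "foldr (sys_act (Suc M) Ac) \<tau> (v, u) =
        ((G (Ac (Suc M) *\<^sub>v v M + Ac M *\<^sub>v y v) v)(M := y v), - (E *\<^sub>v u))" for v u
    proof -
      have "foldr (sys_act (Suc M) Ac) \<tau> (v, u) = foldr (sys_act (Suc M) Ac) \<alpha> (sys_act (Suc M) Ac (- int M)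
          (sys_act (Suc M) Ac (- int (Suc M)) (foldr (sys_act (Suc M) Ac) \<beta> (v, u))))"
        unfolding gd 2 using commute_top[OF lowe(1)] by simp
      also have "foldr (sys_act (Suc M) Ac) \<beta> (v, u) = (?D \<beta> v, u)" by (rule foldr_sys_act_down[OF low'(2)])
      also have "sys_act (Suc M) Ac (- int M) (sys_act (Suc M) Ac (- int (Suc M)) (?D \<beta> v, u)) =
          (((?D \<beta> v)(M - 1 := Ac (Suc M) *\<^sub>v v M + Ac M *\<^sub>v y v))(M := y v), - (E *\<^sub>v u))"
        unfolding top step y_def foldr_down_act_same[OF low(2)] using ne by (simp add: fun_upd_twist)
      also have "foldr (sys_act (Suc M) Ac) \<alpha> \<dots> = ((G (Ac (Suc M) *\<^sub>v v M + Ac M *\<^sub>v y v) v)(M := y v), - (E *\<^sub>v u))"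
        unfolding foldr_sys_act_down[OF low'(1)] foldr_down_act_upd[OF low(1)] G_def ..
      finally show ?thesis .
    qed
    show ?thesis
    proof (rule that[of G "\<lambda>v. Ac (Suc M) *\<^sub>v v M" y "\<lambda>y. y"])
      fix v :: "nat \<Rightarrow> complex vec" assume "\<And>k. v k \<in> carrier_vec n" "v M = \<mu> \<cdot>\<^sub>v y v"
      then show "Ac (Suc M) *\<^sub>v v M = \<mu> \<cdot>\<^sub>v (Ac (Suc M) *\<^sub>v y v)"
        using Ac[of "Suc M"] yc[of v] by (simp add: mult_mat_vec)
    qed (use full new yupd Gupd yc in auto)
  qed
qed

text \<open>As \<open>M \<ge> 1\<close>, the matrix of index 0 leaves the top block alone, and the top block row reads
  \<open>v M = \<mu> g (y v)\<close>. This equation recovers the top block from the others.\<close>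

lemma drop_degree:
  assumes Ac: "\<And>i. i \<le> Suc M \<Longrightarrow> Ac i \<in> carrier_mat n n" and M: "M \<ge> 1"
    and \<tau>: "distinct \<tau>" "set \<tau> = {- int (Suc M)..-1}"
  shows "bij_betw (\<lambda>(v, u). (v(M := 0\<^sub>v n), u)) (pencil_solutions (Suc M) Ac [0] \<tau>)
     (pencil_solutions M (Ac(M := Ac M + \<mu> \<cdot>\<^sub>m Ac (Suc M))) [0] (filter (\<lambda>i. i \<noteq> - int (Suc M)) \<tau>))"
proof -
  let ?Ac = "Ac(M := Ac M + \<mu> \<cdot>\<^sub>m Ac (Suc M))" and ?\<tau> = "filter (\<lambda>i. i \<noteq> - int (Suc M)) \<tau>"
  show ?thesis
  proof (rule foldr_sys_act_drop_degree[of M Ac \<tau>])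
    fix g y G d
    assume full: "\<And>v u. foldr (sys_act (Suc M) Ac) \<tau> (v, u) = ((G (d v + Ac M *\<^sub>v y v) v)(M := g (y v)), - (E *\<^sub>v u))"
    and new: "\<And>v u. foldr (sys_act M ?Ac) ?\<tau> (v, u) = (G (?Ac M *\<^sub>v y v) v, - (E *\<^sub>v u))"
    and d: "\<And>v. (\<And>k. v k \<in> carrier_vec n) \<Longrightarrow> v M = \<mu> \<cdot>\<^sub>v g (y v) \<Longrightarrow> d v = \<mu> \<cdot>\<^sub>v (Ac (Suc M) *\<^sub>v y v)"
    and y: "\<And>v x. y (v(M := x)) = y v" and G: "\<And>v x z. G z (v(M := x)) = (G z v)(M := x)"
    and yc: "\<And>v. (\<And>k. v k \<in> carrier_vec n) \<Longrightarrow> y v \<in> carrier_vec n"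
    and gc: "\<And>v. (\<And>k. v k \<in> carrier_vec n) \<Longrightarrow> g (y v) \<in> carrier_vec n"
    define a where "a v u = - (Ac 0 *\<^sub>v v 0) - C *\<^sub>v u" for v :: "nat \<Rightarrow> complex vec" and u
    define b where "b v u = - (B *\<^sub>v v 0) - A *\<^sub>v u" for v :: "nat \<Rightarrow> complex vec" and u
    have bot: "sys_act (Suc M) Ac 0 (v, u) = (v(0 := a v u), b v u)" "sys_act M ?Ac 0 (v, u) = (v(0 := a v u), b v u)" for v u
      using M by (simp_all add: sys_act_bottom a_def b_def)
    have aupd: "a (v(M := x)) u = a v u" "b (v(M := x)) u = b v u" for v x u
      using M by (simp_all add: a_def b_def)
    define z where "z v = (\<lambda>k. \<mu> \<cdot>\<^sub>v G (?Ac M *\<^sub>v y v) v k)" for v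
    have zupd: "z (v(M := x)) = (z v)(M := \<mu> \<cdot>\<^sub>v x)" for v x
      by (auto simp: z_def y G fun_eq_iff)
    (* Block row M of the pencil decides v M; the other rows, once v M is inserted, are those of
       the reduced pencil. *)
    have old_iff: "(v, u) \<in> pencil_solutions (Suc M) Ac [0] \<tau> \<longleftrightarrow> (v, u) \<in> states (Suc M) \<and>
        v M = \<mu> \<cdot>\<^sub>v g (y v) \<and> v(0 := a v u) = (z v)(M := \<mu> \<cdot>\<^sub>v g (y v)) \<and> b v u = \<mu> \<cdot>\<^sub>v - (E *\<^sub>v u)" for v u
    proof -
      have coeff: "d v + Ac M *\<^sub>v y v = ?Ac M *\<^sub>v y v"
        if "(v, u) \<in> states (Suc M)" and vM: "v M = \<mu> \<cdot>\<^sub>v g (y v)"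
      proof -
        have v: "\<And>k. v k \<in> carrier_vec n" using that by (simp add: state_space_def)
        have "?Ac M *\<^sub>v y v = Ac M *\<^sub>v y v + \<mu> \<cdot>\<^sub>v (Ac (Suc M) *\<^sub>v y v)"
          using Ac[of M] Ac[of "Suc M"] yc[OF v]
          by (simp add: add_mult_distrib_mat_vec[of _ n n] smult_mat_mult_vec)
        also have "\<dots> = d v + Ac M *\<^sub>v y v"
          unfolding d[OF v vM] using Ac[of M] Ac[of "Suc M"] yc[OF v] by (intro comm_add_vec[of _ n]) auto
        finally show ?thesis ..
      qed
      have "(v, u) \<in> pencil_solutions (Suc M) Ac [0] \<tau> \<longleftrightarrow> (v, u) \<in> states (Suc M) \<and>
        v(0 := a v u) = (\<lambda>k. \<mu> \<cdot>\<^sub>v ((G (d v + Ac M *\<^sub>v y v) v)(M := g (y v))) k) \<and> b v u = \<mu> \<cdot>\<^sub>v - (E *\<^sub>v u)"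
        by (simp add: pencil_solutions_def bot full scale_def)
      also have "\<dots> \<longleftrightarrow> (v, u) \<in> states (Suc M) \<and> v M = \<mu> \<cdot>\<^sub>v g (y v) \<and>
        v(0 := a v u) = (\<lambda>k. \<mu> \<cdot>\<^sub>v ((G (d v + Ac M *\<^sub>v y v) v)(M := g (y v))) k) \<and> b v u = \<mu> \<cdot>\<^sub>v - (E *\<^sub>v u)"
        using M by (auto dest: fun_cong[of _ _ M])
      also have "\<dots> \<longleftrightarrow> (v, u) \<in> states (Suc M) \<and> v M = \<mu> \<cdot>\<^sub>v g (y v) \<and>
        v(0 := a v u) = (z v)(M := \<mu> \<cdot>\<^sub>v g (y v)) \<and> b v u = \<mu> \<cdot>\<^sub>v - (E *\<^sub>v u)"
      proof (intro conj_cong refl)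
        assume "(v, u) \<in> states (Suc M)" "v M = \<mu> \<cdot>\<^sub>v g (y v)"
        note c = coeff[OF this]
        have "(\<lambda>k. \<mu> \<cdot>\<^sub>v ((G (d v + Ac M *\<^sub>v y v) v)(M := g (y v))) k) = (z v)(M := \<mu> \<cdot>\<^sub>v g (y v))"
          unfolding c z_def by auto
        then show "(v(0 := a v u) = (\<lambda>k. \<mu> \<cdot>\<^sub>v ((G (d v + Ac M *\<^sub>v y v) v)(M := g (y v))) k)) =
          (v(0 := a v u) = (z v)(M := \<mu> \<cdot>\<^sub>v g (y v)))" by simp
      qed
      finally show ?thesis .
    qed
    have new_iff: "(v, u) \<in> pencil_solutions M ?Ac [0] ?\<tau> \<longleftrightarrow>
        (v, u) \<in> states M \<and> v(0 := a v u) = z v \<and> b v u = \<mu> \<cdot>\<^sub>v - (E *\<^sub>v u)" for v u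
      unfolding pencil_solutions_def by (simp add: bot new scale_def z_def del: fun_upd_apply of_nat_Suc)
    have zero: "\<mu> \<cdot>\<^sub>v 0\<^sub>v n = 0\<^sub>v n" by (intro eq_vecI) auto
    show ?thesis
    proof (rule bij_betw_byWitness[where f' = "\<lambda>(v, u). (v(M := \<mu> \<cdot>\<^sub>v g (y v)), u)"])
      show "\<forall>s\<in>pencil_solutions (Suc M) Ac [0] \<tau>.
          (case case s of (v, u) \<Rightarrow> (v(M := 0\<^sub>v n), u) of (v, u) \<Rightarrow> (v(M := \<mu> \<cdot>\<^sub>v g (y v)), u)) = s"
      proof
        fix s assume s: "s \<in> pencil_solutions (Suc M) Ac [0] \<tau>"
        obtain v u where vu: "s = (v, u)" by force
        have "\<mu> \<cdot>\<^sub>v g (y v) = v M" using s unfolding vu old_iff by (simp only:)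
        then show "(case case s of (v, u) \<Rightarrow> (v(M := 0\<^sub>v n), u) of (v, u) \<Rightarrow> (v(M := \<mu> \<cdot>\<^sub>v g (y v)), u)) = s"
          unfolding vu by (simp add: y)
      qed
      show "\<forall>s\<in>pencil_solutions M ?Ac [0] ?\<tau>.
          (case case s of (v, u) \<Rightarrow> (v(M := \<mu> \<cdot>\<^sub>v g (y v)), u) of (v, u) \<Rightarrow> (v(M := 0\<^sub>v n), u)) = s"
      proof
        fix s assume s: "s \<in> pencil_solutions M ?Ac [0] ?\<tau>"
        obtain v u where vu: "s = (v, u)" by force
        have "(v, u) \<in> states M" using s unfolding vu new_iff by (simp only:)
        then have "0\<^sub>v n = v M" by (simp add: state_space_def)
        then show "(case case s of (v, u) \<Rightarrow> (v(M := \<mu> \<cdot>\<^sub>v g (y v)), u) of (v, u) \<Rightarrow> (v(M := 0\<^sub>v n), u)) = s"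
          unfolding vu by simp
      qed
      show "(\<lambda>(v, u). (v(M := 0\<^sub>v n), u)) ` pencil_solutions (Suc M) Ac [0] \<tau> \<subseteq> pencil_solutions M ?Ac [0] ?\<tau>"
      proof safe
        fix v u assume "(v, u) \<in> pencil_solutions (Suc M) Ac [0] \<tau>"
        note h = this[unfolded old_iff]
        have "(v(M := 0\<^sub>v n), u) \<in> states M"
          using conjunct1[OF h] unfolding state_space_def by (auto simp: Suc_le_eq)
        moreover have "(v(M := 0\<^sub>v n))(0 := a v u) = (v(0 := a v u))(M := 0\<^sub>v n)"
          using M by (intro fun_upd_twist) simp
        ultimately show "(v(M := 0\<^sub>v n), u) \<in> pencil_solutions M ?Ac [0] ?\<tau>"
          unfolding new_iff zupd aupd zero using h by (simp only: fun_upd_upd)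
      qed
      show "(\<lambda>(v, u). (v(M := \<mu> \<cdot>\<^sub>v g (y v)), u)) ` pencil_solutions M ?Ac [0] ?\<tau> \<subseteq> pencil_solutions (Suc M) Ac [0] \<tau>"
      proof safe
        fix v u assume "(v, u) \<in> pencil_solutions M ?Ac [0] ?\<tau>"
        note h = this[unfolded new_iff]
        have v: "\<And>k. v k \<in> carrier_vec n" using conjunct1[OF h] by (simp add: state_space_def)
        have "(v(M := \<mu> \<cdot>\<^sub>v g (y v)), u) \<in> states (Suc M)"
          using conjunct1[OF h] gc[OF v] unfolding state_space_def by auto
        moreover have "(v(M := \<mu> \<cdot>\<^sub>v g (y v)))(0 := a v u) = (v(0 := a v u))(M := \<mu> \<cdot>\<^sub>v g (y v))"
          using M by (intro fun_upd_twist) simp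
        ultimately show "(v(M := \<mu> \<cdot>\<^sub>v g (y v)), u) \<in> pencil_solutions (Suc M) Ac [0] \<tau>"
          unfolding old_iff zupd aupd y using h by (simp only: fun_upd_upd fun_upd_same)
      qed
    qed
  qed (use Ac M \<tau> in auto)
qed

text \<open>The degree drops until it is 1. No step touches block 0 or \<open>u\<close>, and the polynomial matrix keeps its value at \<open>\<mu>\<close>.\<close>

lemma bottom_block_bij:
  assumes "\<And>i. i \<le> Suc M \<Longrightarrow> Ac i \<in> carrier_mat n n"
    and "distinct \<tau>" "set \<tau> = {- int (Suc M)..-1}"
  shows "bij_betw (\<lambda>(v, u). (v 0, u)) (pencil_solutions (Suc M) Ac [0] \<tau>) (sys_solutions (Suc M) Ac)"
  using assms
proof (induction M arbitrary: Ac \<tau>)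
  case 0
  have Ac: "Ac 0 \<in> carrier_mat n n" "Ac (Suc 0) \<in> carrier_mat n n" using 0(1) by auto
  have "{- int (Suc 0)..-1} = {-1::int}" by auto
  with 0 have \<tau>: "\<tau> = [-1]" by (intro distinct_set_singletonD) auto
  have iff: "(v, u) \<in> pencil_solutions (Suc 0) Ac [0] \<tau> \<longleftrightarrow>
    (v, u) \<in> states (Suc 0) \<and> (v 0, u) \<in> sys_solutions (Suc 0) Ac" for v u
  proof (cases "(v, u) \<in> states (Suc 0)")
    case True
    have v: "v k \<in> carrier_vec n" "k \<ge> Suc 0 \<Longrightarrow> v k = 0\<^sub>v n" and u: "u \<in> carrier_vec r" for k
      using True by (simp_all add: state_space_def)
    have c: "Ac 0 *\<^sub>v v 0 \<in> carrier_vec n" "Ac (Suc 0) *\<^sub>v v 0 \<in> carrier_vec n" "C *\<^sub>v u \<in> carrier_vec n"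
      "B *\<^sub>v v 0 \<in> carrier_vec r" "A *\<^sub>v u \<in> carrier_vec r" "E *\<^sub>v u \<in> carrier_vec r"
      using Ac v u by (auto intro!: mult_mat_vec_carrier)
    have P: "mat_poly n (Suc 0) Ac \<mu> *\<^sub>v v 0 = Ac 0 *\<^sub>v v 0 + \<mu> \<cdot>\<^sub>v (Ac (Suc 0) *\<^sub>v v 0)"
      using mat_poly_one[of Ac n \<mu>] Ac v by (simp add: add_mult_distrib_mat_vec[of _ n n] smult_mat_mult_vec)
    have Q: "(A - \<mu> \<cdot>\<^sub>m E) *\<^sub>v u = A *\<^sub>v u - \<mu> \<cdot>\<^sub>v (E *\<^sub>v u)"
      using u by (simp add: minus_mult_distrib_mat_vec[of _ r r] smult_mat_mult_vec[OF E])
    have 1: "- p - q = \<mu> \<cdot>\<^sub>v t \<longleftrightarrow> (p + \<mu> \<cdot>\<^sub>v t) + q = 0\<^sub>v k"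
      if "p \<in> carrier_vec k" "q \<in> carrier_vec k" "t \<in> carrier_vec k" for p q t :: "complex vec" and k
    proof -
      have "- x - y = z \<longleftrightarrow> x + z + y = 0" for x y z :: complex
      proof -
        have "x + z + y = z - (- x - y)" by simp
        then show ?thesis by (auto simp only: right_minus_eq)
      qed
      then show ?thesis using that by (simp add: vec_eq_iff add.assoc)
    qed
    have 2: "- p - q = \<mu> \<cdot>\<^sub>v - t \<longleftrightarrow> p + (q - \<mu> \<cdot>\<^sub>v t) = 0\<^sub>v k"
      if "p \<in> carrier_vec k" "q \<in> carrier_vec k" "t \<in> carrier_vec k" for p q t :: "complex vec" and k
    proof -
      have "- x - y = - z \<longleftrightarrow> x + (y - z) = 0" for x y z :: complex
      proof -
        have "x + (y - z) = - z - (- x - y)" by simp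
        then show ?thesis by (auto simp only: right_minus_eq)
      qed
      then show ?thesis using that by (simp add: vec_eq_iff)
    qed
    have "(v, u) \<in> pencil_solutions (Suc 0) Ac [0] \<tau> \<longleftrightarrow>
      - (Ac 0 *\<^sub>v v 0) - C *\<^sub>v u = \<mu> \<cdot>\<^sub>v (Ac (Suc 0) *\<^sub>v v 0) \<and> - (B *\<^sub>v v 0) - A *\<^sub>v u = \<mu> \<cdot>\<^sub>v - (E *\<^sub>v u)"
    proof -
      have "v(0 := x) = (\<lambda>k. \<mu> \<cdot>\<^sub>v (v(0 := y)) k) \<longleftrightarrow> x = \<mu> \<cdot>\<^sub>v y" for x y
        using v(2) by (auto simp: fun_eq_iff Suc_le_eq)
      then show ?thesis
        using True sys_act_top[of "Suc 0" Ac v u]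
        by (simp add: pencil_solutions_def \<tau> sys_act_bottom scale_def del: fun_upd_apply)
    qed
    then show ?thesis using True v u unfolding 1[OF c(1,3,2)] 2[OF c(4,5,6)] by (simp add: sys_solutions_def P Q)
  qed (simp add: pencil_solutions_def)
  show ?case
  proof (rule bij_betw_byWitness[where f' = "\<lambda>(x, u). ((\<lambda>_. 0\<^sub>v n)(0 := x), u)"])
    show "\<forall>s\<in>pencil_solutions (Suc 0) Ac [0] \<tau>.
        (case case s of (v, u) \<Rightarrow> (v 0, u) of (x, u) \<Rightarrow> ((\<lambda>_. 0\<^sub>v n)(0 := x), u)) = s"
      by (auto simp: pencil_solutions_def state_space_def fun_eq_iff Suc_le_eq)
    show "(\<lambda>(v, u). (v 0, u)) ` pencil_solutions (Suc 0) Ac [0] \<tau> \<subseteq> sys_solutions (Suc 0) Ac"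
      by (auto simp: iff)
    show "(\<lambda>(x, u). ((\<lambda>_. 0\<^sub>v n)(0 := x), u)) ` sys_solutions (Suc 0) Ac \<subseteq> pencil_solutions (Suc 0) Ac [0] \<tau>"
      by (auto simp: iff) (auto simp: state_space_def sys_solutions_def)
  qed auto
next
  case (Suc M)
  let ?Ac = "Ac(Suc M := Ac (Suc M) + \<mu> \<cdot>\<^sub>m Ac (Suc (Suc M)))"
  let ?\<tau> = "filter (\<lambda>i. i \<noteq> - int (Suc (Suc M))) \<tau>"
  have "set ?\<tau> = set \<tau> - {- int (Suc (Suc M))}" by auto
  also have "\<dots> = {- int (Suc M)..-1}" unfolding Suc.prems(3) by auto
  finally have s: "set ?\<tau> = {- int (Suc M)..-1}" .
  have IH: "bij_betw (\<lambda>(v, u). (v 0, u)) (pencil_solutions (Suc M) ?Ac [0] ?\<tau>) (sys_solutions (Suc M) ?Ac)"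
    using Suc.prems(1)[of "Suc M"] Suc.prems(1)[of "Suc (Suc M)"]
    by (intro Suc.IH s distinct_filter Suc.prems(2)) (auto intro: Suc.prems(1))
  have same: "sys_solutions (Suc M) ?Ac = sys_solutions (Suc (Suc M)) Ac"
    unfolding sys_solutions_def
    using mat_poly_Suc[of Ac "Suc M" n \<mu>] Suc.prems(1)[of "Suc M"] Suc.prems(1)[of "Suc (Suc M)"] by simp
  have drop: "bij_betw (\<lambda>(v, u). (v(Suc M := 0\<^sub>v n), u)) (pencil_solutions (Suc (Suc M)) Ac [0] \<tau>)
      (pencil_solutions (Suc M) ?Ac [0] ?\<tau>)"
    using Suc.prems by (intro drop_degree) simp_all
  show ?case
    by (rule iffD1[OF bij_betw_cong bij_betw_trans[OF drop IH[unfolded same]]]) auto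
qed

subsection \<open>The recovered block\<close>

text \<open>Induction on \<open>h\<close>. Removing \<open>h\<close> from \<open>\<sigma>\<close> changes \<open>c0\<close> only if it was \<open>h\<close>, and then to \<open>h - 1\<close>; the change of the unknown
  that accompanies this removal moves block \<open>h\<close> to the same place.\<close>

lemma c0_block_bij:
  assumes Ac: "\<And>i. i \<le> m \<Longrightarrow> Ac i \<in> carrier_mat n n" and "h < m"
    and "distinct \<sigma>" "set \<sigma> = {0..int h}" "distinct \<tau>" "set \<tau> = {- int m..- int h - 1}"
  shows "bij_betw (\<lambda>(v, u). (v (c0 \<sigma>), u)) (pencil_solutions m Ac \<sigma> \<tau>) (sys_solutions m Ac)"
  using assms(2-)
proof (induction h arbitrary: \<sigma> \<tau>)
  case 0
  then have \<sigma>: "\<sigma> = [0]" by (intro distinct_set_singletonD) auto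
  have "c0 [0] = 0" by (rule c0_eqI) (auto dest: list_emb_length)
  moreover obtain M where "m = Suc M" using 0(1) by (cases m) auto
  ultimately show ?case
    unfolding \<sigma> using bottom_block_bij[of M Ac \<tau>] 0 Ac by simp
next
  case (Suc h)
  have "int (Suc h) \<in> set \<sigma>" using Suc.prems by simp
  then obtain \<alpha> \<beta> where ab: "\<sigma> = \<alpha> @ int (Suc h) # \<beta>" by (metis split_list)
  have "set (\<alpha> @ \<beta>) = set \<sigma> - {int (Suc h)}" using Suc.prems(2) unfolding ab by auto
  also have "\<dots> = {0..int h}" unfolding Suc.prems(3) by auto
  finally have s: "set (\<alpha> @ \<beta>) = {0..int h}" .
  have d: "distinct (\<alpha> @ \<beta>)" using Suc.prems(2) unfolding ab by auto
  have t: "set (\<tau> @ [- int (Suc h)]) = {- int m..- int h - 1}" "set (- int (Suc h) # \<tau>) = {- int m..- int h - 1}"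
    using Suc.prems(1,5) by auto
  have td: "distinct (\<tau> @ [- int (Suc h)])" "distinct (- int (Suc h) # \<tau>)"
    using Suc.prems(4,5) by auto
  note c = c0_insert_max[OF Suc.prems(2)[unfolded ab] Suc.prems(3)[unfolded ab]]
  have le: "c0 (\<alpha> @ \<beta>) \<le> h" using c0_in_set[of "\<alpha> @ \<beta>"] unfolding s by simp
  have move: "int h \<in> set \<alpha> \<Longrightarrow> bij_betw (sys_act m Ac (int (Suc h)))
      (pencil_solutions m Ac \<sigma> \<tau>) (pencil_solutions m Ac (\<alpha> @ \<beta>) (\<tau> @ [- int (Suc h)]))"
    "int h \<in> set \<beta> \<Longrightarrow> pencil_solutions m Ac \<sigma> \<tau> = pencil_solutions m Ac (\<alpha> @ \<beta>) (- int (Suc h) # \<tau>)"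
    using move_highest_index[of m Ac "Suc h" \<alpha> \<beta> \<tau>] Ac Suc.prems s d unfolding ab by auto
  have "int h \<in> set (\<alpha> @ \<beta>)" unfolding s by simp
  then consider "int h \<in> set \<alpha>" | "int h \<in> set \<beta>" by auto
  then show ?case
  proof cases
    case 1
    have "bij_betw ((\<lambda>(v, u). (v (c0 (\<alpha> @ \<beta>)), u)) \<circ> sys_act m Ac (int (Suc h)))
        (pencil_solutions m Ac \<sigma> \<tau>) (sys_solutions m Ac)"
      using Suc.prems(1) by (intro bij_betw_trans[OF move(1)[OF 1]] Suc.IH d s td t) simp
    (* The factor of index Suc h writes block Suc h into block h and leaves the blocks below h. *)
    moreover have "(\<lambda>(v, u). (v (c0 (\<alpha> @ \<beta>)), u)) \<circ> sys_act m Ac (int (Suc h)) = (\<lambda>(v, u). (v (c0 \<sigma>), u))"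
      unfolding ab c(1)[OF 1] sys_act_up[OF Suc.prems(1)]
      using le by (auto simp: fun_eq_iff elem_act_up[OF Suc.prems(1)] simp del: of_nat_Suc)
    ultimately show ?thesis by (simp only:)
  next
    case 2
    show ?thesis unfolding move(2)[OF 2] unfolding ab c(2)[OF 2]
      using Suc.prems(1) by (intro Suc.IH d s td t) simp
  qed
qed

end

section \<open>Right factors\<close>

definition elem_acts :: "nat \<Rightarrow> int list \<Rightarrow> complex mat list \<Rightarrow> state \<Rightarrow> state" where
  "elem_acts m t X = foldr (\<lambda>(i, Y). elem_act m i Y) (zip t X)"

lemma elem_acts_simps [simp]:
  "elem_acts m [] X s = s"
  "elem_acts m (i # t) (Y # X) s = elem_act m i Y (elem_acts m t X s)"
  by (simp_all add: elem_acts_def)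

text \<open>Block \<open>q = c0 \<beta>\<close> of the image depends on the argument only through block \<open>q\<close>, or through block \<open>q + 1\<close> if
  \<open>i = q + 1\<close>. The only index that would put a coefficient there is \<open>q\<close> itself, and the SIP excludes it.\<close>

lemma elem_act_c0:
  assumes "0 \<in> set \<beta>" "SIP (\<beta> @ [i])" "0 \<le> i" "i < int m"
  shows "fst (elem_act m i X s) (c0 \<beta>) = fst s (c0 (\<beta> @ [i]))"
proof -
  have ne: "i \<noteq> int (c0 \<beta>)" by (rule SIP_snoc_ne_c0[OF assms(2,1)])
  obtain v u where s: "s = (v, u)" by force
  show ?thesis
  proof (cases "nat i")
    case 0
    then have "i = 0" using assms(3) by simp
    then show ?thesis using ne by (simp add: c0_snoc[OF assms(1)] s elem_act_def)
  next
    case (Suc k)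
    then have i: "i = int (Suc k)" and k: "Suc k < m" using assms(3,4) by auto
    show ?thesis unfolding s i elem_act_up[OF k] c0_snoc[OF assms(1)]
      using ne i by (auto simp del: of_nat_Suc)
  qed
qed

lemma elem_acts_c0:
  assumes "0 \<in> set \<beta>" "SIP (\<beta> @ t)" "set t \<subseteq> {0..int m - 1}" "length X = length t"
  shows "fst (elem_acts m t X s) (c0 \<beta>) = fst s (c0 (\<beta> @ t))"
  using assms
proof (induction t arbitrary: \<beta> X)
  case (Cons i t)
  then obtain Y X' where X: "X = Y # X'" "length X' = length t" by (cases X) auto
  have S: "SIP ((\<beta> @ [i]) @ t)" using Cons.prems(2) by simp
  have "fst (elem_acts m (i # t) X s) (c0 \<beta>) = fst (elem_acts m t X' s) (c0 (\<beta> @ [i]))"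
    unfolding X elem_acts_simps using Cons.prems(1,3) by (intro elem_act_c0 SIP_prefix[OF S]) auto
  also have "\<dots> = fst s (c0 ((\<beta> @ [i]) @ t))"
    using Cons.prems X by (intro Cons.IH S) auto
  finally show ?case by simp
qed simp

lemma elem_acts_above:
  assumes "set t \<subseteq> {- int m..- int h - 2}" "length X = length t" "q \<le> h"
  shows "fst (elem_acts m t X s) q = fst s q"
  using assms
proof (induction t arbitrary: X)
  case (Cons i t)
  then obtain Y X' where X: "X = Y # X'" "length X' = length t" by (cases X) auto
  have i: "- int m \<le> i" "i \<le> - int h - 2" using Cons.prems(1) by auto
  have "fst (elem_act m i Y s) q = fst s q" for s
  proof -
    obtain v u where s: "s = (v, u)" by force
    have "q \<noteq> nat (- i)" "q \<noteq> nat (- i) - Suc 0" "i < 0" using i Cons.prems(3) by linarith+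
    moreover have "q \<noteq> m - Suc 0" if "i = - int m" using that i Cons.prems(3) by linarith
    ultimately show ?thesis unfolding s elem_act_def by simp
  qed
  then show ?case using Cons.IH[of X'] Cons.prems X by simp
qed simp

lemma snd_elem_act [simp]: "snd (elem_act m i X s) = snd s"
  by (simp add: elem_act_def split: prod.splits)

lemma snd_elem_acts [simp]: "snd (elem_acts m t X s) = snd s"
proof -
  have "snd (foldr (\<lambda>(i, Y). elem_act m i Y) ps s) = snd s" for ps
    by (induction ps) (auto split: prod.splits)
  then show ?thesis unfolding elem_acts_def .
qed

lemma invertible_mat_obtain:
  fixes X :: "complex mat"
  assumes "invertible_mat X" "X \<in> carrier_mat n n"
  obtains Y where "Y \<in> carrier_mat n n" "X * Y = 1\<^sub>m n" "Y * X = 1\<^sub>m n"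
proof -
  obtain Y where Y: "X * Y = 1\<^sub>m (dim_row X)" "Y * X = 1\<^sub>m (dim_row Y)"
    using assms(1) unfolding invertible_mat_def inverts_mat_def by auto
  have "dim_col Y = dim_col (X * Y)" "dim_row Y = dim_row (Y * X)" "dim_col X = dim_col (Y * X)" by simp_all
  then have "Y \<in> carrier_mat n n" using assms(2) unfolding Y by (intro carrier_matI) auto
  then show ?thesis using that Y assms(2) by auto
qed

lemma bij_elem_act:
  assumes X: "X \<in> carrier_mat n n" and i: "- int m \<le> i" "i < int m"
    and ns: "i \<in> {0, - int m} \<Longrightarrow> invertible_mat X"
  shows "bij_betw (elem_act m i X) (state_space n r m) (state_space n r m)"
proof -
  have "\<exists>j Y. Y \<in> carrier_mat n n \<and> - int m \<le> j \<and> j < int m \<and>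
    (\<forall>s\<in>state_space n r m. elem_act m j Y (elem_act m i X s) = s \<and> elem_act m i X (elem_act m j Y s) = s)"
  proof (cases "i \<in> {0, - int m}")
    case True
    obtain Y where Y: "Y \<in> carrier_mat n n" "X * Y = 1\<^sub>m n" "Y * X = 1\<^sub>m n"
      using invertible_mat_obtain[OF ns[OF True] X] .
    have inv: "X *\<^sub>v (Y *\<^sub>v x) = x" "Y *\<^sub>v (X *\<^sub>v x) = x" if "x \<in> carrier_vec n" for x
      using that X Y by (simp_all add: assoc_mult_mat_vec[symmetric, of _ n n _ n])
    have "\<forall>s\<in>state_space n r m. elem_act m i Y (elem_act m i X s) = s \<and> elem_act m i X (elem_act m i Y s) = s"
    proof
      fix s assume "s \<in> state_space n r m"
      then obtain v u where s: "s = (v, u)" and v: "v k \<in> carrier_vec n" for k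
        by (cases s) (auto simp: state_space_def)
      note cancel = inv[OF v]
      show "elem_act m i Y (elem_act m i X s) = s \<and> elem_act m i X (elem_act m i Y s) = s"
        using True unfolding s by (cases "i = 0") (simp_all add: elem_act_def cancel)
    qed
    then show ?thesis using Y(1) i by blast
  next
    case False
    then consider k where "i = int (Suc k)" "Suc k < m" | k where "i = - int (Suc k)" "Suc k < m"
    proof (cases "i > 0")
      case True
      then show ?thesis using that(1)[of "nat (i - 1)"] i by simp
    next
      case nonpos: False
      have "i = - int (Suc (nat (- i - 1)))" "Suc (nat (- i - 1)) < m"
        using nonpos i False by auto
      then show ?thesis by (rule that(2))
    qed
    then show ?thesis
    proof cases
      case 1
      have "- (- X) = X" using X by auto
      then have "\<forall>s\<in>state_space n r m. elem_act m (- int (Suc k)) (- X) (elem_act m i X s) = s \<and>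
          elem_act m i X (elem_act m (- int (Suc k)) (- X) s) = s"
        using elem_act_inverse[of "- X" n k m _ r] X 1 by auto
      then show ?thesis using X 1
        by (intro exI[of _ "- int (Suc k)"] exI[of _ "- X"]) auto
    next
      case 2
      have "\<forall>s\<in>state_space n r m. elem_act m (int (Suc k)) (- X) (elem_act m i X s) = s \<and>
          elem_act m i X (elem_act m (int (Suc k)) (- X) s) = s"
        using elem_act_inverse[of X n k m _ r] X 2 by auto
      then show ?thesis using X 2
        by (intro exI[of _ "int (Suc k)"] exI[of _ "- X"]) auto
    qed
  qed
  then obtain j Y where Y: "Y \<in> carrier_mat n n" "- int m \<le> j" "j < int m"
    "\<forall>s\<in>state_space n r m. elem_act m j Y (elem_act m i X s) = s"
    "\<forall>s\<in>state_space n r m. elem_act m i X (elem_act m j Y s) = s" by blast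
  show ?thesis
    by (rule bij_betw_byWitness[where f' = "elem_act m j Y"])
      (use Y(4,5) elem_act_closed[OF X i, of _ r] elem_act_closed[OF Y(1-3), of _ r] in blast)+
qed

lemma nonsingular_assignment_Cons:
  "nonsingular_assignment m (i # t) (Y # X) \<longleftrightarrow>
     (i \<in> {0, - int m} \<longrightarrow> invertible_mat Y) \<and> nonsingular_assignment m t X"
  unfolding nonsingular_assignment_def
  by (auto simp: less_Suc_eq_0_disj)

lemma bij_elem_acts:
  assumes "matrix_assignment n t X" "nonsingular_assignment m t X" "set t \<subseteq> {- int m..int m - 1}"
  shows "bij_betw (elem_acts m t X) (state_space n r m) (state_space n r m)"
  using assms
proof (induction t arbitrary: X)
  case Nil
  have "elem_acts m [] X = (\<lambda>s. s)" by (rule ext) simp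
  then show ?case by (simp add: bij_betw_def)
next
  case (Cons i t)
  then obtain Y X' where X: "X = Y # X'" by (cases X) (auto simp: matrix_assignment_def)
  have "bij_betw (elem_act m i Y \<circ> elem_acts m t X') (state_space n r m) (state_space n r m)"
  proof (rule bij_betw_trans)
    show "bij_betw (elem_acts m t X') (state_space n r m) (state_space n r m)"
      using Cons.prems unfolding X nonsingular_assignment_Cons
      by (intro Cons.IH) (auto simp: matrix_assignment_def)
    show "bij_betw (elem_act m i Y) (state_space n r m) (state_space n r m)"
      using Cons.prems unfolding X nonsingular_assignment_Cons
      by (intro bij_elem_act) (auto simp: matrix_assignment_def)
  qed
  moreover have "elem_acts m (i # t) X = elem_act m i Y \<circ> elem_acts m t X'"
    unfolding X by (rule ext) simp
  ultimately show ?case by (simp only:)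
qed

section \<open>From block coordinates to vectors and matrices\<close>

text \<open>The \<open>d\<close> consecutive blocks from \<open>v a\<close> on, with the highest index on top. The base \<open>a\<close> is needed to cut a vector
  into segments.\<close>

primrec stack :: "nat \<Rightarrow> nat \<Rightarrow> (nat \<Rightarrow> complex vec) \<Rightarrow> complex vec" where
  "stack a 0 v = vNil"
| "stack a (Suc d) v = v (a + d) @\<^sub>v stack a d v"

lemma append_vec_assoc: "(x @\<^sub>v y) @\<^sub>v z = x @\<^sub>v y @\<^sub>v z"
  by (rule eq_vecI) auto

lemma append_vNil_right: "x @\<^sub>v vNil = x"
  by (rule eq_vecI) auto

lemma stack_carrier [simp, intro]: "(\<And>k. v k \<in> carrier_vec n) \<Longrightarrow> stack a d v \<in> carrier_vec (d * n)"
  by (induction d) auto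

lemma stack_append: "stack a (d + e) v = stack (a + e) d v @\<^sub>v stack a e v"
  by (induction d) (auto simp: append_vec_assoc ac_simps)

lemma stack_cong: "(\<And>k. a \<le> k \<Longrightarrow> k < a + d \<Longrightarrow> v k = w k) \<Longrightarrow> stack a d v = stack a d w"
  by (induction d) auto

lemma stack_add:
  assumes "\<And>k. v k \<in> carrier_vec n" "\<And>k. w k \<in> carrier_vec n"
  shows "stack a d v + stack a d w = stack a d (\<lambda>k. v k + w k)"
proof (induction d)
  case (Suc d)
  show ?case unfolding stack.simps Suc[symmetric] using assms by (intro append_vec_add) auto
qed auto

lemma stack_inj:
  assumes "\<And>k. v k \<in> carrier_vec n" "\<And>k. w k \<in> carrier_vec n" "stack a d v = stack a d w" "k < d"
  shows "v (a + k) = w (a + k)"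
  using assms(3,4)
proof (induction d)
  case (Suc d)
  have "v (a + d) = w (a + d)" "stack a d v = stack a d w"
    using Suc.prems(1) append_vec_eq[OF assms(1) assms(2)] by auto
  then show ?case using Suc by (cases "k = d") auto
qed simp

lemma stack_surj:
  assumes "x \<in> carrier_vec (m * n)"
  shows "\<exists>v. (\<forall>k. v k \<in> carrier_vec n) \<and> (\<forall>k\<ge>m. v k = 0\<^sub>v n) \<and> stack 0 m v = x"
  using assms
proof (induction m arbitrary: x)
  case 0
  then have "x = vNil" by (intro eq_vecI) auto
  then show ?case by (intro exI[of _ "\<lambda>_. 0\<^sub>v n"]) simp
next
  case (Suc m)
  then have x: "x \<in> carrier_vec (n + m * n)" by simp
  obtain v where v: "\<forall>k. v k \<in> carrier_vec n" "\<forall>k\<ge>m. v k = 0\<^sub>v n" "stack 0 m v = vec_last x (m * n)"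
    using Suc.IH[of "vec_last x (m * n)"] by auto
  have "stack 0 m (v(m := vec_first x n)) = stack 0 m v" by (rule stack_cong) auto
  then have "stack 0 (Suc m) (v(m := vec_first x n)) = x"
    using v(3) vec_first_last_append[OF x] by simp
  moreover have "\<forall>k. (v(m := vec_first x n)) k \<in> carrier_vec n" using v(1) by simp
  moreover have "\<forall>k\<ge>Suc m. (v(m := vec_first x n)) k = 0\<^sub>v n" using v(2) by auto
  ultimately show ?case by blast
qed

lemma zero_mat_mult_vec: "w \<in> carrier_vec b \<Longrightarrow> (0\<^sub>m a b :: complex mat) *\<^sub>v w = 0\<^sub>v a"
  by (intro eq_vecI) auto

definition state_vec :: "nat \<Rightarrow> state \<Rightarrow> complex vec" where
  "state_vec m = (\<lambda>(v, u). stack 0 m v @\<^sub>v u)"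

lemma bij_state_vec: "bij_betw (state_vec m) (state_space n r m) (carrier_vec (m * n + r))"
proof (intro bij_betw_imageI inj_onI)
  fix s t assume s: "s \<in> state_space n r m" and t: "t \<in> state_space n r m" and eq: "state_vec m s = state_vec m t"
  obtain v u w x where st: "s = (v, u)" "t = (w, x)" by (cases s, cases t)
  have v: "\<And>k. v k \<in> carrier_vec n" "\<And>k. w k \<in> carrier_vec n"
    using s t by (simp_all add: st state_space_def)
  have "stack 0 m v = stack 0 m w" "u = x"
    using eq append_vec_eq[OF stack_carrier[OF v(1)] stack_carrier[OF v(2)]] by (auto simp: state_vec_def st)
  moreover have "v k = w k" for k
  proof (cases "k < m")
    case True
    then show ?thesis using stack_inj[OF v \<open>stack 0 m v = stack 0 m w\<close>] by simp
  next
    case False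
    then show ?thesis using s t by (simp add: st state_space_def)
  qed
  ultimately show "s = t" unfolding st by auto
next
  show "state_vec m ` state_space n r m = carrier_vec (m * n + r)"
  proof safe
    fix v u assume "(v, u) \<in> state_space n r m"
    then show "state_vec m (v, u) \<in> carrier_vec (m * n + r)"
      by (auto simp: state_space_def state_vec_def)
  next
    fix x :: "complex vec" assume x: "x \<in> carrier_vec (m * n + r)"
    obtain v where v: "\<forall>k. v k \<in> carrier_vec n" "\<forall>k\<ge>m. v k = 0\<^sub>v n" "stack 0 m v = vec_first x (m * n)"
      using stack_surj[of "vec_first x (m * n)" m n] by auto
    have "state_vec m (v, vec_last x r) = x" using v(3) vec_first_last_append[OF x] by (simp add: state_vec_def)
    moreover have "(v, vec_last x r) \<in> state_space n r m" using v by (simp add: state_space_def)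
    ultimately show "x \<in> state_vec m ` state_space n r m" by (metis image_eqI)
  qed
qed

lemma state_vec_carrier [simp]: "s \<in> state_space n r m \<Longrightarrow> state_vec m s \<in> carrier_vec (m * n + r)"
  using bij_betw_apply[OF bij_state_vec] .

lemma state_vec_inject: "s \<in> state_space n r m \<Longrightarrow> t \<in> state_space n r m \<Longrightarrow> state_vec m s = state_vec m t \<longleftrightarrow> s = t"
  using bij_betw_imp_inj_on[OF bij_state_vec] by (rule inj_on_eq_iff)

lemma state_vec_scale:
  assumes "s \<in> state_space n r m"
  shows "state_vec m (scale c s) = c \<cdot>\<^sub>v state_vec m s"
proof -
  have "stack 0 m (\<lambda>k. c \<cdot>\<^sub>v v k) = c \<cdot>\<^sub>v stack 0 m v" for v
    by (induction m) (auto intro!: eq_vecI)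
  then show ?thesis by (auto simp: state_vec_def scale_def split: prod.splits intro!: eq_vecI)
qed

lemma diag_block_mult_vec:
  assumes "X \<in> carrier_mat a a" "diag_block_mat Xs \<in> carrier_mat b b" "x \<in> carrier_vec a" "y \<in> carrier_vec b"
  shows "diag_block_mat (X # Xs) *\<^sub>v (x @\<^sub>v y) = X *\<^sub>v x @\<^sub>v diag_block_mat Xs *\<^sub>v y"
  using assms mult_mat_vec_split[OF assms] by (simp add: Let_def)

lemma diag_block_carrier:
  assumes "X \<in> carrier_mat a a" "diag_block_mat Xs \<in> carrier_mat b b"
  shows "diag_block_mat (X # Xs) \<in> carrier_mat (a + b) (a + b)"
  using assms by (simp add: Let_def)

lemma middle_block_action:
  assumes F: "F \<in> carrier_mat (n + n) (n + n)" and act: "F *\<^sub>v (v (Suc k) @\<^sub>v v k) = a @\<^sub>v b"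
    and v: "\<And>k. v k \<in> carrier_vec n"
  shows "diag_block_mat [1\<^sub>m (d * n), F, 1\<^sub>m (k * n)] \<in> carrier_mat ((d + (2 + k)) * n) ((d + (2 + k)) * n)"
    and "diag_block_mat [1\<^sub>m (d * n), F, 1\<^sub>m (k * n)] *\<^sub>v stack 0 (d + (2 + k)) v =
      stack 0 (d + (2 + k)) (v(Suc k := a, k := b))"
proof -
  let ?D = "diag_block_mat [1\<^sub>m (d * n), F, 1\<^sub>m (k * n)]"
  have tail: "diag_block_mat [F, 1\<^sub>m (k * n)] \<in> carrier_mat (n + n + k * n) (n + n + k * n)"
    using F by (intro diag_block_carrier) auto
  show "?D \<in> carrier_mat ((d + (2 + k)) * n) ((d + (2 + k)) * n)"
    using diag_block_carrier[OF one_carrier_mat tail, of "d * n"]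
    by (simp add: algebra_simps del: diag_block_mat.simps)
  have split: "stack 0 (d + (2 + k)) w = stack (2 + k) d w @\<^sub>v (w (Suc k) @\<^sub>v w k) @\<^sub>v stack 0 k w" for w
    unfolding stack_append by (simp add: append_vec_assoc numeral_2_eq_2)
  have "?D *\<^sub>v stack 0 (d + (2 + k)) v =
      1\<^sub>m (d * n) *\<^sub>v stack (2 + k) d v @\<^sub>v F *\<^sub>v (v (Suc k) @\<^sub>v v k) @\<^sub>v 1\<^sub>m (k * n) *\<^sub>v stack 0 k v"
    unfolding split using F tail v
    by (simp del: diag_block_mat.simps(2) add: diag_block_mult_vec[of _ "d * n" _ "n + n + k * n"]
        diag_block_mult_vec[of _ "n + n" _ "k * n"])
  also have "1\<^sub>m (d * n) *\<^sub>v stack (2 + k) d v = stack (2 + k) d v"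
    by (rule one_mult_mat_vec[OF stack_carrier[OF v]])
  also have "1\<^sub>m (k * n) *\<^sub>v stack 0 k v = stack 0 k v"
    by (rule one_mult_mat_vec[OF stack_carrier[OF v]])
  also have "stack (2 + k) d v @\<^sub>v F *\<^sub>v (v (Suc k) @\<^sub>v v k) @\<^sub>v stack 0 k v =
      stack 0 (d + (2 + k)) (v(Suc k := a, k := b))"
    unfolding split act by (intro arg_cong2[of _ _ _ _ "(@\<^sub>v)"] stack_cong) auto
  finally show "?D *\<^sub>v stack 0 (d + (2 + k)) v = stack 0 (d + (2 + k)) (v(Suc k := a, k := b))" .
qed

lemma elem_mat0_action:
  assumes m: "m \<ge> 1" and X: "X \<in> carrier_mat n n" and i: "- int m \<le> i" "i < int m"
    and v: "\<And>k. v k \<in> carrier_vec n"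
  shows "elem_mat0 n m i X \<in> carrier_mat (m * n) (m * n)"
    and "elem_mat0 n m i X *\<^sub>v stack 0 m v = stack 0 m (fst (elem_act m i X (v, u)))"
proof -
  obtain M where M: "m = Suc M" using m by (cases m) auto
  consider "i = 0" | "i = - int m" | k where "i = int (Suc k)" "Suc k < m" | k where "i = - int (Suc k)" "Suc k < m"
  proof (cases "i > 0")
    case True
    then show ?thesis using that(3)[of "nat (i - 1)"] i by simp
  next
    case False
    then show ?thesis using that(1,2) that(4)[of "nat (- i - 1)"] i by (cases "i = 0"; cases "i = - int m") auto
  qed
  then have "elem_mat0 n m i X \<in> carrier_mat (m * n) (m * n) \<and>
    elem_mat0 n m i X *\<^sub>v stack 0 m v = stack 0 m (fst (elem_act m i X (v, u)))"
  proof cases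
    case 1
    have eq: "elem_mat0 n m i X = diag_block_mat [1\<^sub>m (M * n), X]"
      using 1 M by (simp add: elem_mat0_def)
    have s: "stack 0 m w = stack 1 M w @\<^sub>v w 0" for w
      using stack_append[of 0 M 1 w] M by (simp add: append_vNil_right)
    have "elem_mat0 n m i X *\<^sub>v stack 0 m v = 1\<^sub>m (M * n) *\<^sub>v stack 1 M v @\<^sub>v X *\<^sub>v v 0"
      unfolding eq s using X v by (subst diag_block_mult_vec[of _ "M * n" _ n]) (auto simp del: diag_block_mat.simps(2))
    also have "\<dots> = stack 1 M v @\<^sub>v X *\<^sub>v v 0"
      using stack_carrier[OF v, of 1 M] by (simp only: one_mult_mat_vec)
    also have "\<dots> = stack 0 m (fst (elem_act m i X (v, u)))"
      unfolding s using 1 stack_cong[of 1 M v "v(0 := X *\<^sub>v v 0)"] by (simp add: elem_act_def)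
    finally show ?thesis
      using diag_block_carrier[of "1\<^sub>m (M * n)" "M * n" "[X]" n] X
      by (simp add: eq[unfolded M] M add.commute del: diag_block_mat.simps(2))
  next
    case 2
    have eq: "elem_mat0 n m i X = diag_block_mat [X, 1\<^sub>m (M * n)]"
      using 2 M by (simp add: elem_mat0_def)
    have "elem_mat0 n m i X *\<^sub>v stack 0 m v = X *\<^sub>v v M @\<^sub>v 1\<^sub>m (M * n) *\<^sub>v stack 0 M v"
      unfolding eq unfolding M using X v by (simp del: diag_block_mat.simps add: diag_block_mult_vec[of _ n _ "M * n"])
    also have "\<dots> = X *\<^sub>v v M @\<^sub>v stack 0 M v"
      using stack_carrier[OF v, of 0 M] by (simp only: one_mult_mat_vec)
    also have "\<dots> = stack 0 m (fst (elem_act m i X (v, u)))"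
      using 2 M stack_cong[of 0 M v "v(M := X *\<^sub>v v M)"] by (simp add: elem_act_def)
    finally show ?thesis
      using diag_block_carrier[of X n "[1\<^sub>m (M * n)]" "M * n"] X
      by (simp add: eq[unfolded M] M del: diag_block_mat.simps(2))
  next
    case (3 k)
    define d where "d = m - Suc k - 1"
    have md: "m = d + (2 + k)" using 3 d_def by simp
    let ?F = "four_block_mat X (1\<^sub>m n) (1\<^sub>m n) (0\<^sub>m n n)"
    have eq: "elem_mat0 n m i X = diag_block_mat [1\<^sub>m (d * n), ?F, 1\<^sub>m (k * n)]"
      using 3 unfolding elem_mat0_def d_def by (simp del: of_nat_Suc diag_block_mat.simps)
    have F: "?F \<in> carrier_mat (n + n) (n + n)" using X by auto
    have act: "?F *\<^sub>v (v (Suc k) @\<^sub>v v k) = (X *\<^sub>v v (Suc k) + v k) @\<^sub>v (v (Suc k))"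
      using four_block_mat_mult_vec[OF X one_carrier_mat one_carrier_mat zero_carrier_mat v v, of "Suc k" k] v
      by (simp add: zero_mat_mult_vec[OF v])
    have new: "fst (elem_act m i X (v, u)) = v(Suc k := X *\<^sub>v v (Suc k) + v k, k := v (Suc k))"
      unfolding 3(1) elem_act_up[OF 3(2)] by (simp only: fst_conv)
    show ?thesis
      unfolding new using middle_block_action[OF F act v, of d, folded md eq] by blast
  next
    case (4 k)
    define d where "d = m - Suc k - 1"
    have md: "m = d + (2 + k)" using 4 d_def by simp
    let ?F = "four_block_mat (0\<^sub>m n n) (1\<^sub>m n) (1\<^sub>m n) X"
    have eq: "elem_mat0 n m i X = diag_block_mat [1\<^sub>m (d * n), ?F, 1\<^sub>m (k * n)]"
      using 4 unfolding elem_mat0_def d_def by (simp del: of_nat_Suc diag_block_mat.simps)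
    have F: "?F \<in> carrier_mat (n + n) (n + n)" using X by auto
    have act: "?F *\<^sub>v (v (Suc k) @\<^sub>v v k) = (v k) @\<^sub>v (v (Suc k) + X *\<^sub>v v k)"
      using four_block_mat_mult_vec[OF zero_carrier_mat one_carrier_mat one_carrier_mat X v v, of "Suc k" k] v
      by (simp add: zero_mat_mult_vec[OF v])
    have new: "fst (elem_act m i X (v, u)) = v(Suc k := v k, k := v (Suc k) + X *\<^sub>v v k)"
      unfolding 4(1) elem_act_down[OF 4(2)] by (simp only: fst_conv)
    show ?thesis
      unfolding new using middle_block_action[OF F act v, of d, folded md eq] by blast
  qed
  then show "elem_mat0 n m i X \<in> carrier_mat (m * n) (m * n)"
    "elem_mat0 n m i X *\<^sub>v stack 0 m v = stack 0 m (fst (elem_act m i X (v, u)))" by auto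
qed

declare diag_block_mat.simps(2) [simp del]

lemma mat_eq_by_action:
  fixes X Y :: "complex mat"
  assumes "X \<in> carrier_mat a b" "Y \<in> carrier_mat a b"
    and "\<And>x. x \<in> carrier_vec b \<Longrightarrow> X *\<^sub>v x = Y *\<^sub>v x"
  shows "X = Y"
proof (rule eq_matI)
  fix i j assume ij: "i < dim_row Y" "j < dim_col Y"
  have "(X *\<^sub>v unit_vec b j) $ i = (Y *\<^sub>v unit_vec b j) $ i" using assms(3) by simp
  then show "X $$ (i, j) = Y $$ (i, j)" using assms(1,2) ij by simp
qed (use assms in auto)

lemma mat_inv_eqI:
  assumes "M \<in> carrier_mat N N" "M' \<in> carrier_mat N N" "M * M' = 1\<^sub>m N" "M' * M = 1\<^sub>m N"
  shows "mat_inv M = M'"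
proof (cases "mat_inverse M")
  case None
  have "M \<in> Units (ring_mat TYPE(complex) N ())"
    using assms by (auto simp: Units_def ring_mat_def)
  then show ?thesis using mat_inverse(1)[OF assms(1) None, where b = "()"] by simp
next
  case (Some M'')
  then have M'': "M * M'' = 1\<^sub>m N" "M'' * M = 1\<^sub>m N" "M'' \<in> carrier_mat N N"
    using mat_inverse(2)[OF assms(1) Some] by auto
  have "M'' = M'' * (M * M')" unfolding assms(3) using M''(3) by simp
  also have "\<dots> = (M'' * M) * M'" by (rule assoc_mult_mat[OF M''(3) assms(1,2), symmetric])
  also have "\<dots> = M'" unfolding M''(2) using assms by simp
  finally show ?thesis using Some by simp
qed

lemma elem_mat_action:
  assumes m: "m \<ge> 1" and X: "X \<in> carrier_mat n n" and i: "- int m \<le> i" "i < int m"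
  shows "elem_mat n m r i X \<in> carrier_mat (m * n + r) (m * n + r)"
    and "s \<in> state_space n r m \<Longrightarrow> elem_mat n m r i X *\<^sub>v state_vec m s = state_vec m (elem_act m i X s)"
proof -
  have c: "elem_mat0 n m i X \<in> carrier_mat (m * n) (m * n)"
    by (rule elem_mat0_action[OF m X i, of "\<lambda>_. 0\<^sub>v n"]) simp
  then show "elem_mat n m r i X \<in> carrier_mat (m * n + r) (m * n + r)"
    unfolding elem_mat_def by (intro diag_block_carrier) simp_all
  assume s: "s \<in> state_space n r m"
  then obtain v u where vu: "s = (v, u)" and v: "\<And>k. v k \<in> carrier_vec n" and u: "u \<in> carrier_vec r"
    by (cases s) (auto simp: state_space_def)
  have "elem_mat n m r i X *\<^sub>v state_vec m s = elem_mat0 n m i X *\<^sub>v stack 0 m v @\<^sub>v 1\<^sub>m r *\<^sub>v u"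
    unfolding elem_mat_def vu state_vec_def prod.case
    using diag_block_mult_vec[OF c, of "[1\<^sub>m r]" r "stack 0 m v" u] v u by simp
  also have "\<dots> = stack 0 m (fst (elem_act m i X s)) @\<^sub>v snd (elem_act m i X s)"
    using elem_mat0_action(2)[OF m X i v, where u = u] u by (simp add: vu)
  finally show "elem_mat n m r i X *\<^sub>v state_vec m s = state_vec m (elem_act m i X s)"
    by (simp only: state_vec_def case_prod_beta)
qed

lemma elem_mat_inverse:
  assumes k: "Suc k < m" and X: "X \<in> carrier_mat n n"
  shows "elem_mat n m r (int (Suc k)) (- X) * elem_mat n m r (- int (Suc k)) X = 1\<^sub>m (m * n + r)"
    and "elem_mat n m r (- int (Suc k)) X * elem_mat n m r (int (Suc k)) (- X) = 1\<^sub>m (m * n + r)"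
proof -
  let ?N = "m * n + r" and ?U = "elem_mat n m r (int (Suc k)) (- X)" and ?D = "elem_mat n m r (- int (Suc k)) X"
  have X': "- X \<in> carrier_mat n n" using X by simp
  have r: "- int m \<le> int (Suc k)" "int (Suc k) < int m" "- int m \<le> - int (Suc k)" "- int (Suc k) < int m" "m \<ge> 1"
    using k by auto
  note U = elem_mat_action[OF r(5) X' r(1,2), where r = r] and D = elem_mat_action[OF r(5) X r(3,4), where r = r]
  have "(?U * ?D) *\<^sub>v x = 1\<^sub>m ?N *\<^sub>v x" "(?D * ?U) *\<^sub>v x = 1\<^sub>m ?N *\<^sub>v x" if x: "x \<in> carrier_vec ?N" for x
  proof -
    obtain s where s: "s \<in> state_space n r m" "x = state_vec m s"
      using bij_betw_imp_surj_on[OF bij_state_vec] x by blast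
    note cl = elem_act_closed[OF X' r(1,2) s(1)] elem_act_closed[OF X r(3,4) s(1)]
    have "(?U * ?D) *\<^sub>v x = ?U *\<^sub>v (?D *\<^sub>v x)" using U(1) D(1) x by (rule assoc_mult_mat_vec)
    also have "\<dots> = state_vec m s" unfolding s(2) D(2)[OF s(1)] U(2)[OF cl(2)] elem_act_inverse(1)[OF X k s(1)] ..
    finally show "(?U * ?D) *\<^sub>v x = 1\<^sub>m ?N *\<^sub>v x" using x s(2) by simp
    have "(?D * ?U) *\<^sub>v x = ?D *\<^sub>v (?U *\<^sub>v x)" using D(1) U(1) x by (rule assoc_mult_mat_vec)
    also have "\<dots> = state_vec m s" unfolding s(2) U(2)[OF s(1)] D(2)[OF cl(1)] elem_act_inverse(2)[OF X k s(1)] ..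
    finally show "(?D * ?U) *\<^sub>v x = 1\<^sub>m ?N *\<^sub>v x" using x s(2) by simp
  qed
  then show "?U * ?D = 1\<^sub>m ?N" "?D * ?U = 1\<^sub>m ?N"
    using U(1) D(1) by (auto intro!: mat_eq_by_action[of _ ?N ?N])
qed

lemma stack_index:
  assumes "\<And>k. w k \<in> carrier_vec n" "c < m * n"
  shows "stack 0 m w $ c = w (m - 1 - c div n) $ (c mod n)"
  using assms(2)
proof (induction m arbitrary: c)
  case (Suc m)
  have d: "dim_vec (w m) = n" using assms(1)[of m] by simp
  have d': "dim_vec (stack 0 m w) = m * n" using stack_carrier[OF assms(1), of 0 m] by simp
  show ?case
  proof (cases "c < n")
    case True
    then show ?thesis using d d' by simp
  next
    case False
    then have "n > 0" "c - n < m * n" using Suc.prems by (auto intro: gr0I)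
    moreover have "c div n = Suc ((c - n) div n)" "c mod n = (c - n) mod n"
      using False \<open>n > 0\<close> by (simp_all add: le_div_geq le_mod_geq)
    ultimately show ?thesis using d d' Suc.prems False Suc.IH[of "c - n"] by simp
  qed
qed simp

lemma stack_scalar_prod:
  assumes "\<And>k. v k \<in> carrier_vec n" "\<And>k. w k \<in> carrier_vec n"
  shows "stack 0 m v \<bullet> stack 0 m w = (\<Sum>k<m. v k \<bullet> w k)"
proof (induction m)
  case (Suc m)
  then show ?case
    using scalar_prod_append[OF assms(1) stack_carrier[OF assms(1)] assms(2) stack_carrier[OF assms(2)]]
    by (simp add: add.commute)
qed (simp add: scalar_prod_def)

text \<open>Row \<open>i\<close> of the Kronecker product is row \<open>i\<close> of \<open>X\<close>, placed in block \<open>m - j\<close>.\<close>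

lemma kron_unit_row:
  assumes X: "X \<in> carrier_mat a n" and j: "1 \<le> j" "j \<le> m"
  shows "kron (transpose_mat (unit_col m j)) X \<in> carrier_mat a (m * n)"
    and "(\<And>k. v k \<in> carrier_vec n) \<Longrightarrow> kron (transpose_mat (unit_col m j)) X *\<^sub>v stack 0 m v = X *\<^sub>v v (m - j)"
proof -
  let ?K = "kron (transpose_mat (unit_col m j)) X"
  show c: "?K \<in> carrier_mat a (m * n)" using X by (simp add: kron_def unit_col_def)
  assume v: "\<And>k. v k \<in> carrier_vec n"
  show "?K *\<^sub>v stack 0 m v = X *\<^sub>v v (m - j)"
  proof (rule eq_vecI)
    fix i assume "i < dim_vec (X *\<^sub>v v (m - j))"
    then have i: "i < a" using X by simp
    let ?w = "(\<lambda>_. 0\<^sub>v n)(m - j := row X i)"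
    have w: "?w k \<in> carrier_vec n" for k using X by auto
    have "row ?K i = stack 0 m ?w"
    proof (rule eq_vecI)
      show "dim_vec (row ?K i) = dim_vec (stack 0 m ?w)"
        using c stack_carrier[of ?w n 0 m, OF w] by simp
      fix k assume "k < dim_vec (stack 0 m ?w)"
      then have k: "k < m * n" using stack_carrier[of ?w n 0 m, OF w] by simp
      then have "n > 0" by (auto intro: gr0I)
      with k have n: "n > 0" "k mod n < n" "k div n < m" by (auto simp: less_mult_imp_div_less)
      have "row ?K i $ k = (if Suc (k div n) = j then X $$ (i, k mod n) else 0)"
        using c X i k n by (simp add: kron_def unit_col_def)
      also have "\<dots> = ?w (m - 1 - k div n) $ (k mod n)"
        using n j i X by auto
      also have "\<dots> = stack 0 m ?w $ k" by (rule stack_index[OF w k, symmetric])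
      finally show "row ?K i $ k = stack 0 m ?w $ k" .
    qed
    then have "(?K *\<^sub>v stack 0 m v) $ i = stack 0 m ?w \<bullet> stack 0 m v" using c i by simp
    also have "\<dots> = (\<Sum>k<m. ?w k \<bullet> v k)" by (rule stack_scalar_prod[OF w v])
    also have "\<dots> = (\<Sum>k<m. if k = m - j then row X i \<bullet> v k else 0)"
      using v by (intro sum.cong) auto
    also have "\<dots> = row X i \<bullet> v (m - j)" using j by simp
    finally show "(?K *\<^sub>v stack 0 m v) $ i = (X *\<^sub>v v (m - j)) $ i" using X i by simp
  qed (use c X in simp)
qed

lemma kron_unit_last_col:
  assumes X: "X \<in> carrier_mat n a" and m: "m \<ge> 1"
  shows "kron (unit_col m m) X \<in> carrier_mat (m * n) a"
    and "u \<in> carrier_vec a \<Longrightarrow> kron (unit_col m m) X *\<^sub>v u = stack 0 m ((\<lambda>_. 0\<^sub>v n)(0 := X *\<^sub>v u))"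
proof -
  let ?K = "kron (unit_col m m) X"
  show c: "?K \<in> carrier_mat (m * n) a" using X by (simp add: kron_def unit_col_def)
  assume u: "u \<in> carrier_vec a"
  let ?w = "(\<lambda>_. 0\<^sub>v n)(0 := X *\<^sub>v u)"
  have w: "?w k \<in> carrier_vec n" for k using X u by auto
  show "?K *\<^sub>v u = stack 0 m ?w"
  proof (rule eq_vecI)
    fix k assume "k < dim_vec (stack 0 m ?w)"
    then have k: "k < m * n" using stack_carrier[of ?w n 0 m, OF w] by simp
    then have "n > 0" by (auto intro: gr0I)
      with k have n: "n > 0" "k mod n < n" "k div n < m" by (auto simp: less_mult_imp_div_less)
    have "row ?K k = (if Suc (k div n) = m then row X (k mod n) else 0\<^sub>v a)"
      using c X k n by (intro eq_vecI) (auto simp: kron_def unit_col_def)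
    then have "(?K *\<^sub>v u) $ k = (if Suc (k div n) = m then row X (k mod n) \<bullet> u else 0)"
      using c k u by simp
    also have "\<dots> = ?w (m - 1 - k div n) $ (k mod n)" using n X by auto
    also have "\<dots> = stack 0 m ?w $ k" by (rule stack_index[OF w k, symmetric])
    finally show "(?K *\<^sub>v u) $ k = stack 0 m ?w $ k" .
  qed (use c stack_carrier[of ?w n 0 m, OF w] in simp)
qed

lemma uminus_kron:
  fixes X Y :: "complex mat"
  shows "- kron X Y = kron X (- Y)"
proof (rule eq_matI)
  fix i j assume "i < dim_row (kron X (- Y))" "j < dim_col (kron X (- Y))"
  then have ij: "i < dim_row X * dim_row Y" "j < dim_col X * dim_col Y" by (simp_all add: kron_def)
  then have "0 < dim_row Y" "0 < dim_col Y" by (auto intro: gr0I)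
  then have "i mod dim_row Y < dim_row Y" "j mod dim_col Y < dim_col Y" by simp_all
  then show "(- kron X Y) $$ (i, j) = kron X (- Y) $$ (i, j)" using ij by (simp add: kron_def)
qed (simp_all add: kron_def)

context pencil_at
begin

text \<open>For negative indices the Fiedler matrix is defined as an inverse; it is again an elementary matrix.\<close>

lemma fiedler_sys_elem:
  assumes Ac: "\<And>i. i \<le> m \<Longrightarrow> Ac i \<in> carrier_mat n n"
    and i: "- int m < i" "i < int m" "i \<noteq> 0"
  shows "fiedler_sys n m r Ac A E B C i = elem_mat n m r i (if i > 0 then - Ac (nat i) else Ac (nat (- i)))"
proof (cases "i > 0")
  case True
  then show ?thesis using i by (simp add: fiedler_sys_def fiedler_poly_def elem_mat_def)
next
  case False
  define k where "k = nat (- i - 1)"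
  have k: "i = - int (Suc k)" "Suc k < m" using i False by (simp_all add: k_def)
  have X: "Ac (Suc k) \<in> carrier_mat n n" using Ac k by simp
  let ?U = "elem_mat n m r (int (Suc k)) (- Ac (Suc k))"
  have "fiedler_sys n m r Ac A E B C i = mat_inv ?U"
    using k by (simp add: fiedler_sys_def fiedler_poly_def elem_mat_def del: of_nat_Suc)
  also have "mat_inv ?U = elem_mat n m r i (Ac (Suc k))"
    unfolding k(1) using k X
    by (intro mat_inv_eqI[of _ "m * n + r"] elem_mat_inverse elem_mat_action) auto
  finally show ?thesis using k False by (simp del: of_nat_Suc)
qed

lemma fiedler_sys_action:
  assumes Ac: "\<And>i. i \<le> m \<Longrightarrow> Ac i \<in> carrier_mat n n" and m: "m \<ge> 1"
    and i: "- int m \<le> i" "i < int m"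
  shows "fiedler_sys n m r Ac A E B C i \<in> carrier_mat (m * n + r) (m * n + r)"
    and "s \<in> states m \<Longrightarrow> fiedler_sys n m r Ac A E B C i *\<^sub>v state_vec m s = state_vec m (sys_act m Ac i s)"
proof -
  let ?F = "fiedler_sys n m r Ac A E B C i"
  have "?F \<in> carrier_mat (m * n + r) (m * n + r) \<and> (s \<in> states m \<longrightarrow> ?F *\<^sub>v state_vec m s = state_vec m (sys_act m Ac i s))"
  proof (cases "i = 0 \<or> i = - int m")
    case False
    have X: "(if i > 0 then - Ac (nat i) else Ac (nat (- i))) \<in> carrier_mat n n"
      using Ac[of "nat i"] Ac[of "nat (- i)"] i by auto
    have "?F = elem_mat n m r i (if i > 0 then - Ac (nat i) else Ac (nat (- i)))"
      using i False by (intro fiedler_sys_elem Ac) auto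
    moreover have "sys_act m Ac i = elem_act m i (if i > 0 then - Ac (nat i) else Ac (nat (- i)))"
      using False by (intro sys_act_elem) auto
    ultimately show ?thesis using elem_mat_action[OF m X i, where r = r] by (intro conjI impI) (simp_all only:)
  next
    case True
    define X where "X = (if i = 0 then - Ac 0 else Ac m)"
    have X: "X \<in> carrier_mat n n" using Ac by (simp add: X_def)
    have P: "fiedler_poly n m Ac i = elem_mat0 n m i X" using True by (auto simp: fiedler_poly_def X_def)
    have Pc: "elem_mat0 n m i X \<in> carrier_mat (m * n) (m * n)"
      by (rule elem_mat0_action[OF m X i, of "\<lambda>_. 0\<^sub>v n"]) simp
    have act: "elem_mat0 n m i X *\<^sub>v stack 0 m v = stack 0 m (fst (elem_act m i X (v, u)))"
      if "\<And>k. v k \<in> carrier_vec n" for v u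
      using that by (rule elem_mat0_action[OF m X i])
    show ?thesis
    proof (cases "i = 0")
      case False
      then have im: "i = - int m" using True by simp
      have E': "- E \<in> carrier_mat r r" by simp
      have F: "?F = diag_block_mat [elem_mat0 n m i X, - E]"
        using P m unfolding im fiedler_sys_def by simp
      have "?F *\<^sub>v state_vec m s = state_vec m (sys_act m Ac i s)" if s: "s \<in> states m"
      proof -
        obtain v u where vu: "s = (v, u)" and v: "\<And>k. v k \<in> carrier_vec n" and u: "u \<in> carrier_vec r"
          using s by (cases s) (auto simp: state_space_def)
        have "?F *\<^sub>v state_vec m s = elem_mat0 n m i X *\<^sub>v stack 0 m v @\<^sub>v (- E) *\<^sub>v u"
          unfolding F vu state_vec_def prod.case
          using diag_block_mult_vec[OF Pc, of "[- E]" r "stack 0 m v" u] v u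
          by (simp del: diag_block_mat.simps(2))
        also have "(- E) *\<^sub>v u = - (E *\<^sub>v u)"
          using u carrier_matD(2)[OF E] by (intro uminus_mult_mat_vec) simp
        also have "elem_mat0 n m i X *\<^sub>v stack 0 m v = stack 0 m (v(m - 1 := Ac m *\<^sub>v v (m - 1)))"
          unfolding act[OF v, where u = u] using False by (simp add: im elem_act_def X_def)
        finally show ?thesis unfolding vu im sys_act_top[OF m] state_vec_def prod.case .
      qed
      then show ?thesis
        using diag_block_carrier[OF Pc, of "[- E]" r] by (simp add: F del: diag_block_mat.simps(2))
    next
      case i0: True
      have K: "- kron (unit_col m m) C \<in> carrier_mat (m * n) r" "- kron (transpose_mat (unit_col m m)) B \<in> carrier_mat r (m * n)"
        using kron_unit_last_col(1)[OF C m] kron_unit_row(1)[OF B m] by auto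
      have A': "- A \<in> carrier_mat r r" by simp
      have F: "?F = four_block_mat (elem_mat0 n m 0 X) (- kron (unit_col m m) C)
          (- kron (transpose_mat (unit_col m m)) B) (- A)"
        using P unfolding i0 fiedler_sys_def by simp
      have "?F *\<^sub>v state_vec m s = state_vec m (sys_act m Ac i s)" if s: "s \<in> states m"
      proof -
        obtain v u where vu: "s = (v, u)" and v: "\<And>k. v k \<in> carrier_vec n" and u: "u \<in> carrier_vec r"
          using s by (cases s) (auto simp: state_space_def)
        have Cu: "C *\<^sub>v u \<in> carrier_vec n" "B *\<^sub>v v 0 \<in> carrier_vec r" "A *\<^sub>v u \<in> carrier_vec r"
          "Ac 0 *\<^sub>v v 0 \<in> carrier_vec n"
          using u v Ac[of 0] by (auto intro!: mult_mat_vec_carrier)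
        have neg: "(- Ac 0) *\<^sub>v v 0 = - (Ac 0 *\<^sub>v v 0)"
          using v[of 0] Ac[of 0] by (intro uminus_mult_mat_vec) auto
        let ?v = "v(0 := - (Ac 0 *\<^sub>v v 0))" and ?w = "(\<lambda>_. 0\<^sub>v n)(0 := - (C *\<^sub>v u))"
        have "?F *\<^sub>v state_vec m s = (elem_mat0 n m 0 X *\<^sub>v stack 0 m v + (- kron (unit_col m m) C) *\<^sub>v u)
            @\<^sub>v ((- kron (transpose_mat (unit_col m m)) B) *\<^sub>v stack 0 m v + (- A) *\<^sub>v u)"
          unfolding F vu state_vec_def prod.case
          by (rule four_block_mat_mult_vec[OF Pc[unfolded i0] K A' stack_carrier[OF v] u])
        also have "elem_mat0 n m 0 X *\<^sub>v stack 0 m v = stack 0 m ?v"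
          using act[OF v, where u = u] by (simp add: i0 elem_act_def X_def neg)
        also have "(- kron (unit_col m m) C) *\<^sub>v u = stack 0 m ?w"
        proof -
          have "(- C) *\<^sub>v u = - (C *\<^sub>v u)"
          using u carrier_matD(2)[OF C] by (intro uminus_mult_mat_vec) simp
          moreover have "- kron (unit_col m m) C = kron (unit_col m m) (- C)" by (rule uminus_kron)
          ultimately show ?thesis using kron_unit_last_col(2)[of "- C" n r m u] m u by simp
        qed
        also have "stack 0 m ?v + stack 0 m ?w = stack 0 m (\<lambda>k. ?v k + ?w k)"
          using v Cu by (intro stack_add) auto
        also have "(\<lambda>k. ?v k + ?w k) = v(0 := - (Ac 0 *\<^sub>v v 0) - C *\<^sub>v u)"
          using v Cu by (auto simp: fun_eq_iff minus_add_uminus_vec[of _ n])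
        also have "(- kron (transpose_mat (unit_col m m)) B) *\<^sub>v stack 0 m v = - (B *\<^sub>v v 0)"
          using kron_unit_row[OF B m order_refl] v stack_carrier[OF v, of 0 m]
          by (subst uminus_mult_mat_vec) auto
        also have "(- A) *\<^sub>v u = - (A *\<^sub>v u)"
          using u carrier_matD(2)[OF A] by (intro uminus_mult_mat_vec) simp
        also have "- (B *\<^sub>v v 0) + - (A *\<^sub>v u) = - (B *\<^sub>v v 0) - A *\<^sub>v u"
          using Cu by (intro minus_add_uminus_vec[symmetric]) auto
        finally show ?thesis unfolding vu i0 sys_act_bottom state_vec_def prod.case .
      qed
      then show ?thesis using four_block_carrier_mat[OF Pc[unfolded i0] A'] by (simp add: F)
    qed
  qed
  then show "?F \<in> carrier_mat (m * n + r) (m * n + r)"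
    "s \<in> states m \<Longrightarrow> ?F *\<^sub>v state_vec m s = state_vec m (sys_act m Ac i s)" by auto
qed

end

section \<open>The kernel of the pencil\<close>

lemma mat_prod_append:
  assumes "set Ms \<subseteq> carrier_mat N N" "set Ms' \<subseteq> carrier_mat N N"
  shows "mat_prod N Ms \<in> carrier_mat N N" "mat_prod N (Ms @ Ms') = mat_prod N Ms * mat_prod N Ms'"
proof -
  have c: "mat_prod N Ms \<in> carrier_mat N N" if "set Ms \<subseteq> carrier_mat N N" for Ms
    using that by (induction Ms) (auto simp: mat_prod_def)
  show "mat_prod N Ms \<in> carrier_mat N N" by (rule c[OF assms(1)])
  show "mat_prod N (Ms @ Ms') = mat_prod N Ms * mat_prod N Ms'"
    using assms(1)
  proof (induction Ms)
    case Nil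
    then show ?case using c[OF assms(2)] by (simp add: mat_prod_def)
  next
    case (Cons M Ms)
    have M: "M \<in> carrier_mat N N" "set Ms \<subseteq> carrier_mat N N" using Cons.prems by auto
    have "mat_prod N ((M # Ms) @ Ms') = M * (mat_prod N Ms * mat_prod N Ms')"
      using Cons.IH[OF M(2)] by (simp add: mat_prod_def)
    also have "\<dots> = M * mat_prod N Ms * mat_prod N Ms'"
      by (rule assoc_mult_mat[OF M(1) c[OF M(2)] c[OF assms(2)], symmetric])
    finally show ?case by (simp add: mat_prod_def)
  qed
qed

lemma mat_prod_action:
  assumes "\<And>a. a \<in> set as \<Longrightarrow> F a \<in> carrier_mat N N"
    and "\<And>a s. a \<in> set as \<Longrightarrow> s \<in> S \<Longrightarrow> f a s \<in> S \<and> F a *\<^sub>v e s = e (f a s)"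
    and "\<And>s. s \<in> S \<Longrightarrow> e s \<in> carrier_vec N" "s \<in> S"
  shows "mat_prod N (map F as) *\<^sub>v e s = e (foldr f as s) \<and> foldr f as s \<in> S"
  using assms(1,2)
proof (induction as)
  case Nil
  then show ?case using assms(3)[OF assms(4)] assms(4) by (simp add: mat_prod_def)
next
  case (Cons a as)
  have IH: "mat_prod N (map F as) *\<^sub>v e s = e (foldr f as s)" "foldr f as s \<in> S"
    using Cons.IH Cons.prems by auto
  have P: "mat_prod N (map F as) \<in> carrier_mat N N"
    using Cons.prems(1) by (intro mat_prod_append(1)[of _ _ "[]"]) auto
  have a: "F a \<in> carrier_mat N N" using Cons.prems(1) by simp
  have "mat_prod N (map F (a # as)) *\<^sub>v e s = F a *\<^sub>v (mat_prod N (map F as) *\<^sub>v e s)"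
    using assoc_mult_mat_vec[OF a P assms(3)[OF assms(4)]] by (simp add: mat_prod_def)
  then show ?case using Cons.prems(2)[of a "foldr f as s"] IH by simp
qed

lemma elem_prod_action:
  assumes m: "m \<ge> 1" and X: "matrix_assignment n t X" and t: "set t \<subseteq> {- int m..int m - 1}"
  shows "elem_prod n m r t X \<in> carrier_mat (m * n + r) (m * n + r)"
    and "s \<in> state_space n r m \<Longrightarrow> elem_prod n m r t X *\<^sub>v state_vec m s = state_vec m (elem_acts m t X s)"
    and "s \<in> state_space n r m \<Longrightarrow> elem_acts m t X s \<in> state_space n r m"
proof -
  let ?F = "\<lambda>(i, Y). elem_mat n m r i Y" and ?f = "\<lambda>(i, Y). elem_act m i Y"
  have eq: "elem_prod n m r t X = mat_prod (m * n + r) (map ?F (zip t X))"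
    by (simp add: elem_prod_def)
  have p: "Y \<in> carrier_mat n n \<and> - int m \<le> i \<and> i < int m" if "(i, Y) \<in> set (zip t X)" for i Y
    using that X t by (auto simp: matrix_assignment_def dest: set_zip_leftD set_zip_rightD)
  have c: "?F a \<in> carrier_mat (m * n + r) (m * n + r)" if "a \<in> set (zip t X)" for a
  proof -
    obtain i Y where a: "a = (i, Y)" by force
    show ?thesis unfolding a prod.case using p[of i Y] that unfolding a by (intro elem_mat_action(1)[OF m]) blast+
  qed
  have f: "?f a s \<in> state_space n r m \<and> ?F a *\<^sub>v state_vec m s = state_vec m (?f a s)"
    if "a \<in> set (zip t X)" "s \<in> state_space n r m" for a s
  proof -
    obtain i Y where a: "a = (i, Y)" by force
    show ?thesis unfolding a prod.case using p[of i Y] that unfolding a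
      by (intro conjI elem_mat_action(2)[OF m] elem_act_closed) blast+
  qed
  show "elem_prod n m r t X \<in> carrier_mat (m * n + r) (m * n + r)"
    unfolding eq using c by (intro mat_prod_append(1)[of _ _ "[]"]) auto
  show "elem_prod n m r t X *\<^sub>v state_vec m s = state_vec m (elem_acts m t X s)" if "s \<in> state_space n r m"
    unfolding eq elem_acts_def using mat_prod_action[of "zip t X" ?F, OF c f state_vec_carrier that] by blast
  show "elem_acts m t X s \<in> state_space n r m" if "s \<in> state_space n r m"
    unfolding eq elem_acts_def using mat_prod_action[of "zip t X" ?F, OF c f state_vec_carrier that] by blast
qed

lemma vec_diff_eq_0_iff:
  fixes x y :: "complex vec"
  assumes "x \<in> carrier_vec a" "y \<in> carrier_vec a"
  shows "x - y = 0\<^sub>v a \<longleftrightarrow> x = y"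
  using assms by (auto simp: vec_eq_iff)

lemma mat_mult_zero_vec: "(M :: complex mat) \<in> carrier_mat a b \<Longrightarrow> M *\<^sub>v 0\<^sub>v b = 0\<^sub>v a"
  by (intro eq_vecI) auto

lemma trivial_kernel_by_action:
  assumes M: "M \<in> carrier_mat (m * n + r) (m * n + r)"
    and act: "\<And>s. s \<in> state_space n r m \<Longrightarrow> M *\<^sub>v state_vec m s = state_vec m (f s)"
    and f: "bij_betw f (state_space n r m) (state_space n r m)"
    and x: "x \<in> carrier_vec (m * n + r)" "M *\<^sub>v x = 0\<^sub>v (m * n + r)"
  shows "x = 0\<^sub>v (m * n + r)"
proof -
  obtain s where s: "s \<in> state_space n r m" "x = state_vec m s"
    using bij_betw_imp_surj_on[OF bij_state_vec] x(1) by blast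
  obtain t where t: "t \<in> state_space n r m" "0\<^sub>v (m * n + r) = state_vec m t"
    using bij_betw_imp_surj_on[OF bij_state_vec, of m n r] zero_carrier_vec[of "m * n + r"] by blast
  have "M *\<^sub>v 0\<^sub>v (m * n + r) = 0\<^sub>v (m * n + r)" using M by (intro eq_vecI) auto
  then have "state_vec m (f s) = state_vec m (f t)" using act[OF s(1)] act[OF t(1)] x(2) s(2) t(2) by simp
  then have "f s = f t"
    using state_vec_inject[OF bij_betw_apply[OF f s(1)] bij_betw_apply[OF f t(1)]] by simp
  then have "s = t" using bij_betw_imp_inj_on[OF f] s(1) t(1) by (auto dest: inj_onD)
  then show ?thesis using s t by simp
qed

text \<open>This matrix keeps block row \<open>j\<close> and the last \<open>r\<close> coordinates.\<close>

definition block_selector :: "nat \<Rightarrow> nat \<Rightarrow> nat \<Rightarrow> nat \<Rightarrow> complex mat" where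
  "block_selector n m r j = four_block_mat (kron (transpose_mat (unit_col m j)) (1\<^sub>m n)) (0\<^sub>m n r) (0\<^sub>m r (m * n)) (1\<^sub>m r)"

lemma block_selector_action:
  assumes "1 \<le> j" "j \<le> m"
  shows "block_selector n m r j \<in> carrier_mat (n + r) (m * n + r)"
    and "s \<in> state_space n r m \<Longrightarrow> block_selector n m r j *\<^sub>v state_vec m s = fst s (m - j) @\<^sub>v snd s"
    and "Zmn \<in> carrier_mat (m * n) p \<Longrightarrow> Zr \<in> carrier_mat r p \<Longrightarrow>
      block_selector n m r j * (Zmn @\<^sub>r Zr) = (kron (transpose_mat (unit_col m j)) (1\<^sub>m n) * Zmn) @\<^sub>r Zr"
proof -
  let ?K = "kron (transpose_mat (unit_col m j)) (1\<^sub>m n) :: complex mat"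
  have one: "1\<^sub>m n \<in> carrier_mat n n" by simp
  have K: "?K \<in> carrier_mat n (m * n)" by (rule kron_unit_row(1)[OF one assms])
  show "block_selector n m r j \<in> carrier_mat (n + r) (m * n + r)"
    unfolding block_selector_def using four_block_carrier_mat[OF K, of "1\<^sub>m r" r r] by simp
  show "block_selector n m r j *\<^sub>v state_vec m s = fst s (m - j) @\<^sub>v snd s" if s: "s \<in> state_space n r m"
  proof -
    obtain v u where vu: "s = (v, u)" and v: "\<And>k. v k \<in> carrier_vec n" and u: "u \<in> carrier_vec r"
      using s by (cases s) (auto simp: state_space_def)
    have "block_selector n m r j *\<^sub>v state_vec m s = (?K *\<^sub>v stack 0 m v + 0\<^sub>m n r *\<^sub>v u) @\<^sub>v (0\<^sub>m r (m * n) *\<^sub>v stack 0 m v + 1\<^sub>m r *\<^sub>v u)"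
      unfolding vu state_vec_def prod.case block_selector_def
      by (rule four_block_mat_mult_vec[OF K _ _ _ stack_carrier[OF v] u]) auto
    also have "?K *\<^sub>v stack 0 m v = v (m - j)" using kron_unit_row(2)[OF one assms v] v by simp
    also have "0\<^sub>m n r *\<^sub>v u = 0\<^sub>v n" by (rule zero_mat_mult_vec[OF u])
    also have "0\<^sub>m r (m * n) *\<^sub>v stack 0 m v = 0\<^sub>v r" by (rule zero_mat_mult_vec[OF stack_carrier[OF v]])
    finally show ?thesis using v u by (simp add: vu)
  qed
  show "block_selector n m r j * (Zmn @\<^sub>r Zr) = (?K * Zmn) @\<^sub>r Zr"
    if Z: "Zmn \<in> carrier_mat (m * n) p" "Zr \<in> carrier_mat r p"
  proof -
    have "block_selector n m r j * (Zmn @\<^sub>r Zr) =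
      four_block_mat (?K * Zmn + 0\<^sub>m n r * Zr) (?K * 0\<^sub>m (m * n) 0 + 0\<^sub>m n r * 0\<^sub>m r 0)
        (0\<^sub>m r (m * n) * Zmn + 1\<^sub>m r * Zr) (0\<^sub>m r (m * n) * 0\<^sub>m (m * n) 0 + 1\<^sub>m r * 0\<^sub>m r 0)"
      unfolding block_selector_def append_rows_def using Z K
      by (subst mult_four_block_mat[of _ n "m * n" _ r _ r _ _ p _ 0]) auto
    also have "?K * Zmn + 0\<^sub>m n r * Zr = ?K * Zmn" using K Z by simp
    also have "0\<^sub>m r (m * n) * Zmn + 1\<^sub>m r * Zr = Zr" using Z by simp
    finally show ?thesis using K Z by (simp add: append_rows_def)
  qed
qed

context pencil_at
begin

lemma mat_kernel_sys_mat:
  "bij_betw (\<lambda>(x, u). x @\<^sub>v u) (sys_solutions m Ac) (mat_kernel (sys_mat n m Ac A E B C \<mu>))"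
    and sys_mat_carrier: "sys_mat n m Ac A E B C \<mu> \<in> carrier_mat (n + r) (n + r)"
proof -
  let ?S = "sys_mat n m Ac A E B C \<mu>"
  have D: "A - \<mu> \<cdot>\<^sub>m E \<in> carrier_mat r r" using minus_carrier_mat[of "\<mu> \<cdot>\<^sub>m E" r r A] by simp
  show c: "?S \<in> carrier_mat (n + r) (n + r)"
    unfolding sys_mat_def using four_block_carrier_mat[OF mat_poly_carrier D] .
  have act: "?S *\<^sub>v (x @\<^sub>v u) = (mat_poly n m Ac \<mu> *\<^sub>v x + C *\<^sub>v u) @\<^sub>v (B *\<^sub>v x + (A - \<mu> \<cdot>\<^sub>m E) *\<^sub>v u)"
    if "x \<in> carrier_vec n" "u \<in> carrier_vec r" for x u
    unfolding sys_mat_def by (rule four_block_mat_mult_vec[OF mat_poly_carrier C B D that])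
  have zero: "0\<^sub>v (n + r) = 0\<^sub>v n @\<^sub>v (0\<^sub>v r :: complex vec)" by (intro eq_vecI) auto
  have iff: "(x, u) \<in> sys_solutions m Ac \<longleftrightarrow> x \<in> carrier_vec n \<and> u \<in> carrier_vec r \<and> ?S *\<^sub>v (x @\<^sub>v u) = 0\<^sub>v (n + r)" for x u
  proof (cases "x \<in> carrier_vec n \<and> u \<in> carrier_vec r")
    case True
    have "mat_poly n m Ac \<mu> *\<^sub>v x + C *\<^sub>v u \<in> carrier_vec n"
      using True by (auto intro!: add_carrier_vec mult_mat_vec_carrier)
    then show ?thesis using True act append_vec_eq[of _ n "0\<^sub>v n"] by (simp add: sys_solutions_def zero)
  qed (auto simp: sys_solutions_def)
  show "bij_betw (\<lambda>(x, u). x @\<^sub>v u) (sys_solutions m Ac) (mat_kernel ?S)"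
  proof (intro bij_betw_imageI inj_onI)
    fix s t assume "s \<in> sys_solutions m Ac" "t \<in> sys_solutions m Ac"
      "(case s of (x, u) \<Rightarrow> x @\<^sub>v u) = (case t of (x, u) \<Rightarrow> x @\<^sub>v u)"
    then show "s = t" using append_vec_eq[of _ n] by (auto simp: sys_solutions_def)
  next
    show "(\<lambda>(x, u). x @\<^sub>v u) ` sys_solutions m Ac = mat_kernel ?S"
    proof safe
      fix x u assume "(x, u) \<in> sys_solutions m Ac"
      then show "x @\<^sub>v u \<in> mat_kernel ?S" unfolding iff by (intro mat_kernelI[OF c]) auto
    next
      fix y assume y: "y \<in> mat_kernel ?S"
      have split: "vec_first y n @\<^sub>v vec_last y r = y" by (rule vec_first_last_append[OF mat_kernelD(1)[OF c y]])
      then have "(vec_first y n, vec_last y r) \<in> sys_solutions m Ac"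
        unfolding iff using mat_kernelD(2)[OF c y] by simp
      then show "y \<in> (\<lambda>(x, u). x @\<^sub>v u) ` sys_solutions m Ac" using split by (metis (mono_tags, lifting) image_eqI prod.case)
    qed
  qed
qed

lemma fiedler_prod_action:
  assumes Ac: "\<And>i. i \<le> m \<Longrightarrow> Ac i \<in> carrier_mat n n" and m: "m \<ge> 1"
    and t: "set t \<subseteq> {- int m..int m - 1}"
  shows "fiedler_prod n m r Ac A E B C t \<in> carrier_mat (m * n + r) (m * n + r)"
    and "s \<in> states m \<Longrightarrow> fiedler_prod n m r Ac A E B C t *\<^sub>v state_vec m s = state_vec m (foldr (sys_act m Ac) t s)"
    and "s \<in> states m \<Longrightarrow> foldr (sys_act m Ac) t s \<in> states m"
proof -
  let ?F = "fiedler_sys n m r Ac A E B C"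
  have c: "?F i \<in> carrier_mat (m * n + r) (m * n + r)" if "i \<in> set t" for i
    using that t by (intro fiedler_sys_action Ac m) auto
  have f: "sys_act m Ac i s \<in> states m \<and> ?F i *\<^sub>v state_vec m s = state_vec m (sys_act m Ac i s)"
    if "i \<in> set t" "s \<in> states m" for i s
    using that t by (intro conjI fiedler_sys_action sys_act_closed Ac m) auto
  show "fiedler_prod n m r Ac A E B C t \<in> carrier_mat (m * n + r) (m * n + r)"
    unfolding fiedler_prod_def using c by (intro mat_prod_append(1)[of _ _ "[]"]) auto
  show "fiedler_prod n m r Ac A E B C t *\<^sub>v state_vec m s = state_vec m (foldr (sys_act m Ac) t s)" if "s \<in> states m"
    unfolding fiedler_prod_def using mat_prod_action[of t ?F, OF c f state_vec_carrier that] by blast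
  show "foldr (sys_act m Ac) t s \<in> states m" if "s \<in> states m"
    using mat_prod_action[of t ?F, OF c f state_vec_carrier that] by blast
qed

lemma gfpr_kernel_bij:
  assumes Ac: "\<And>i. i \<le> m \<Longrightarrow> Ac i \<in> carrier_mat n n" and m: "m \<ge> 1"
    and gfpr: "gfpr_data n m h \<sigma> \<tau> \<sigma>1 \<sigma>2 \<tau>1 \<tau>2 X1 X2 Y1 Y2"
    and ns: "nonsingular_assignment m \<sigma>1 X1" "nonsingular_assignment m \<sigma>2 X2"
      "nonsingular_assignment m \<tau>1 Y1" "nonsingular_assignment m \<tau>2 Y2"
  defines "L \<equiv> gfpr n m r Ac A E B C \<sigma> \<tau> \<sigma>1 \<sigma>2 \<tau>1 \<tau>2 X1 X2 Y1 Y2 \<mu>"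
    and "j \<equiv> m - c0 (\<sigma> @ \<sigma>2)"
  shows "1 \<le> j" "j \<le> m" "L \<in> carrier_mat (m * n + r) (m * n + r)"
    "bij_betw (\<lambda>x. block_selector n m r j *\<^sub>v x) (mat_kernel L) (mat_kernel (sys_mat n m Ac A E B C \<mu>))"
proof -
  have h: "h < m" using gfpr m by (auto simp: gfpr_data_def)
  have \<sigma>: "set \<sigma> = {0..int h}" "distinct \<sigma>" and \<tau>: "set \<tau> = {- int m..- int h - 1}" "distinct \<tau>"
    using gfpr by (auto simp: gfpr_data_def permutations_of_set_def)
  have sub: "set \<sigma>1 \<subseteq> {0..int h - 1}" "set \<sigma>2 \<subseteq> {0..int h - 1}"
    "set \<tau>1 \<subseteq> {- int m..- int h - 2}" "set \<tau>2 \<subseteq> {- int m..- int h - 2}"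
    and SIP: "SIP (\<sigma>1 @ \<sigma> @ \<sigma>2)"
    and asg: "matrix_assignment n \<sigma>1 X1" "matrix_assignment n \<sigma>2 X2"
      "matrix_assignment n \<tau>1 Y1" "matrix_assignment n \<tau>2 Y2"
    using gfpr by (auto simp: gfpr_data_def)
  have sub': "set \<sigma>1 \<subseteq> {- int m..int m - 1}" "set \<sigma>2 \<subseteq> {- int m..int m - 1}"
    "set \<tau>1 \<subseteq> {- int m..int m - 1}" "set \<tau>2 \<subseteq> {- int m..int m - 1}"
    "set \<sigma> \<subseteq> {- int m..int m - 1}" "set \<tau> \<subseteq> {- int m..int m - 1}"
    using sub h unfolding \<sigma> \<tau> by (auto dest!: subsetD)
  have 0: "0 \<in> set \<sigma>" "0 \<in> set (\<sigma> @ \<sigma>2)" using \<sigma> by auto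
  (* In the coordinates v the block row m - q of the matrices is block q. *)
  define q where "q = c0 (\<sigma> @ \<sigma>2)"
  have "int q \<in> set (\<sigma> @ \<sigma>2)" unfolding q_def by (rule c0_in_set[OF 0(2)])
  then have qh: "q \<le> h" using \<sigma> sub by auto
  show j: "1 \<le> j" "j \<le> m" using qh h by (auto simp: j_def q_def)
  have mj: "m - j = q" using qh h by (simp add: j_def q_def)
  let ?N = "m * n + r"
  let ?K1 = "elem_prod n m r \<tau>1 Y1" and ?K2 = "elem_prod n m r \<sigma>1 X1"
    and ?K3 = "elem_prod n m r \<sigma>2 X2" and ?K4 = "elem_prod n m r \<tau>2 Y2"
  let ?Ft = "fiedler_prod n m r Ac A E B C \<tau>" and ?Fs = "fiedler_prod n m r Ac A E B C \<sigma>"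
  note K1 = elem_prod_action[OF m asg(3) sub'(3), where r = r]
    and K2 = elem_prod_action[OF m asg(1) sub'(1), where r = r]
    and K3 = elem_prod_action[OF m asg(2) sub'(2), where r = r]
    and K4 = elem_prod_action[OF m asg(4) sub'(4), where r = r]
  note Fs = fiedler_prod_action[of m Ac, OF Ac m sub'(5)] and Ft = fiedler_prod_action[of m Ac, OF Ac m sub'(6)]
  let ?T = "\<mu> \<cdot>\<^sub>m ?Ft - ?Fs"
  have T: "?T \<in> carrier_mat ?N ?N" by (rule minus_carrier_mat[OF Fs(1)])
  have P: "?K1 * ?K2 \<in> carrier_mat ?N ?N" using K1(1) K2(1) by simp
  have Q: "?K3 * ?K4 \<in> carrier_mat ?N ?N" using K3(1) K4(1) by simp
  have L: "L = (?K1 * ?K2) * ?T * (?K3 * ?K4)" unfolding L_def gfpr_def ..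
  show Lc: "L \<in> carrier_mat ?N ?N" unfolding L using P T Q by simp
  define g where "g s = elem_acts m \<sigma>2 X2 (elem_acts m \<tau>2 Y2 s)" for s
  have bij_g: "bij_betw g (states m) (states m)"
    using bij_betw_trans[OF bij_elem_acts[OF asg(4) ns(4) sub'(4)] bij_elem_acts[OF asg(2) ns(2) sub'(2)]]
    by (simp add: g_def[abs_def] comp_def)
  have Qact: "(?K3 * ?K4) *\<^sub>v state_vec m s = state_vec m (g s)" if s: "s \<in> states m" for s
    using assoc_mult_mat_vec[OF K3(1) K4(1) state_vec_carrier[OF s]] K4(2)[OF s] K3(2)[OF K4(3)[OF s]] by (simp add: g_def)
  (* Every factor to the left of the pencil has trivial kernel, so only the right factor moves the
     kernel of the pencil. *)
  have left0: "(?K1 * ?K2) *\<^sub>v x = 0\<^sub>v ?N \<longleftrightarrow> x = 0\<^sub>v ?N" if x: "x \<in> carrier_vec ?N" for x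
  proof
    assume "(?K1 * ?K2) *\<^sub>v x = 0\<^sub>v ?N"
    then have "?K1 *\<^sub>v (?K2 *\<^sub>v x) = 0\<^sub>v ?N" using assoc_mult_mat_vec[OF K1(1) K2(1) x] by simp
    then have "?K2 *\<^sub>v x = 0\<^sub>v ?N"
      using trivial_kernel_by_action[OF K1(1,2) bij_elem_acts[OF asg(3) ns(3) sub'(3)]] mult_mat_vec_carrier[OF K2(1) x] by blast
    then show "x = 0\<^sub>v ?N"
      using trivial_kernel_by_action[OF K2(1,2) bij_elem_acts[OF asg(1) ns(1) sub'(1)]] x by blast
  next
    show "x = 0\<^sub>v ?N \<Longrightarrow> (?K1 * ?K2) *\<^sub>v x = 0\<^sub>v ?N" using mat_mult_zero_vec[OF P] by simp
  qed
  have T0: "?T *\<^sub>v state_vec m t = 0\<^sub>v ?N \<longleftrightarrow> t \<in> pencil_solutions m Ac \<sigma> \<tau>" if t: "t \<in> states m" for t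
  proof -
    have ft: "foldr (sys_act m Ac) \<tau> t \<in> states m" and fs: "foldr (sys_act m Ac) \<sigma> t \<in> states m"
      using Ft(3) Fs(3) t by auto
    have "?T *\<^sub>v state_vec m t = \<mu> \<cdot>\<^sub>v (?Ft *\<^sub>v state_vec m t) - ?Fs *\<^sub>v state_vec m t"
      using minus_mult_distrib_mat_vec[of "\<mu> \<cdot>\<^sub>m ?Ft" ?N ?N ?Fs "state_vec m t"] Ft(1) Fs(1) state_vec_carrier[OF t]
        smult_mat_mult_vec[OF Ft(1) state_vec_carrier[OF t]] by simp
    also have "\<dots> = state_vec m (scale \<mu> (foldr (sys_act m Ac) \<tau> t)) - state_vec m (foldr (sys_act m Ac) \<sigma> t)"
      using Ft(2) Fs(2) t state_vec_scale[OF ft] by simp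
    finally have eq: "?T *\<^sub>v state_vec m t = state_vec m (scale \<mu> (foldr (sys_act m Ac) \<tau> t)) - state_vec m (foldr (sys_act m Ac) \<sigma> t)" .
    have "?T *\<^sub>v state_vec m t = 0\<^sub>v ?N \<longleftrightarrow> state_vec m (scale \<mu> (foldr (sys_act m Ac) \<tau> t)) = state_vec m (foldr (sys_act m Ac) \<sigma> t)"
      unfolding eq by (rule vec_diff_eq_0_iff[OF state_vec_carrier[OF scale_closed[OF ft]] state_vec_carrier[OF fs]])
    then show ?thesis
      unfolding state_vec_inject[OF scale_closed[OF ft] fs] pencil_solutions_def mem_Collect_eq using t by metis
  qed
  have L0: "state_vec m s \<in> mat_kernel L \<longleftrightarrow> g s \<in> pencil_solutions m Ac \<sigma> \<tau>" if s: "s \<in> states m" for s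
  proof -
    note gs = bij_betw_apply[OF bij_g s]
    have "L *\<^sub>v state_vec m s = (?K1 * ?K2) *\<^sub>v (?T *\<^sub>v ((?K3 * ?K4) *\<^sub>v state_vec m s))"
    proof -
      have "L *\<^sub>v state_vec m s = ((?K1 * ?K2) * ?T) *\<^sub>v ((?K3 * ?K4) *\<^sub>v state_vec m s)"
        unfolding L by (rule assoc_mult_mat_vec[OF mult_carrier_mat[OF P T] Q state_vec_carrier[OF s]])
      also have "\<dots> = (?K1 * ?K2) *\<^sub>v (?T *\<^sub>v ((?K3 * ?K4) *\<^sub>v state_vec m s))"
        by (rule assoc_mult_mat_vec[OF P T mult_mat_vec_carrier[OF Q state_vec_carrier[OF s]]])
      finally show ?thesis .
    qed
    then have "L *\<^sub>v state_vec m s = 0\<^sub>v ?N \<longleftrightarrow> g s \<in> pencil_solutions m Ac \<sigma> \<tau>"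
      unfolding Qact[OF s] using left0[OF mult_mat_vec_carrier[OF T state_vec_carrier[OF gs]]] T0[OF gs] by simp
    then show ?thesis using mat_kernel[OF Lc] state_vec_carrier[OF s] by simp
  qed
  define W where "W = {s \<in> states m. g s \<in> pencil_solutions m Ac \<sigma> \<tau>}"
  have encW: "bij_betw (state_vec m) W (mat_kernel L)"
  proof -
    have "bij_betw (state_vec m) {s \<in> states m. g s \<in> pencil_solutions m Ac \<sigma> \<tau>} {x \<in> carrier_vec ?N. x \<in> mat_kernel L}"
      using L0 by (intro bij_betw_restrict[OF bij_state_vec]) simp
    moreover have "{x \<in> carrier_vec ?N. x \<in> mat_kernel L} = mat_kernel L"
      using mat_kernel_carrier[OF Lc] by auto
    ultimately show ?thesis by (simp only: W_def)
  qed
  have gW: "bij_betw g W (pencil_solutions m Ac \<sigma> \<tau>)"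
  proof -
    have "bij_betw g {s \<in> states m. g s \<in> pencil_solutions m Ac \<sigma> \<tau>} {t \<in> states m. t \<in> pencil_solutions m Ac \<sigma> \<tau>}"
      by (intro bij_betw_restrict[OF bij_g]) simp
    moreover have "{t \<in> states m. t \<in> pencil_solutions m Ac \<sigma> \<tau>} = pencil_solutions m Ac \<sigma> \<tau>"
      by (auto simp: pencil_solutions_def)
    ultimately show ?thesis by (simp only: W_def)
  qed
  note core = c0_block_bij[of m Ac h \<sigma> \<tau>, OF Ac h \<sigma>(2,1) \<tau>(2,1)]
  (* The selector of L on block vectors is the composite of three bijections: the right factor,
     the selector of the Fiedler pencil, and the stacking of the two components. *)
  have all: "bij_betw ((\<lambda>(x, u). x @\<^sub>v u) \<circ> ((\<lambda>(v, u). (v (c0 \<sigma>), u)) \<circ> g)) W (mat_kernel (sys_mat n m Ac A E B C \<mu>))"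
    by (rule bij_betw_trans[OF bij_betw_trans[OF gW core] mat_kernel_sys_mat])
  have "((\<lambda>x. block_selector n m r j *\<^sub>v x) \<circ> state_vec m) s = ((\<lambda>(x, u). x @\<^sub>v u) \<circ> ((\<lambda>(v, u). (v (c0 \<sigma>), u)) \<circ> g)) s"
    if "s \<in> W" for s
  proof -
    have s: "s \<in> states m" using that by (simp add: W_def)
    have SIP': "SIP (\<sigma> @ \<sigma>2)" by (rule SIP_suffix[OF SIP])
    have "fst (g s) (c0 \<sigma>) = fst (elem_acts m \<tau>2 Y2 s) q"
      unfolding g_def q_def using sub(2) h asg(2)
      by (intro elem_acts_c0[OF 0(1) SIP']) (auto simp: matrix_assignment_def dest!: subsetD)
    also have "\<dots> = fst s q"
      using sub(4) asg(4) qh by (intro elem_acts_above[of \<tau>2 m h]) (auto simp: matrix_assignment_def)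
    finally have "fst (g s) (c0 \<sigma>) = fst s q" .
    moreover have "snd (g s) = snd s" by (simp add: g_def)
    ultimately show ?thesis using block_selector_action(2)[OF j s] mj by (simp add: case_prod_beta)
  qed
  then have "bij_betw ((\<lambda>x. block_selector n m r j *\<^sub>v x) \<circ> state_vec m) W (mat_kernel (sys_mat n m Ac A E B C \<mu>))"
    using all by (subst bij_betw_cong) auto
  then show "bij_betw (\<lambda>x. block_selector n m r j *\<^sub>v x) (mat_kernel L) (mat_kernel (sys_mat n m Ac A E B C \<mu>))"
    by (rule iffD2[OF bij_betw_comp_iff[OF encW]])
qed

end

section \<open>Bases under a bijection of kernels\<close>

lemma columns_form_basis_transport:
  assumes Q: "Q \<in> carrier_mat b a" and L: "L \<in> carrier_mat c a" and S: "S \<in> carrier_mat d b"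
    and bij: "bij_betw (\<lambda>x. Q *\<^sub>v x) (mat_kernel L) (mat_kernel S)"
    and Z: "Z \<in> carrier_mat a p" and basis: "columns_form_basis Z (mat_kernel L)"
  shows "columns_form_basis (Q * Z) (mat_kernel S)"
proof -
  interpret KL: kernel c a L by (unfold_locales, rule L)
  interpret KS: kernel d b S by (unfold_locales, rule S)
  let ?f = "\<lambda>x. Q *\<^sub>v x"
  have sub: "mat_kernel L \<subseteq> carrier_vec a" by (rule mat_kernel_carrier[OF L])
  have hom: "?f \<in> module_hom class_ring KL.VK KS.VK"
    unfolding module_hom_def using bij_betw_imp_surj_on[OF bij] sub Q
    by (auto simp: module_vec_def class_ring_simps mult_add_distrib_mat_vec[of Q b a] mult_mat_vec[of Q b a] subset_iff)
  interpret lin: linear_map class_ring KL.VK KS.VK ?f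
    by unfold_locales (rule hom)
  have dZ: "dim_row Z = a" and dQZ: "dim_row (Q * Z) = b" using Z Q by auto
  have dist: "distinct (cols Z)" and b: "KL.Ker.basis (set (cols Z))"
    using basis unfolding columns_form_basis_def dZ by auto
  have colsub: "set (cols Z) \<subseteq> mat_kernel L" using b unfolding KL.Ker.basis_def by simp
  have cols: "cols (Q * Z) = map ?f (cols Z)"
    using Q Z by (intro nth_equalityI) (auto simp: col_mult2[OF Q Z])
  have inj: "inj_on ?f (mat_kernel L)" using bij by (rule bij_betw_imp_inj_on)
  have "KS.Ker.basis (?f ` set (cols Z))"
  proof (rule lin.linear_inj_image_is_basis)
    show "inj_on ?f (carrier KL.VK)" using inj by simp
    show "?f ` carrier KL.VK = carrier KS.VK" using bij_betw_imp_surj_on[OF bij] by simp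
    show "KL.Ker.fin_dim" unfolding KL.Ker.fin_dim_def
      using b unfolding KL.Ker.basis_def by blast
  qed (rule b)
  moreover have "distinct (cols (Q * Z))"
    unfolding cols distinct_map using dist inj_on_subset[OF inj colsub] by simp
  ultimately show ?thesis unfolding columns_form_basis_def dQZ cols by simp
qed

section \<open>Transposition\<close>

lemma left_null_space_eq: "left_null_space F = mat_kernel (transpose_mat F)"
proof -
  have "mat_of_row x * F = 0\<^sub>m 1 (dim_col F) \<longleftrightarrow> transpose_mat F *\<^sub>v x = 0\<^sub>v (dim_col F)"
    if x: "x \<in> carrier_vec (dim_row F)" for x
  proof -
    have "(mat_of_row x * F) $$ (0, j) = (transpose_mat F *\<^sub>v x) $ j" if "j < dim_col F" for j
    proof -
      have "vec (dim_row F) (($) x) = x" using x by (intro eq_vecI) auto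
      moreover have "x \<bullet> col F j = col F j \<bullet> x" using x by (intro comm_scalar_prod[of _ "dim_row F"]) auto
      ultimately show ?thesis using that x by (simp add: mat_of_row_def)
    qed
    then have *: "\<forall>j<dim_col F. (mat_of_row x * F) $$ (0, j) = (transpose_mat F *\<^sub>v x) $ j" by blast
    have "mat_of_row x * F = 0\<^sub>m 1 (dim_col F) \<longleftrightarrow> (\<forall>j<dim_col F. (mat_of_row x * F) $$ (0, j) = 0)"
    proof
      assume "\<forall>j<dim_col F. (mat_of_row x * F) $$ (0, j) = 0"
      then show "mat_of_row x * F = 0\<^sub>m 1 (dim_col F)"
        by (intro eq_matI) (simp_all add: mat_of_row_def)
    qed simp
    also have "\<dots> \<longleftrightarrow> transpose_mat F *\<^sub>v x = 0\<^sub>v (dim_col F)"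
      using * by (auto simp: vec_eq_iff simp del: index_mult_mat_vec)
    finally show ?thesis .
  qed
  then show ?thesis unfolding left_null_space_def mat_kernel_def by auto
qed

lemma transpose_smult: "transpose_mat (c \<cdot>\<^sub>m M :: complex mat) = c \<cdot>\<^sub>m transpose_mat M"
  by (rule eq_matI) auto

lemma transpose_diag_block_mat:
  "transpose_mat (diag_block_mat Ms :: complex mat) = diag_block_mat (map transpose_mat Ms)"
proof (induction Ms)
  case (Cons M Ms)
  show ?case unfolding diag_block_mat.simps list.map Let_def Cons[symmetric]
    by (subst transpose_four_block_mat[of _ "dim_row M" "dim_col M" _ "dim_col (diag_block_mat Ms)" _ "dim_row (diag_block_mat Ms)"]) auto
qed simp

lemma transpose_kron: "transpose_mat (kron X Y :: complex mat) = kron (transpose_mat X) (transpose_mat Y)"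
proof (rule eq_matI)
  fix i j assume "i < dim_row (kron (transpose_mat X) (transpose_mat Y))" "j < dim_col (kron (transpose_mat X) (transpose_mat Y))"
  then have ij: "i < dim_col X * dim_col Y" "j < dim_row X * dim_row Y" by (simp_all add: kron_def)
  then have "0 < dim_row Y" "0 < dim_col Y" by (auto intro: gr0I)
  then have "i mod dim_col Y < dim_col Y" "j mod dim_row Y < dim_row Y"
    "i div dim_col Y < dim_col X" "j div dim_row Y < dim_row X"
    using ij by (simp_all add: less_mult_imp_div_less)
  then show "transpose_mat (kron X Y) $$ (i, j) = kron (transpose_mat X) (transpose_mat Y) $$ (i, j)"
    using ij by (simp add: kron_def)
qed (simp_all add: kron_def)

lemma transpose_elem_mat0:
  assumes "X \<in> carrier_mat n n"
  shows "transpose_mat (elem_mat0 n m i X) = elem_mat0 n m i (transpose_mat X)"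
proof -
  have "transpose_mat (four_block_mat X (1\<^sub>m n) (1\<^sub>m n) (0\<^sub>m n n)) = four_block_mat (transpose_mat X) (1\<^sub>m n) (1\<^sub>m n) (0\<^sub>m n n)"
    "transpose_mat (four_block_mat (0\<^sub>m n n) (1\<^sub>m n) (1\<^sub>m n) X) = four_block_mat (0\<^sub>m n n) (1\<^sub>m n) (1\<^sub>m n) (transpose_mat X)"
    using assms by (subst transpose_four_block_mat[of _ n n _ n _ n]; simp)+
  then show ?thesis by (simp add: elem_mat0_def transpose_diag_block_mat)
qed

lemma transpose_elem_mat:
  "X \<in> carrier_mat n n \<Longrightarrow> transpose_mat (elem_mat n m r i X) = elem_mat n m r i (transpose_mat X)"
  by (simp add: elem_mat_def transpose_diag_block_mat transpose_elem_mat0)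

lemma transpose_mat_prod:
  assumes "set Ms \<subseteq> carrier_mat N N"
  shows "transpose_mat (mat_prod N Ms) = mat_prod N (rev (map transpose_mat Ms))"
  using assms
proof (induction Ms)
  case (Cons M Ms)
  have M: "M \<in> carrier_mat N N" "mat_prod N Ms \<in> carrier_mat N N"
    using Cons.prems mat_prod_append(1)[of Ms N "[]"] by auto
  have c: "set (rev (map transpose_mat Ms)) \<subseteq> carrier_mat N N" "set [transpose_mat M] \<subseteq> carrier_mat N N"
    using Cons.prems by auto
  have "transpose_mat (mat_prod N (M # Ms)) = transpose_mat (mat_prod N Ms) * transpose_mat M"
    using transpose_mult[OF M] by (simp add: mat_prod_def)
  also have "transpose_mat M = mat_prod N [transpose_mat M]" using M by (simp add: mat_prod_def)
  also have "transpose_mat (mat_prod N Ms) * mat_prod N [transpose_mat M] = mat_prod N (rev (map transpose_mat (M # Ms)))"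
    using Cons mat_prod_append(2)[OF c] by simp
  finally show ?case .
qed (simp add: mat_prod_def)

lemma transpose_elem_prod:
  assumes "matrix_assignment n t X" "m \<ge> 1" "set t \<subseteq> {- int m..int m - 1}"
  shows "transpose_mat (elem_prod n m r t X) = elem_prod n m r (rev t) (rev (map transpose_mat X))"
proof -
  have p: "Y \<in> carrier_mat n n \<and> - int m \<le> i \<and> i < int m" if "(i, Y) \<in> set (zip t X)" for i Y
    using that assms by (auto simp: matrix_assignment_def dest: set_zip_leftD set_zip_rightD)
  have z: "zip (rev t) (rev (map transpose_mat X)) = rev (map (\<lambda>(i, Y). (i, transpose_mat Y)) (zip t X))"
    using assms(1) by (simp add: zip_rev zip_map2 matrix_assignment_def)
  have "transpose_mat (elem_prod n m r t X) =
      mat_prod (m * n + r) (rev (map transpose_mat (map (\<lambda>(i, Y). elem_mat n m r i Y) (zip t X))))"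
    unfolding elem_prod_def
  proof (rule transpose_mat_prod, rule subsetI)
    fix M assume "M \<in> set (map (\<lambda>(i, Y). elem_mat n m r i Y) (zip t X))"
    then obtain i Y where "(i, Y) \<in> set (zip t X)" "M = elem_mat n m r i Y" by auto
    then show "M \<in> carrier_mat (m * n + r) (m * n + r)" using p elem_mat_action(1)[OF assms(2)] by blast
  qed
  also have "map transpose_mat (map (\<lambda>(i, Y). elem_mat n m r i Y) (zip t X)) =
      map (\<lambda>(i, Y). elem_mat n m r i Y) (map (\<lambda>(i, Y). (i, transpose_mat Y)) (zip t X))"
    using p by (auto intro!: transpose_elem_mat)
  also have "mat_prod (m * n + r) (rev \<dots>) = elem_prod n m r (rev t) (rev (map transpose_mat X))"
    unfolding elem_prod_def z by (simp add: rev_map)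
  finally show ?thesis .
qed

lemma invertible_mat_transpose:
  fixes X :: "complex mat"
  assumes "invertible_mat X" "X \<in> carrier_mat n n"
  shows "invertible_mat (transpose_mat X)"
proof -
  obtain Y where Y: "Y \<in> carrier_mat n n" "X * Y = 1\<^sub>m n" "Y * X = 1\<^sub>m n"
    using invertible_mat_obtain[OF assms] .
  have "transpose_mat X * transpose_mat Y = 1\<^sub>m n" "transpose_mat Y * transpose_mat X = 1\<^sub>m n"
    using transpose_mult[OF Y(1) assms(2)] transpose_mult[OF assms(2) Y(1)]
    unfolding Y(2,3) transpose_one by (simp_all only:)
  then show ?thesis unfolding invertible_mat_def inverts_mat_def
    using assms(2) Y(1) by (auto intro!: exI[of _ "transpose_mat Y"])
qed

lemma matrix_assignment_rev:
  "matrix_assignment n t X \<Longrightarrow> matrix_assignment n (rev t) (rev (map transpose_mat X))"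
  by (auto simp: matrix_assignment_def)

lemma nonsingular_assignment_rev:
  assumes "matrix_assignment n t X" "nonsingular_assignment m t X"
  shows "nonsingular_assignment m (rev t) (rev (map transpose_mat X))"
  unfolding nonsingular_assignment_def
proof (intro allI impI)
  fix j assume j: "j < length (rev t)" "rev t ! j \<in> {0, - int m}"
  let ?k = "length t - Suc j"
  have len: "length X = length t" using assms(1) by (simp add: matrix_assignment_def)
  have k: "?k < length t" "t ! ?k \<in> {0, - int m}" using j by (simp_all add: rev_nth)
  have "X ! ?k \<in> carrier_mat n n" using assms(1) k len by (auto simp: matrix_assignment_def subset_iff)
  moreover have "invertible_mat (X ! ?k)" by (rule assms(2)[unfolded nonsingular_assignment_def, rule_format, OF k])
  ultimately have "invertible_mat (transpose_mat (X ! ?k))" by (rule invertible_mat_transpose[rotated])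
  then show "invertible_mat (rev (map transpose_mat X) ! j)" using j len by (simp add: rev_nth)
qed

lemma gfpr_data_rev:
  assumes "gfpr_data n m h \<sigma> \<tau> \<sigma>1 \<sigma>2 \<tau>1 \<tau>2 X1 X2 Y1 Y2"
  shows "gfpr_data n m h (rev \<sigma>) (rev \<tau>) (rev \<sigma>2) (rev \<sigma>1) (rev \<tau>2) (rev \<tau>1)
    (rev (map transpose_mat X2)) (rev (map transpose_mat X1)) (rev (map transpose_mat Y2)) (rev (map transpose_mat Y1))"
  using assms SIP_rev[of "\<sigma>1 @ \<sigma> @ \<sigma>2"] SIP_rev[of "\<tau>1 @ \<tau> @ \<tau>2"]
  by (auto simp: gfpr_data_def permutations_of_set_def matrix_assignment_rev)

lemma transpose_mat_poly:
  assumes "\<And>i. i \<le> m \<Longrightarrow> Ac i \<in> carrier_mat n n"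
  shows "transpose_mat (mat_poly n m Ac \<mu>) = mat_poly n m (\<lambda>i. transpose_mat (Ac i)) \<mu>"
proof (rule eq_matI)
  fix i j assume "i < dim_row (mat_poly n m (\<lambda>i. transpose_mat (Ac i)) \<mu>)" "j < dim_col (mat_poly n m (\<lambda>i. transpose_mat (Ac i)) \<mu>)"
  then have ij: "i < n" "j < n" by (auto simp: mat_poly_def)
  have "transpose_mat (Ac k) $$ (i, j) = Ac k $$ (j, i)" if "k \<le> m" for k
    using assms[OF that] ij by simp
  then show "transpose_mat (mat_poly n m Ac \<mu>) $$ (i, j) = mat_poly n m (\<lambda>i. transpose_mat (Ac i)) \<mu> $$ (i, j)"
    using ij by (simp add: mat_poly_def)
qed (auto simp: mat_poly_def)

context pencil_at
begin

lemma transpose_sys_mat: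
  assumes "\<And>i. i \<le> m \<Longrightarrow> Ac i \<in> carrier_mat n n"
  shows "transpose_mat (sys_mat n m Ac A E B C \<mu>) =
    sys_mat n m (\<lambda>i. transpose_mat (Ac i)) (transpose_mat A) (transpose_mat E) (transpose_mat C) (transpose_mat B) \<mu>"
proof -
  have D: "A - \<mu> \<cdot>\<^sub>m E \<in> carrier_mat r r" using minus_carrier_mat[of "\<mu> \<cdot>\<^sub>m E" r r A] by simp
  have "transpose_mat (A - \<mu> \<cdot>\<^sub>m E) = transpose_mat A - \<mu> \<cdot>\<^sub>m transpose_mat E"
    using transpose_minus[of A r r "\<mu> \<cdot>\<^sub>m E"] by (simp add: transpose_smult)
  then show ?thesis
    unfolding sys_mat_def transpose_four_block_mat[OF mat_poly_carrier C B D]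
    using transpose_mat_poly[of m Ac n \<mu>] assms by simp
qed

lemma transpose_fiedler_sys:
  assumes Ac: "\<And>i. i \<le> m \<Longrightarrow> Ac i \<in> carrier_mat n n" and m: "m \<ge> 1" and i: "- int m \<le> i" "i < int m"
  shows "transpose_mat (fiedler_sys n m r Ac A E B C i) = fiedler_sys n m r (\<lambda>i. transpose_mat (Ac i))
    (transpose_mat A) (transpose_mat E) (transpose_mat C) (transpose_mat B) i"
proof -
  interpret T: pencil_at n r "transpose_mat A" "transpose_mat E" "transpose_mat C" "transpose_mat B" \<mu>
    by unfold_locales simp_all
  have Ac': "transpose_mat (Ac i) \<in> carrier_mat n n" if "i \<le> m" for i using Ac[OF that] by simp
  consider "i = 0" | "i = - int m" "i \<noteq> 0" | "- int m < i" "i \<noteq> 0" using i by linarith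
  then show ?thesis
  proof cases
    case 1
    have P: "fiedler_poly n m Ac 0 \<in> carrier_mat (m * n) (m * n)"
      unfolding fiedler_poly_def using Ac[of 0] m by (intro elem_mat0_action(1)[where v = "\<lambda>_. 0\<^sub>v n"]) auto
    have tP: "transpose_mat (fiedler_poly n m Ac 0) = fiedler_poly n m (\<lambda>i. transpose_mat (Ac i)) 0"
      unfolding fiedler_poly_def using Ac[of 0] by (simp add: transpose_elem_mat0 transpose_uminus)
    have K: "- kron (unit_col m m) C \<in> carrier_mat (m * n) r" "- kron (transpose_mat (unit_col m m)) B \<in> carrier_mat r (m * n)"
      using kron_unit_last_col(1)[OF C m] kron_unit_row(1)[OF B m] by auto
    have A': "- A \<in> carrier_mat r r" by simp
    show ?thesis unfolding 1 fiedler_sys_def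
      using transpose_four_block_mat[OF P K A'] by (simp add: tP transpose_uminus transpose_kron)
  next
    case 2
    have "transpose_mat (fiedler_poly n m Ac i) = fiedler_poly n m (\<lambda>i. transpose_mat (Ac i)) i"
      unfolding fiedler_poly_def using Ac[of m] 2 by (simp add: transpose_elem_mat0)
    then show ?thesis using 2 by (simp add: fiedler_sys_def transpose_diag_block_mat transpose_uminus)
  next
    case 3
    have X: "(if i > 0 then - Ac (nat i) else Ac (nat (- i))) \<in> carrier_mat n n"
      using Ac[of "nat i"] Ac[of "nat (- i)"] i by auto
    show ?thesis
      using fiedler_sys_elem[of m Ac i] T.fiedler_sys_elem[of m "\<lambda>i. transpose_mat (Ac i)" i] Ac Ac' 3 i
        transpose_elem_mat[OF X, of m r i]
      by (auto simp: transpose_uminus split: if_splits)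
  qed
qed

lemma transpose_fiedler_prod:
  assumes Ac: "\<And>i. i \<le> m \<Longrightarrow> Ac i \<in> carrier_mat n n" and m: "m \<ge> 1" and t: "set t \<subseteq> {- int m..int m - 1}"
  shows "transpose_mat (fiedler_prod n m r Ac A E B C t) = fiedler_prod n m r (\<lambda>i. transpose_mat (Ac i))
    (transpose_mat A) (transpose_mat E) (transpose_mat C) (transpose_mat B) (rev t)"
proof -
  have sub: "set (map (fiedler_sys n m r Ac A E B C) t) \<subseteq> carrier_mat (m * n + r) (m * n + r)"
    using t by (auto intro!: fiedler_sys_action(1) Ac m)
  have eq: "map transpose_mat (map (fiedler_sys n m r Ac A E B C) t) =
    map (fiedler_sys n m r (\<lambda>i. transpose_mat (Ac i)) (transpose_mat A) (transpose_mat E) (transpose_mat C) (transpose_mat B)) t"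
    using t by (auto intro!: transpose_fiedler_sys Ac m)
  show ?thesis unfolding fiedler_prod_def transpose_mat_prod[OF sub] eq by (simp only: rev_map)
qed

text \<open>The transposed system has \<open>B\<close> and \<open>C\<close> interchanged, and the subscripts 1 and 2 of the index tuples are
  interchanged because left and right factors change places.\<close>

lemma transpose_gfpr:
  assumes Ac: "\<And>i. i \<le> m \<Longrightarrow> Ac i \<in> carrier_mat n n" and m: "m \<ge> 1"
    and gfpr: "gfpr_data n m h \<sigma> \<tau> \<sigma>1 \<sigma>2 \<tau>1 \<tau>2 X1 X2 Y1 Y2"
  shows "transpose_mat (gfpr n m r Ac A E B C \<sigma> \<tau> \<sigma>1 \<sigma>2 \<tau>1 \<tau>2 X1 X2 Y1 Y2 \<mu>) =
    gfpr n m r (\<lambda>i. transpose_mat (Ac i)) (transpose_mat A) (transpose_mat E) (transpose_mat C) (transpose_mat B)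
      (rev \<sigma>) (rev \<tau>) (rev \<sigma>2) (rev \<sigma>1) (rev \<tau>2) (rev \<tau>1)
      (rev (map transpose_mat X2)) (rev (map transpose_mat X1)) (rev (map transpose_mat Y2)) (rev (map transpose_mat Y1)) \<mu>"
proof -
  have h: "h < m" using gfpr m by (auto simp: gfpr_data_def)
  have rng: "set \<sigma>1 \<subseteq> {- int m..int m - 1}" "set \<sigma>2 \<subseteq> {- int m..int m - 1}"
    "set \<tau>1 \<subseteq> {- int m..int m - 1}" "set \<tau>2 \<subseteq> {- int m..int m - 1}"
    "set \<sigma> \<subseteq> {- int m..int m - 1}" "set \<tau> \<subseteq> {- int m..int m - 1}"
    using gfpr h by (auto simp: gfpr_data_def permutations_of_set_def dest!: subsetD)
  have asg: "matrix_assignment n \<sigma>1 X1" "matrix_assignment n \<sigma>2 X2"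
      "matrix_assignment n \<tau>1 Y1" "matrix_assignment n \<tau>2 Y2"
    using gfpr by (auto simp: gfpr_data_def)
  let ?N = "m * n + r"
  note c = elem_prod_action(1)[OF m asg(1) rng(1), where r = r] elem_prod_action(1)[OF m asg(2) rng(2), where r = r]
    elem_prod_action(1)[OF m asg(3) rng(3), where r = r] elem_prod_action(1)[OF m asg(4) rng(4), where r = r]
  note Fs = fiedler_prod_action(1)[of m Ac, OF Ac m rng(5)] and Ft = fiedler_prod_action(1)[of m Ac, OF Ac m rng(6)]
  have T: "\<mu> \<cdot>\<^sub>m fiedler_prod n m r Ac A E B C \<tau> - fiedler_prod n m r Ac A E B C \<sigma> \<in> carrier_mat ?N ?N"
    by (rule minus_carrier_mat[OF Fs])
  have tT: "transpose_mat (\<mu> \<cdot>\<^sub>m fiedler_prod n m r Ac A E B C \<tau> - fiedler_prod n m r Ac A E B C \<sigma>) =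
    \<mu> \<cdot>\<^sub>m transpose_mat (fiedler_prod n m r Ac A E B C \<tau>) - transpose_mat (fiedler_prod n m r Ac A E B C \<sigma>)"
    using transpose_minus[OF smult_carrier_mat[OF Ft] Fs] by (simp add: transpose_smult)
  have tF: "transpose_mat (fiedler_prod n m r Ac A E B C t) = fiedler_prod n m r (\<lambda>i. transpose_mat (Ac i))
      (transpose_mat A) (transpose_mat E) (transpose_mat C) (transpose_mat B) (rev t)"
    if "set t \<subseteq> {- int m..int m - 1}" for t
    by (rule transpose_fiedler_prod[OF Ac m that])
  note tF = tF[OF rng(5)] tF[OF rng(6)]
  let ?t = "transpose_mat :: complex mat \<Rightarrow> complex mat"
  let ?K1 = "elem_prod n m r \<tau>1 Y1" and ?K2 = "elem_prod n m r \<sigma>1 X1"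
    and ?K3 = "elem_prod n m r \<sigma>2 X2" and ?K4 = "elem_prod n m r \<tau>2 Y2"
    and ?T = "\<mu> \<cdot>\<^sub>m fiedler_prod n m r Ac A E B C \<tau> - fiedler_prod n m r Ac A E B C \<sigma>"
  have "?t ((?K1 * ?K2) * ?T * (?K3 * ?K4)) = ?t (?K3 * ?K4) * ?t ((?K1 * ?K2) * ?T)"
    by (rule transpose_mult[OF mult_carrier_mat[OF mult_carrier_mat[OF c(3,1)] T] mult_carrier_mat[OF c(2,4)]])
  also have "?t (?K3 * ?K4) = ?t ?K4 * ?t ?K3" by (rule transpose_mult[OF c(2,4)])
  also have "?t ((?K1 * ?K2) * ?T) = ?t ?T * ?t (?K1 * ?K2)" by (rule transpose_mult[OF mult_carrier_mat[OF c(3,1)] T])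
  also have "?t (?K1 * ?K2) = ?t ?K2 * ?t ?K1" by (rule transpose_mult[OF c(3,1)])
  (* Reversal has swapped the left and the right factor, in the order that a pencil prescribes. *)
  also have "(?t ?K4 * ?t ?K3) * (?t ?T * (?t ?K2 * ?t ?K1)) = (?t ?K4 * ?t ?K3) * ?t ?T * (?t ?K2 * ?t ?K1)"
  proof (rule assoc_mult_mat[symmetric])
    show "?t ?K4 * ?t ?K3 \<in> carrier_mat ?N ?N" "?t ?K2 * ?t ?K1 \<in> carrier_mat ?N ?N" "?t ?T \<in> carrier_mat ?N ?N"
      using c T by (auto simp del: minus_carrier_mat)
  qed
  finally show ?thesis
    unfolding gfpr_def tT tF
      transpose_elem_prod[OF asg(1) m rng(1)] transpose_elem_prod[OF asg(2) m rng(2)]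
      transpose_elem_prod[OF asg(3) m rng(3)] transpose_elem_prod[OF asg(4) m rng(4)] .
qed

end

section \<open>Recovery of bases\<close>

context pencil_at
begin

lemma gfpr_recovers_kernel_basis:
  assumes Ac: "\<And>i. i \<le> m \<Longrightarrow> Ac i \<in> carrier_mat n n" and m: "m \<ge> 1"
    and gfpr: "gfpr_data n m h \<sigma> \<tau> \<sigma>1 \<sigma>2 \<tau>1 \<tau>2 X1 X2 Y1 Y2"
    and ns: "nonsingular_assignment m \<sigma>1 X1" "nonsingular_assignment m \<sigma>2 X2"
      "nonsingular_assignment m \<tau>1 Y1" "nonsingular_assignment m \<tau>2 Y2"
    and Z: "Zmn \<in> carrier_mat (m * n) p" "Zr \<in> carrier_mat r p"
    and basis: "columns_form_basis (Zmn @\<^sub>r Zr) (mat_kernel (gfpr n m r Ac A E B C \<sigma> \<tau> \<sigma>1 \<sigma>2 \<tau>1 \<tau>2 X1 X2 Y1 Y2 \<mu>))"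
  shows "columns_form_basis ((kron (transpose_mat (unit_col m (m - c0 (\<sigma> @ \<sigma>2)))) (1\<^sub>m n) * Zmn) @\<^sub>r Zr)
    (mat_kernel (sys_mat n m Ac A E B C \<mu>))"
proof -
  let ?j = "m - c0 (\<sigma> @ \<sigma>2)" and ?L = "gfpr n m r Ac A E B C \<sigma> \<tau> \<sigma>1 \<sigma>2 \<tau>1 \<tau>2 X1 X2 Y1 Y2 \<mu>"
  have bij: "1 \<le> ?j" "?j \<le> m" "?L \<in> carrier_mat (m * n + r) (m * n + r)"
    "bij_betw (\<lambda>x. block_selector n m r ?j *\<^sub>v x) (mat_kernel ?L) (mat_kernel (sys_mat n m Ac A E B C \<mu>))"
    by (rule gfpr_kernel_bij[OF _ m gfpr ns], erule Ac)+
  note sel = block_selector_action[OF bij(1,2)]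
  show ?thesis
    using columns_form_basis_transport[OF sel(1) bij(3) sys_mat_carrier bij(4) carrier_append_rows[OF Z] basis]
    unfolding sel(3)[OF Z] .
qed

end

theorem theorem5p4:
  fixes n m r h p :: nat
    and Ac :: "nat \<Rightarrow> complex mat"
    and A E B C :: "complex mat"
    and \<sigma> \<tau> \<sigma>1 \<sigma>2 \<tau>1 \<tau>2 :: "int list"
    and X1 X2 Y1 Y2 :: "complex mat list"
    and S L :: "complex \<Rightarrow> complex mat"
    and \<mu> :: complex
    and Z Zmn Zr :: "complex mat"
  assumes "m \<ge> 1"
    and "\<And>i. i \<le> m \<Longrightarrow> Ac i \<in> carrier_mat n n"
    and "Ac m \<noteq> 0\<^sub>m n n"
    and "minimal_realization n m r Ac A E B C"
    and S: "S = sys_mat n m Ac A E B C"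
    and "gfpr_data n m h \<sigma> \<tau> \<sigma>1 \<sigma>2 \<tau>1 \<tau>2 X1 X2 Y1 Y2"
    and "nonsingular_assignment m \<sigma>1 X1" and "nonsingular_assignment m \<sigma>2 X2"
    and "nonsingular_assignment m \<tau>1 Y1" and "nonsingular_assignment m \<tau>2 Y2"
    and L: "L = gfpr n m r Ac A E B C \<sigma> \<tau> \<sigma>1 \<sigma>2 \<tau>1 \<tau>2 X1 X2 Y1 Y2"
    and regular: "\<exists>lam. det (S lam) \<noteq> 0"
    and eigenvalue: "det (S \<mu>) = 0"
    and "Zmn \<in> carrier_mat (m * n) p" and "Zr \<in> carrier_mat r p"
    and Z: "Z = Zmn @\<^sub>r Zr"
    and "vec_space.rank (m * n + r) Z = p"
  shows "(columns_form_basis Z (right_null_space (L \<mu>)) \<longrightarrow>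
            columns_form_basis
              ((kron (transpose_mat (unit_col m (m - c0 (\<sigma> @ \<sigma>2)))) (1\<^sub>m n) * Zmn) @\<^sub>r Zr)
              (right_null_space (S \<mu>))) \<and>
         (columns_form_basis Z (left_null_space (L \<mu>)) \<longrightarrow>
            columns_form_basis
              ((kron (transpose_mat (unit_col m (m - i0 (\<sigma>1 @ \<sigma>)))) (1\<^sub>m n) * Zmn) @\<^sub>r Zr)
              (left_null_space (S \<mu>)))"
proof -
  note m = assms(1) and Ac = assms(2) and gfpr = assms(6) and ns = assms(7-10) and ZZ = assms(14,15)
  interpret pencil_at n r A E B C \<mu>
    using assms(4) by unfold_locales (auto simp: minimal_realization_def realization_data_def)
  interpret T: pencil_at n r "transpose_mat A" "transpose_mat E" "transpose_mat C" "transpose_mat B" \<mu>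
    by unfold_locales simp_all
  have Ac': "transpose_mat (Ac i) \<in> carrier_mat n n" if "i \<le> m" for i using Ac[OF that] by simp
  have asg: "matrix_assignment n \<sigma>1 X1" "matrix_assignment n \<sigma>2 X2"
      "matrix_assignment n \<tau>1 Y1" "matrix_assignment n \<tau>2 Y2"
    using gfpr by (auto simp: gfpr_data_def)
  note ns' = nonsingular_assignment_rev[OF asg(1) ns(1)] nonsingular_assignment_rev[OF asg(2) ns(2)]
    nonsingular_assignment_rev[OF asg(3) ns(3)] nonsingular_assignment_rev[OF asg(4) ns(4)]
  show ?thesis
  proof (intro conjI impI)
    assume right: "columns_form_basis Z (right_null_space (L \<mu>))"
    show "columns_form_basis ((kron (transpose_mat (unit_col m (m - c0 (\<sigma> @ \<sigma>2)))) (1\<^sub>m n) * Zmn) @\<^sub>r Zr)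
        (right_null_space (S \<mu>))"
      unfolding S by (rule gfpr_recovers_kernel_basis[OF _ m gfpr ns ZZ right[unfolded L Z]], erule Ac)
  next
    assume left: "columns_form_basis Z (left_null_space (L \<mu>))"
    have tL: "transpose_mat (L \<mu>) = gfpr n m r (\<lambda>i. transpose_mat (Ac i)) (transpose_mat A) (transpose_mat E)
      (transpose_mat C) (transpose_mat B) (rev \<sigma>) (rev \<tau>) (rev \<sigma>2) (rev \<sigma>1) (rev \<tau>2) (rev \<tau>1)
      (rev (map transpose_mat X2)) (rev (map transpose_mat X1)) (rev (map transpose_mat Y2)) (rev (map transpose_mat Y1)) \<mu>"
      unfolding L by (rule transpose_gfpr[OF Ac m gfpr])
    have tS: "transpose_mat (S \<mu>) = sys_mat n m (\<lambda>i. transpose_mat (Ac i)) (transpose_mat A) (transpose_mat E)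
      (transpose_mat C) (transpose_mat B) \<mu>"
      unfolding S by (rule transpose_sys_mat[OF Ac])
    have idx: "i0 (\<sigma>1 @ \<sigma>) = c0 (rev \<sigma> @ rev \<sigma>1)" by (simp add: i0_eq_c0_rev)
    show "columns_form_basis ((kron (transpose_mat (unit_col m (m - i0 (\<sigma>1 @ \<sigma>)))) (1\<^sub>m n) * Zmn) @\<^sub>r Zr)
        (left_null_space (S \<mu>))"
      unfolding left_null_space_eq tS idx
      by (rule T.gfpr_recovers_kernel_basis[OF _ m gfpr_data_rev[OF gfpr] ns'(2,1,4,3) ZZ
            left[unfolded left_null_space_eq tL Z]], erule Ac')
  qed
qed

end
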